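(* Let $n\geq 2$ and let $B(\cdot)$ be a standard Brownian motion in $\mathbb{R}^n$. Let $K=\operatorname{Conv}(\{B(t):0\leq t\leq 1\})$. Then almost surely $K$ is smooth, i.e. for every boundary point $x\in\partial K$ the supporting hyperplane to $K$ at $x$ is unique.
   Context: $\operatorname{Conv}$ denotes the convex hull. A point $x\in\partial K$ of a convex set $K$ is called singular if the supporting hyperplane to $K$ at $x$ is not unique; $K$ is smooth if none of its boundary points are singular. *)

theory Defs
  imports "HOL-Probability.Probability"
begin

definition gaussian_vec_density :: "real \<Rightarrow> real ^ 'n \<Rightarrow> real" where
  "gaussian_vec_density s x = (\<Prod>i\<in>UNIV. normal_density 0 s (x $ i))"

definition standard_brownian_motion ::
  "'w measure \<Rightarrow> (real \<Rightarrow> 'w \<Rightarrow> real ^ 'n) \<Rightarrow> bool" where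
  "standard_brownian_motion M B \<longleftrightarrow>
     prob_space M \<and>
     (\<forall>t\<ge>0. B t \<in> borel_measurable M) \<and>
     (\<forall>\<omega>\<in>space M. B 0 \<omega> = 0) \<and>
     (AE \<omega> in M. continuous_on {0..} (\<lambda>t. B t \<omega>)) \<and>
     (\<forall>s t. 0 \<le> s \<and> s < t \<longrightarrow>
        distributed M lborel (\<lambda>\<omega>. B t \<omega> - B s \<omega>) (\<lambda>x. ennreal (gaussian_vec_density (sqrt (t - s)) x))) \<and>
     (\<forall>(ts :: nat \<Rightarrow> real) k. 0 \<le> ts 0 \<and> strict_mono ts \<longrightarrow>
        prob_space.indep_vars M (\<lambda>_. borel) (\<lambda>i \<omega>. B (ts (Suc i)) \<omega> - B (ts i) \<omega>) {..<k})"

definition supporting_hyperplane_at :: "'a::real_inner set \<Rightarrow> 'a \<Rightarrow> 'a set \<Rightarrow> bool" where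
  "supporting_hyperplane_at K x H \<longleftrightarrow>
     (\<exists>a. a \<noteq> 0 \<and> H = {y. a \<bullet> y = a \<bullet> x} \<and> (\<forall>y\<in>K. a \<bullet> y \<le> a \<bullet> x))"

definition smooth_convex :: "'a::real_inner set \<Rightarrow> bool" where
  "smooth_convex K \<longleftrightarrow> (\<forall>x\<in>frontier K. \<exists>!H. supporting_hyperplane_at K x H)"

end

theory Submission
  imports Defs
begin

text \<open>
  If the hull \<open>K\<close> has two supporting hyperplanes at a point, then some \<open>B t\<close> is the vertex of a wedge
  \<open>{y. a\<^sub>1 \<bullet> y \<le> 0 \<and> a\<^sub>2 \<bullet> y \<le> 0}\<close>, with \<open>a\<^sub>1\<close>, \<open>a\<^sub>2\<close> not parallel, that contains the whole path.
  Choose \<open>e\<close> from a countable dense set with \<open>a\<^sub>1 \<bullet> e > 0 > a\<^sub>2 \<bullet> e\<close> and rotate \<open>e\<close> to a coordinate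
  vector. Write \<open>Y\<close> for the coordinate of \<open>B\<close> along \<open>e\<close> and \<open>X\<close> for the projection to the orthogonal
  complement of \<open>e\<close>; these are independent. A positive combination of \<open>a\<^sub>1\<close> and \<open>a\<^sub>2\<close> is orthogonal to \<open>e\<close>,
  so on a grid of mesh \<open>1/N\<close> there is a vertex \<open>i\<close> of the hull of the walk \<open>X\<close> at which
  \<open>|Y\<^sub>j - Y\<^sub>i| \<le> R (|X\<^sub>j - X\<^sub>i| + \<epsilon>)\<close> for all \<open>j\<close>, with \<open>\<epsilon>\<close> a negative power of \<open>N\<close>.

  The expected number of facets of the hull of an \<open>N\<close>-step random walk is only polylogarithmic in \<open>N\<close>:
  cyclically shifting the increments between consecutive vertices of a facet, and cutting the rest
  of the walk at another place, keeps the normal of the facet, and by uniqueness of the maximum at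
  most one of the rearranged walks is on the right side of it.
  Given \<open>X\<close>, at each candidate vertex the inequality restricts the increments of \<open>Y\<close> over
  a positive fraction of about \<open>log N\<close> scales, each with conditional probability bounded away from 1.
  Hence it holds with probability at most a negative power of \<open>N\<close>, which beats the number of candidates.
\<close>

section \<open>Measure-theoretic preliminaries\<close>

text \<open>The order in which the constants are chosen dictates the shape of the proof. The grid
  has N = 64^K steps, and the K time scales are 4^-l. The size bound on the scale increments has to
  hold at all N + 1 grid points at once, which forces a large \<open>C\<close>. Only then is the
  constant \<rho> = R (32 C + 2) known that restricts Y, and the gain per scale,
  \<open>sqrt (small_prob \<rho>)\<close>, is merely some number below 1. The total gain is thus a
  power of N with a possibly tiny exponent, and a union bound over all grid points would lose
  against it. Only a family of candidates growing more slowly than every power of N can be afforded;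
  the facets provide one.

  The base 64 = 4^3 comes from continuity: replacing a time in [0,1] by a grid time costs 4
  (3/4)^(3K) = 4 (27/64)^K \<le> 4 / 2^K, which is of the spatial order of the finest scale 4^-K.
  The base 16 would only give (9/16)^K.

  For a fixed R the probability of the grid condition tends to 0, whereas a corner makes it hold for
  some integer R and all large K.\<close>

lemma sets_ex_compact:
  fixes g :: "'a \<Rightarrow> 'b::{metric_space, second_countable_topology} \<Rightarrow> real"
  assumes K: "compact K"
    and meas: "\<And>u. u \<in> K \<Longrightarrow> (\<lambda>x. g x u) \<in> borel_measurable M"
    and cont: "\<And>x. x \<in> space M \<Longrightarrow> continuous_on K (g x)"
  shows "{x \<in> space M. \<exists>u\<in>K. g x u \<le> 0} \<in> sets M"
proof -
  obtain D where D: "countable D" "D \<subseteq> K" "K \<subseteq> closure D"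
    using separable by blast
  \<comment> \<open>A continuous function on a compact set attains its infimum, so a value at most 0
    exists iff the infimum is at most 0, and a countable dense set sees the infimum.\<close>
  have "{x \<in> space M. \<exists>u\<in>K. g x u \<le> 0} =
        {x \<in> space M. \<forall>n::nat. \<exists>u\<in>D. g x u < inverse (real (Suc n))}" (is "?L = ?R")
  proof (intro equalityI subsetI)
    fix x assume "x \<in> ?L"
    then obtain u where x: "x \<in> space M" and u: "u \<in> K" "g x u \<le> 0" by auto
    have "\<exists>v\<in>D. g x v < inverse (real (Suc n))" for n :: nat
    proof -
      obtain d where d: "d > 0" "\<And>v. v \<in> K \<Longrightarrow> dist v u < d \<Longrightarrow> dist (g x v) (g x u) < inverse (real (Suc n))"
        using cont[OF x] u(1) unfolding continuous_on_iff
        by (metis inverse_positive_iff_positive of_nat_0_less_iff zero_less_Suc)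
      obtain v where "v \<in> D" "dist v u < d"
        using D(3) u(1) d(1) by (meson closure_approachable subsetD)
      then show ?thesis using d(2)[of v] D(2) u(2)
        by (intro bexI[of _ v]) (auto simp: dist_real_def)
    qed
    then show "x \<in> ?R" using x by auto
  next
    fix x assume "x \<in> ?R"
    then have x: "x \<in> space M" and *: "\<And>n::nat. \<exists>u\<in>D. g x u < inverse (real (Suc n))" by auto
    have "K \<noteq> {}" using *[of 0] D(2) by auto
    then obtain u where u: "u \<in> K" "\<And>v. v \<in> K \<Longrightarrow> g x u \<le> g x v"
      using continuous_attains_inf[OF K _ cont[OF x]] by blast
    have "g x u \<le> 0"
    proof (rule ccontr)
      assume "\<not> g x u \<le> 0"
      then obtain n where "inverse (real (Suc n)) < g x u"
        using reals_Archimedean by (metis not_le)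
      moreover obtain v where "v \<in> D" "g x v < inverse (real (Suc n))" using * by blast
      ultimately show False using u(2)[of v] D(2) by auto
    qed
    then show "x \<in> ?L" using x u by auto
  qed
  also have "\<dots> \<in> sets M"
  proof -
    have "{x \<in> space M. \<exists>u\<in>D. g x u < inverse (real (Suc n))} \<in> sets M" for n
      using D meas by (intro sets.sets_Collect_countable_Ex') auto
    then show ?thesis by (intro sets.sets_Collect_countable_All)
  qed
  finally show ?thesis .
qed

text \<open>Uniqueness of Haar measure, in the one instance needed: both measures agree on the unit ball.\<close>

lemma distr_lborel_orthogonal:
  fixes f :: "'a::euclidean_space \<Rightarrow> 'a"
  assumes f: "orthogonal_transformation f"
  shows "distr lborel borel f = lborel"
proof -
  have lin: "linear f" using f by (simp add: orthogonal_transformation_linear)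
  have [measurable]: "f \<in> borel_measurable borel"
    using lin by (intro borel_measurable_continuous_onI linear_continuous_on)
      (simp add: linear_conv_bounded_linear)
  define \<mu> where "\<mu> = distr lborel borel f"
  have sets_mu[measurable_cong]: "sets \<mu> = sets borel" and space_mu: "space \<mu> = UNIV"
    by (simp_all add: \<mu>_def)
  have nn: "(\<integral>\<^sup>+y. h y \<partial>\<mu>) = (\<integral>\<^sup>+y. h (f y) \<partial>lborel)" if "h \<in> borel_measurable borel" for h
    unfolding \<mu>_def using that by (subst nn_integral_distr) auto
  have shift_l: "(\<integral>\<^sup>+y. h (y + a) \<partial>lborel) = (\<integral>\<^sup>+y. h y \<partial>lborel)"
    if [measurable]: "h \<in> borel_measurable borel" for h :: "'a \<Rightarrow> ennreal" and a :: 'a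
    using nn_integral_distr[of "(+) a" lborel borel h] lborel_distr_plus[of a]
    by (simp add: add.commute[of a])
  have shift_mu: "(\<integral>\<^sup>+y. h (y + a) \<partial>\<mu>) = (\<integral>\<^sup>+y. h y \<partial>\<mu>)"
    if h[measurable]: "h \<in> borel_measurable borel" for h :: "'a \<Rightarrow> ennreal" and a :: 'a
  proof -
    \<comment> \<open>Translating the image by \<open>a\<close> amounts to translating the source by
      a preimage \<open>b\<close> of \<open>a\<close>.\<close>
    obtain b where b: "f b = a" using orthogonal_transformation_surj[OF f] by (metis surjD)
    have "(\<integral>\<^sup>+y. h (y + a) \<partial>\<mu>) = (\<integral>\<^sup>+y. h (f (y + b)) \<partial>lborel)"
      by (subst nn) (auto simp: linear_add[OF lin] b)
    also have "\<dots> = (\<integral>\<^sup>+y. h (f y) \<partial>lborel)" by (rule shift_l) measurable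
    also have "\<dots> = (\<integral>\<^sup>+y. h y \<partial>\<mu>)" by (simp add: nn)
    finally show ?thesis .
  qed
  let ?B = "ball (0::'a) 1"
  have fB: "f -` ?B = ?B"
    using orthogonal_transformation_norm[OF f] by auto
  have muB: "emeasure \<mu> ?B = emeasure lborel ?B"
    unfolding \<mu>_def by (subst emeasure_distr) (auto simp: fB)
  interpret mu: sigma_finite_measure \<mu>
  proof (unfold_locales, intro exI conjI)
    let ?C = "range (\<lambda>n::nat. ball (0::'a) (real n))"
    show "countable ?C" by simp
    show "?C \<subseteq> sets \<mu>" by auto
    show "\<Union> ?C = space \<mu>" by (auto simp: space_mu) (metis real_arch_simple reals_Archimedean2)
    have "f -` ball 0 (real n) = ball 0 (real n)" for n
      using orthogonal_transformation_norm[OF f] by auto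
    then show "\<forall>a\<in>?C. emeasure \<mu> a \<noteq> \<infinity>"
      using emeasure_lborel_ball_finite[of "0::'a"]
      by (auto simp: \<mu>_def emeasure_distr less_top[symmetric])
  qed
  have pair_meas: "h \<in> borel_measurable (\<mu> \<Otimes>\<^sub>M lborel)" "h \<in> borel_measurable (lborel \<Otimes>\<^sub>M \<mu>)"
    if "h \<in> borel_measurable (borel \<Otimes>\<^sub>M borel)" for h :: "'a \<times> 'a \<Rightarrow> ennreal"
    using that by (simp_all add: sets_mu cong: measurable_cong_sets sets_pair_measure_cong)
  have B_sets[measurable]: "?B \<in> sets borel" by simp
  interpret lb: sigma_finite_measure "lborel :: 'a measure" by (rule sigma_finite_lborel)
  interpret P: pair_sigma_finite "\<mu>" "lborel :: 'a measure" ..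
  interpret P': pair_sigma_finite "lborel :: 'a measure" "\<mu>" ..
  have "emeasure lborel A = emeasure \<mu> A" if A[measurable]: "A \<in> sets borel" for A :: "'a set"
  proof -
    let ?f = "indicator ?B :: 'a \<Rightarrow> ennreal" and ?g = "indicator A :: 'a \<Rightarrow> ennreal"
    \<comment> \<open>The integral of 1_B(x) 1_A(y + x) is evaluated in both orders. Translation
      invariance of each measure, and the symmetry of the ball under negation, turn it into |B|
      \<mu>(A) and into \<mu>(B) |A|; the two masses of the ball agree and are finite and
      positive.\<close>
    have "emeasure lborel ?B * emeasure \<mu> A = (\<integral>\<^sup>+x. ?f x * (\<integral>\<^sup>+y. ?g y \<partial>\<mu>) \<partial>lborel)"
      by (subst nn_integral_multc) (auto intro!: borel_measurable_indicator)
    also have "\<dots> = (\<integral>\<^sup>+x. ?f x * (\<integral>\<^sup>+y. ?g (y + x) \<partial>\<mu>) \<partial>lborel)"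
      by (subst shift_mu) auto
    also have "\<dots> = (\<integral>\<^sup>+x. (\<integral>\<^sup>+y. ?f x * ?g (y + x) \<partial>\<mu>) \<partial>lborel)"
      by (intro nn_integral_cong, subst nn_integral_cmult) auto
    also have "\<dots> = (\<integral>\<^sup>+y. (\<integral>\<^sup>+x. ?f x * ?g (y + x) \<partial>lborel) \<partial>\<mu>)"
      by (rule P.Fubini', rule pair_meas) measurable
    also have "\<dots> = (\<integral>\<^sup>+y. (\<integral>\<^sup>+x. ?f (x - y) * ?g x \<partial>lborel) \<partial>\<mu>)"
    proof (rule nn_integral_cong)
      fix y
      show "(\<integral>\<^sup>+x. ?f x * ?g (y + x) \<partial>lborel) = (\<integral>\<^sup>+x. ?f (x - y) * ?g x \<partial>lborel)"
        using shift_l[of "\<lambda>x. ?f (x - y) * ?g x" y] by (simp add: add.commute)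
    qed
    also have "\<dots> = (\<integral>\<^sup>+x. (\<integral>\<^sup>+y. ?f (x - y) * ?g x \<partial>\<mu>) \<partial>lborel)"
      by (rule P'.Fubini', rule pair_meas) measurable
    also have "\<dots> = (\<integral>\<^sup>+x. (\<integral>\<^sup>+y. ?f (y + (- x)) \<partial>\<mu>) * ?g x \<partial>lborel)"
    proof (intro nn_integral_cong)
      fix x
      have "?f (x - y) = ?f (y + - x)" for y
        by (auto simp: indicator_def norm_minus_commute)
      then show "(\<integral>\<^sup>+y. ?f (x - y) * ?g x \<partial>\<mu>) = (\<integral>\<^sup>+y. ?f (y + (- x)) \<partial>\<mu>) * ?g x"
        by (subst nn_integral_multc[symmetric]) auto
    qed
    also have "\<dots> = emeasure \<mu> ?B * emeasure lborel A"
      by (subst shift_mu) (auto simp: nn_integral_cmult)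
    finally have *: "emeasure lborel ?B * emeasure \<mu> A = emeasure lborel ?B * emeasure lborel A"
      by (simp add: muB)
    have "emeasure lborel ?B \<noteq> 0"
      using content_ball_pos[of 1 "0::'a"] by (auto simp: measure_def)
    moreover have "emeasure lborel ?B < \<infinity>" by (rule emeasure_lborel_ball_finite)
    ultimately show ?thesis using * by (auto simp: ennreal_mult_cancel_left)
  qed
  then show ?thesis
    by (intro measure_eqI) (auto simp: \<mu>_def[symmetric] sets_mu)
qed

text \<open>A nonzero annihilating vector can be rescaled to norm 1, so failure means that a
  continuous nonnegative function has a zero on a compact set, and \<open>sets_ex_compact\<close>
  applies.\<close>

lemma annihilator_trivial_measurable:
  fixes y :: "'i \<Rightarrow> 'b \<Rightarrow> 'a::euclidean_space"
  assumes I: "finite I" and y: "\<And>i. i \<in> I \<Longrightarrow> y i \<in> borel_measurable M"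
  shows "{x \<in> space M. \<forall>u. (\<forall>v\<in>Z. u \<bullet> v = 0) \<and> (\<forall>i\<in>I. u \<bullet> y i x = 0) \<longrightarrow> u = 0} \<in> sets M"
proof -
  let ?K = "sphere 0 1 \<inter> {u. \<forall>v\<in>Z. u \<bullet> v = 0}"
  let ?P = "\<lambda>x. \<forall>u. (\<forall>v\<in>Z. u \<bullet> v = 0) \<and> (\<forall>i\<in>I. u \<bullet> y i x = 0) \<longrightarrow> u = 0"
  have "closed {u. \<forall>v\<in>Z. u \<bullet> v = 0}"
    unfolding Ball_def by (intro closed_Collect_all closed_Collect_imp open_Collect_const closed_Collect_eq continuous_intros)
  then have K: "compact ?K" by (intro compact_Int_closed) auto
  have iff: "(\<exists>u\<in>?K. (\<Sum>i\<in>I. \<bar>u \<bullet> y i x\<bar>) \<le> 0) \<longleftrightarrow> \<not> ?P x" for x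
  proof
    assume "\<exists>u\<in>?K. (\<Sum>i\<in>I. \<bar>u \<bullet> y i x\<bar>) \<le> 0"
    then obtain u where u: "u \<in> ?K" "(\<Sum>i\<in>I. \<bar>u \<bullet> y i x\<bar>) \<le> 0" by blast
    then have "(\<Sum>i\<in>I. \<bar>u \<bullet> y i x\<bar>) = 0" by (meson abs_ge_zero order_antisym sum_nonneg)
    then have "\<forall>i\<in>I. u \<bullet> y i x = 0" using sum_nonneg_eq_0_iff[OF I, of "\<lambda>i. \<bar>u \<bullet> y i x\<bar>"] by auto
    moreover have "u \<noteq> 0" using u by auto
    ultimately show "\<not> ?P x" using u by auto
  next
    assume "\<not> ?P x"
    then obtain u where u: "u \<noteq> 0" "\<forall>v\<in>Z. u \<bullet> v = 0" "\<forall>i\<in>I. u \<bullet> y i x = 0" by auto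
    then show "\<exists>u\<in>?K. (\<Sum>i\<in>I. \<bar>u \<bullet> y i x\<bar>) \<le> 0"
      by (intro bexI[of _ "u /\<^sub>R norm u"]) auto
  qed
  have "{x \<in> space M. \<exists>u\<in>?K. (\<Sum>i\<in>I. \<bar>u \<bullet> y i x\<bar>) \<le> 0} \<in> sets M"
    using y by (intro sets_ex_compact K)
      (auto intro!: continuous_intros borel_measurable_sum borel_measurable_abs borel_measurable_inner)
  from sets.sets_Collect_neg[OF this] show ?thesis unfolding iff not_not .
qed

text \<open>The fixed vectors \<open>z i\<close> are replaced by random ones, one at a time.\<close>

lemma AE_PiM_annihilator_trivial:
  fixes N :: "'i \<Rightarrow> 'a::euclidean_space measure"
  assumes "finite I"
    and N: "\<And>i. prob_space (N i)" "\<And>i. sets (N i) = sets borel"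
    and null: "\<And>i a. a \<noteq> 0 \<Longrightarrow> AE y in N i. a \<bullet> y \<noteq> 0"
    and "\<And>u. (\<forall>v\<in>Z. u \<bullet> v = 0) \<Longrightarrow> (\<forall>i\<in>I. u \<bullet> z i = 0) \<Longrightarrow> u = 0"
  shows "AE x in PiM I N. \<forall>u. (\<forall>v\<in>Z. u \<bullet> v = 0) \<and> (\<forall>i\<in>I. u \<bullet> x i = 0) \<longrightarrow> u = 0"
  using assms(1,5)
proof (induction I arbitrary: Z rule: finite_induct)
  case empty
  then show ?case by auto
next
  case (insert i I Z)
  let ?P = "\<lambda>Z I x. \<forall>u. (\<forall>v\<in>Z. u \<bullet> v = 0) \<and> (\<forall>i\<in>I. u \<bullet> x i = 0) \<longrightarrow> u = 0"
  have meas: "{x \<in> space (PiM J N). ?P Z J x} \<in> sets (PiM J N)" if "finite J" for J Z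
  proof (rule annihilator_trivial_measurable[OF that])
    fix j assume "j \<in> J"
    then show "(\<lambda>x. x j) \<in> borel_measurable (PiM J N)"
      using measurable_component_singleton[of j J N] by (simp add: measurable_cong_sets[OF refl N(2)])
  qed
  have good: "AE y in N i. \<forall>u. (\<forall>v\<in>insert y Z. u \<bullet> v = 0) \<longrightarrow> (\<forall>i\<in>I. u \<bullet> z i = 0) \<longrightarrow> u = 0"
  proof (cases "\<exists>a. a \<noteq> 0 \<and> (\<forall>v\<in>Z. a \<bullet> v = 0) \<and> (\<forall>i\<in>I. a \<bullet> z i = 0)")
    \<comment> \<open>Dropping the single constraint from \<open>z i\<close> leaves an annihilator
      of dimension at most 1. It is the line spanned by \<open>a\<close>, and any \<open>y\<close>
      not orthogonal to \<open>a\<close> makes it trivial again.\<close>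
    case True
    then obtain a where a: "a \<noteq> 0" "\<forall>v\<in>Z. a \<bullet> v = 0" "\<forall>i\<in>I. a \<bullet> z i = 0" by blast
    have az: "a \<bullet> z i \<noteq> 0" using insert.prems[of a] a by auto
    show ?thesis using null[OF a(1)]
    proof (rule AE_mp, intro AE_I2 impI allI)
      fix y u assume y: "a \<bullet> y \<noteq> 0" and u: "\<forall>v\<in>insert y Z. u \<bullet> v = 0" "\<forall>i\<in>I. u \<bullet> z i = 0"
      \<comment> \<open>\<open>?b\<close> is the combination of \<open>u\<close> and
        \<open>a\<close> that is also orthogonal to \<open>z i\<close>, so the hypothesis on the
        fixed vectors makes it 0.\<close>
      let ?b = "(a \<bullet> z i) *\<^sub>R u - (u \<bullet> z i) *\<^sub>R a"
      have "?b = 0"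
        by (rule insert.prems) (use a u in \<open>auto simp: inner_simps\<close>)
      then have "?b \<bullet> y = 0" by simp
      then have "u \<bullet> z i = 0" using y u by (simp add: inner_simps)
      then show "u = 0" using \<open>?b = 0\<close> az by simp
    qed
  next
    case False
    then show ?thesis by (intro AE_I2) blast
  qed
  interpret PI: prob_space "PiM I N" by (rule prob_space_PiM) (rule N)
  interpret Ni: prob_space "N i" by (rule N)
  interpret PP: pair_sigma_finite "N i" "PiM I N" ..
  let ?f = "\<lambda>(y, X). X(i := y)"
  have fm: "?f \<in> N i \<Otimes>\<^sub>M PiM I N \<rightarrow>\<^sub>M PiM (insert i I) N"
    unfolding split_beta' by (rule measurable_fun_upd[where J=I]) auto
  have fin: "finite (insert i I)" using insert by simp
  have "AE p in N i \<Otimes>\<^sub>M PiM I N. ?P Z (insert i I) (?f p)"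
  proof -
    have m: "{p \<in> space (N i \<Otimes>\<^sub>M PiM I N). ?P Z (insert i I) (?f p)} \<in> sets (N i \<Otimes>\<^sub>M PiM I N)"
      by (rule measurable_sets_Collect[OF fm meas[OF fin]])
    show ?thesis
    proof (rule PP.AE_pair_measure[OF m])
      show "AE y in N i. AE X in PiM I N. ?P Z (insert i I) (?f (y, X))"
        using good
      proof eventually_elim
        case (elim y)
        then have "AE X in PiM I N. ?P (insert y Z) I X"
          by (intro insert.IH) blast
        then show ?case
        proof (rule AE_mp, intro AE_I2 impI allI)
          fix X u assume X: "?P (insert y Z) I X" and
            u: "(\<forall>v\<in>Z. u \<bullet> v = 0) \<and> (\<forall>k\<in>insert i I. u \<bullet> ?f (y, X) k = 0)"
          have "\<forall>k\<in>I. u \<bullet> X k = 0"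
          proof
            fix k assume "k \<in> I"
            then have "k \<noteq> i" using insert.hyps by auto
            then show "u \<bullet> X k = 0" using u \<open>k \<in> I\<close> by auto
          qed
          then show "u = 0" using X u by auto
        qed
      qed
    qed
  qed
  then have "AE x in distr (N i \<Otimes>\<^sub>M PiM I N) (PiM (insert i I) N) ?f. ?P Z (insert i I) x"
    using AE_distr_iff[OF fm meas[OF fin]] by blast
  then show ?case
    by (subst (asm) distr_pair_PiM_eq_PiM) (use N insert in auto)
qed

lemma (in prob_space) indep_vars_reindex:
  assumes X: "indep_vars M' X J" and h: "inj_on h I" "h ` I \<subseteq> J"
  shows "indep_vars (\<lambda>i. M' (h i)) (\<lambda>i. X (h i)) I"
proof -
  have rv: "\<And>i. i \<in> I \<Longrightarrow> random_variable (M' (h i)) (X (h i))" using X h unfolding indep_vars_def2 by auto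
  have ind: "indep_sets (\<lambda>i. { X i -` A \<inter> space M | A. A \<in> sets (M' i)}) J"
    using X unfolding indep_vars_def2 by auto
  have "indep_sets (\<lambda>i. { X (h i) -` A \<inter> space M | A. A \<in> sets (M' (h i))}) I"
    unfolding indep_sets_def
  proof (intro conjI ballI allI impI)
    fix i assume "i \<in> I"
    then show "{X (h i) -` A \<inter> space M |A. A \<in> sets (M' (h i))} \<subseteq> events"
      using rv by auto
  next
    fix L A assume L: "L \<subseteq> I" "L \<noteq> {}" "finite L" and A: "A \<in> (\<Pi> i\<in>L. {X (h i) -` A \<inter> space M |A. A \<in> sets (M' (h i))})"
    have inj: "inj_on h L" using h L by (meson inj_on_subset)
    let ?A = "\<lambda>k. A (the_inv_into L h k)"
    have e: "\<And>i. i \<in> L \<Longrightarrow> ?A (h i) = A i" using inj by (simp add: the_inv_into_f_f)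
    have "prob (\<Inter>k\<in>h ` L. ?A k) = (\<Prod>k\<in>h ` L. prob (?A k))"
    proof (rule indep_setsD[OF ind])
      show "h ` L \<subseteq> J" using L h by blast
    qed (use L A in \<open>auto simp: e\<close>)
    then show "prob (\<Inter>j\<in>L. A j) = (\<Prod>j\<in>L. prob (A j))"
      using inj by (simp add: prod.reindex e)
  qed
  then show ?thesis using rv unfolding indep_vars_def2 by auto
qed

text \<open>Written through the norm, the density is visibly invariant under orthogonal
  maps.\<close>

lemma gaussian_vec_density_eq:
  "gaussian_vec_density s (x :: real ^ 'n) = (1 / sqrt (2 * pi * s\<^sup>2)) ^ CARD('n) * exp (- (norm x)\<^sup>2 / (2 * s\<^sup>2))"
proof -
  have "(\<Sum>i\<in>UNIV. - (x $ i)\<^sup>2 / (2 * s\<^sup>2)) = - (norm x)\<^sup>2 / (2 * s\<^sup>2)"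
    by (simp add: norm_vec_def L2_set_def sum_nonneg sum_negf sum_divide_distrib)
  then show ?thesis
    by (simp add: gaussian_vec_density_def normal_density_def prod.distrib exp_sum[symmetric] prod_dividef power_one_over)
qed

lemma borel_measurable_gaussian_vec_density[measurable]:
  "gaussian_vec_density s \<in> borel_measurable borel"
  unfolding gaussian_vec_density_eq[abs_def] by measurable

lemma standard_brownian_motion_orthogonal:
  fixes f :: "real ^ 'n \<Rightarrow> real ^ 'n"
  assumes B: "standard_brownian_motion M B" and f: "orthogonal_transformation f"
  shows "standard_brownian_motion M (\<lambda>t \<omega>. f (B t \<omega>))"
proof -
  have lin: "linear f" using f by (simp add: orthogonal_transformation_linear)
  have cf: "continuous_on A f" for A
    using lin by (intro linear_continuous_on) (simp add: linear_conv_bounded_linear)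
  have [measurable]: "f \<in> borel_measurable borel"
    by (intro borel_measurable_continuous_onI cf)
  interpret prob_space M using B by (simp add: standard_brownian_motion_def)
  have [measurable]: "\<And>t. 0 \<le> t \<Longrightarrow> B t \<in> borel_measurable M" using B by (simp add: standard_brownian_motion_def)
  have diff: "f x - f y = f (x - y)" for x y by (simp add: linear_diff[OF lin])
  have nf: "norm (f x) = norm x" for x by (rule orthogonal_transformation_norm[OF f])
  have distr: "distributed M lborel (\<lambda>\<omega>. f (B t \<omega> - B s \<omega>)) (\<lambda>x. ennreal (gaussian_vec_density (sqrt (t - s)) x))"
    if st: "0 \<le> s" "s < t" for s t
  proof -
    let ?g = "\<lambda>x::real^'n. ennreal (gaussian_vec_density (sqrt (t - s)) x)"
    have D: "distributed M lborel (\<lambda>\<omega>. B t \<omega> - B s \<omega>) ?g"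
      using B st by (auto simp: standard_brownian_motion_def)
    have m[measurable]: "(\<lambda>\<omega>. B t \<omega> - B s \<omega>) \<in> borel_measurable M"
      using st by (intro borel_measurable_diff) auto
    have "distr M lborel (\<lambda>\<omega>. f (B t \<omega> - B s \<omega>)) = distr (distr M lborel (\<lambda>\<omega>. B t \<omega> - B s \<omega>)) lborel f"
      by (subst distr_distr) (auto simp: comp_def)
    also have "\<dots> = distr (density lborel ?g) lborel f"
      by (simp add: distributed_distr_eq_density[OF D])
    also have "\<dots> = distr (density lborel (\<lambda>x. ?g (f x))) lborel f"
      by (simp add: gaussian_vec_density_eq nf)
    also have "\<dots> = density (distr lborel borel f) ?g"
      by (subst density_distr) (auto cong: distr_cong)
    also have "\<dots> = density lborel ?g"
      by (simp add: distr_lborel_orthogonal[OF f])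
    finally show ?thesis unfolding distributed_def by auto
  qed
  show ?thesis
    unfolding standard_brownian_motion_def diff
  proof (intro conjI allI impI ballI)
    show "prob_space M" by (rule prob_space_axioms)
    show "(\<lambda>\<omega>. f (B t \<omega>)) \<in> borel_measurable M" if "0 \<le> t" for t using that by measurable
    show "f (B 0 \<omega>) = 0" if "\<omega> \<in> space M" for \<omega>
      using B that linear_0[OF lin] by (simp add: standard_brownian_motion_def)
    have "AE \<omega> in M. continuous_on {0..} (\<lambda>t. B t \<omega>)" using B by (simp add: standard_brownian_motion_def)
    then show "AE \<omega> in M. continuous_on {0..} (\<lambda>t. f (B t \<omega>))"
      by (rule AE_mp) (auto intro!: AE_I2 continuous_on_compose2[OF cf[of UNIV]])
    show "distributed M lborel (\<lambda>\<omega>. f (B t \<omega> - B s \<omega>)) (\<lambda>x. ennreal (gaussian_vec_density (sqrt (t - s)) x))"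
      if "0 \<le> s \<and> s < t" for s t using distr that by auto
    show "indep_vars (\<lambda>_. borel) (\<lambda>i \<omega>. f (B (ts (Suc i)) \<omega> - B (ts i) \<omega>)) {..<k}"
      if "0 \<le> ts 0 \<and> strict_mono ts" for ts :: "nat \<Rightarrow> real" and k
    proof -
      have "indep_vars (\<lambda>_. borel) (\<lambda>i \<omega>. B (ts (Suc i)) \<omega> - B (ts i) \<omega>) {..<k}"
        using B that unfolding standard_brownian_motion_def by blast
      then show ?thesis by (rule indep_vars_compose2[where Y="\<lambda>_. f"]) auto
    qed
  qed
qed

section \<open>Faces of the convex hull of a walk\<close>

definition psum :: "(nat \<Rightarrow> 'a::comm_monoid_add) \<Rightarrow> nat \<Rightarrow> 'a" where
  "psum x k = (\<Sum>i<k. x i)"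

text \<open>For nonzero \<open>e\<close>: \<open>J\<close> lies in a common face of the hull of the
  walk projected along \<open>e\<close>. Normals orthogonal to \<open>e\<close> do not see the
  component along \<open>e\<close>, so the projection itself is never formed. The projected hull
  lives in dimension \<open>DIM('a) - 1\<close>, and in general position its facets have that many
  vertices.\<close>

definition supp_face :: "'a::euclidean_space \<Rightarrow> nat \<Rightarrow> nat set \<Rightarrow> (nat \<Rightarrow> 'a) \<Rightarrow> bool" where
  "supp_face e N J x \<longleftrightarrow>
     (\<exists>u. norm u = 1 \<and> u \<bullet> e = 0 \<and> (\<forall>j\<in>J. \<forall>k\<le>N. u \<bullet> (psum x k - psum x j) \<le> 0))"

text \<open>For nonzero \<open>e\<close>: in the orthogonal complement of \<open>e\<close>, no
  hyperplane contains \<open>DIM('a)\<close> of the projected points, one more than the number of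
  vertices of a facet.\<close>

definition gen_pos :: "'a::euclidean_space \<Rightarrow> nat \<Rightarrow> (nat \<Rightarrow> 'a) \<Rightarrow> bool" where
  "gen_pos e N x \<longleftrightarrow> (\<forall>T u. T \<subseteq> {..N} \<longrightarrow> card T = DIM('a) \<longrightarrow> u \<bullet> e = 0 \<longrightarrow>
     (\<forall>s\<in>T. \<forall>t\<in>T. u \<bullet> psum x s = u \<bullet> psum x t) \<longrightarrow> u = 0)"

lemma gen_posD:
  fixes x :: "nat \<Rightarrow> 'a::euclidean_space"
  assumes "gen_pos e N x" "T \<subseteq> {..N}" "card T \<ge> DIM('a)" "u \<bullet> e = 0"
    "\<And>t. t \<in> T \<Longrightarrow> u \<bullet> psum x t = c"
  shows "u = 0"
proof -
  obtain T' where "T' \<subseteq> T" "card T' = DIM('a)"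
    using assms(3) by (meson obtain_subset_with_card_n)
  then show ?thesis using assms unfolding gen_pos_def by (metis subset_iff)
qed

text \<open>A further point on the supporting hyperplane would give \<open>DIM('a)\<close> points on
  it, against general position.\<close>

lemma supp_face_strict:
  fixes x :: "nat \<Rightarrow> 'a::euclidean_space"
  assumes gp: "gen_pos e N x" and J: "J \<subseteq> {..N}" "Suc (card J) = DIM('a)"
    and u: "u \<noteq> 0" "u \<bullet> e = 0" "\<And>j k. j \<in> J \<Longrightarrow> k \<le> N \<Longrightarrow> u \<bullet> (psum x k - psum x j) \<le> 0"
    and k: "k \<le> N" "k \<notin> J" "j \<in> J"
  shows "u \<bullet> psum x k < u \<bullet> psum x j"
proof (rule ccontr)
  assume "\<not> u \<bullet> psum x k < u \<bullet> psum x j"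
  then have "u \<bullet> psum x k = u \<bullet> psum x j" using u(3)[of j k] k by (simp add: inner_simps)
  moreover have "u \<bullet> psum x i = u \<bullet> psum x j" if "i \<in> J" for i
    using u(3)[of i j] u(3)[of j i] that k J by (auto simp: inner_simps intro: antisym)
  ultimately have const: "u \<bullet> psum x t = u \<bullet> psum x j" if "t \<in> insert k J" for t
    using that by blast
  have "card (insert k J) = DIM('a)" using J k finite_subset[OF J(1)] by simp
  then have "u = 0"
    using gen_posD[OF gp, of "insert k J" u "u \<bullet> psum x j", OF _ _ u(2) const] J(1) k(1) by simp
  then show False using u by simp
qed

text \<open>For a point \<open>k\<close> outside \<open>J\<close>, the combination of
  \<open>u\<close> and \<open>v\<close> that takes the same value at \<open>k\<close> as on
  \<open>J\<close> must vanish by general position. Only constancy on \<open>J\<close> is asked, so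
  that the normal of a differently rearranged walk can play the role of \<open>v\<close>.\<close>

lemma face_normal_unique:
  fixes x :: "nat \<Rightarrow> 'a::euclidean_space"
  assumes gp: "gen_pos e N x" and J: "J \<subseteq> {..N}" "Suc (card J) = DIM('a)" and N: "DIM('a) \<le> Suc N"
    and u: "norm u = 1" "u \<bullet> e = 0" "\<And>j. j \<in> J \<Longrightarrow> u \<bullet> psum x j = c"
    and v: "norm v = 1" "v \<bullet> e = 0" "\<And>j. j \<in> J \<Longrightarrow> v \<bullet> psum x j = d"
  shows "v = u \<or> v = - u"
proof -
  have "J \<noteq> {..N}" using J N by auto
  then obtain k where k: "k \<le> N" "k \<notin> J" using J by auto
  let ?a = "u \<bullet> psum x k - c" and ?b = "v \<bullet> psum x k - d"
  have cT: "card (insert k J) = DIM('a)" using J k finite_subset[OF J(1)] by auto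
  have a: "?a \<noteq> 0"
  proof
    assume "?a = 0"
    then have "u = 0" using cT J k u by (intro gen_posD[OF gp, of "insert k J" u c]) auto
    then show False using u by simp
  qed
  have "?a *\<^sub>R v - ?b *\<^sub>R u = 0"
    using cT J k u v
    by (intro gen_posD[OF gp, of "insert k J" _ "?a * d - ?b * c"]) (auto simp: inner_simps algebra_simps)
  then have v_eq: "v = (?b / ?a) *\<^sub>R u"
    using a by (metis (no_types, lifting) divideR_right eq_iff_diff_eq_0 scaleR_scaleR divide_inverse_commute)
  then have "\<bar>?b / ?a\<bar> = 1" using u v by (metis mult.right_neutral norm_scaleR)
  then show ?thesis using v_eq by (metis abs_eq_iff' scaleR_minus1_left scaleR_one abs_1)
qed

text \<open>Among all normals supporting the hull at \<open>i\<close>, one with the most contact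
  points has \<open>DIM('a) - 1\<close> of them: with fewer, it could be tilted, keeping all
  contacts, until the hyperplane meets a further point.\<close>

lemma supp_face_extend:
  fixes x :: "nat \<Rightarrow> 'a::euclidean_space"
  assumes gp: "gen_pos e N x" and D: "2 \<le> DIM('a)" "DIM('a) \<le> Suc N" and i: "i \<le> N"
    and face: "supp_face e N {i} x"
  obtains J where "J \<subseteq> {..N}" "i \<in> J" "Suc (card J) = DIM('a)" "supp_face e N J x"
proof -
  define d where "d k = psum x k - psum x i" for k
  define U where "U u \<longleftrightarrow> u \<noteq> 0 \<and> u \<bullet> e = 0 \<and> (\<forall>k\<le>N. u \<bullet> d k \<le> 0)" for u
  define A where "A u = {k. k \<le> N \<and> u \<bullet> d k = 0}" for u
  have fA: "finite (A u)" for u unfolding A_def by simp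
  have iA: "i \<in> A u" for u using i by (simp add: A_def d_def)
  obtain u0 where "U u0"
    using face unfolding supp_face_def U_def d_def by (metis norm_zero singletonI zero_neq_one)
  moreover have "card (A u) < N + 2" for u
  proof -
    have "card (A u) \<le> card {..N}" by (rule card_mono) (auto simp: A_def)
    then show ?thesis by simp
  qed
  ultimately obtain u where u: "U u" and max: "\<And>v. U v \<Longrightarrow> card (A v) \<le> card (A u)"
    using ex_has_greatest_nat[of U u0 "\<lambda>u. card (A u)" "N + 2"] less_imp_le by blast
  have lt: "card (A u) < DIM('a)"
  proof (rule ccontr)
    assume "\<not> card (A u) < DIM('a)"
    then have "u = 0"
      by (intro gen_posD[OF gp, of "A u" u "u \<bullet> psum x i"])
        (use u in \<open>auto simp: A_def U_def d_def inner_simps\<close>)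
    then show False using u by (simp add: U_def)
  qed
  have "Suc (card (A u)) = DIM('a)"
  proof (rule ccontr)
    assume "Suc (card (A u)) \<noteq> DIM('a)"
    then have small: "Suc (Suc (card (A u))) \<le> DIM('a)" using lt by simp
    \<comment> \<open>The tilting direction \<open>w\<close> will be orthogonal to all of this: to
      \<open>u\<close> so that the tilted normal is nonzero, to \<open>e\<close> so that it stays
      admissible, and to the contact directions so that no contact is lost.\<close>
    let ?V = "insert u (insert e (d ` (A u - {i})))"
    have "card ?V \<le> Suc (Suc (card (d ` (A u - {i}))))"
      using fA by (simp add: card_insert_if)
    also have "\<dots> \<le> Suc (Suc (card (A u - {i})))"
      using fA by (simp add: card_image_le)
    also have "\<dots> = Suc (card (A u))"
      using card_Suc_Diff1[OF fA iA] by simp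
    also have "\<dots> < DIM('a)"
      using small by simp
    finally have "dim ?V < DIM('a)"
      using dim_le_card'[of ?V] fA by (meson finite_Diff finite_imageI finite_insert le_less_trans)
    then obtain w where w: "w \<noteq> 0" "\<And>y. y \<in> span ?V \<Longrightarrow> orthogonal w y"
      using orthogonal_to_subspace_exists by blast
    have wV: "w \<bullet> y = 0" if "y \<in> ?V" for y
      using w(2)[OF span_base[OF that]] by (simp add: orthogonal_def)
    have "\<exists>k\<le>N. w \<bullet> d k \<noteq> 0"
    proof (rule ccontr)
      assume "\<not> ?thesis"
      then have "w = 0" using D wV
        by (intro gen_posD[OF gp, of "{..N}" w "w \<bullet> psum x i"]) (auto simp: d_def inner_simps)
      then show False using w by simp
    qed
    then obtain k0 where k0': "k0 \<le> N" "w \<bullet> d k0 \<noteq> 0" by blast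
    \<comment> \<open>The factor \<open>s\<close> fixes the sign, so that tilting moves at least the
      point \<open>k0\<close> towards the hyperplane.\<close>
    define s where "s = w \<bullet> d k0"
    have k0: "k0 \<le> N" "(s *\<^sub>R w) \<bullet> d k0 > 0"
      using k0' by (auto simp: s_def zero_less_mult_iff)
    define w' where "w' = s *\<^sub>R w"
    have w'V: "w' \<bullet> y = 0" if "y \<in> ?V" for y using wV[OF that] by (simp add: w'_def)
    define P where "P = {k. k \<le> N \<and> w' \<bullet> d k > 0}"
    have P: "finite P" "P \<noteq> {}" using k0 by (auto simp: P_def w'_def)
    \<comment> \<open>\<open>\<rho> k\<close> is the amount of tilting at which the point
      \<open>k\<close> reaches the hyperplane; \<open>\<tau>\<close> is the first such
      amount.\<close>
    define \<rho> where "\<rho> k = - (u \<bullet> d k) / (w' \<bullet> d k)" for k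
    define \<tau> where "\<tau> = Min (\<rho> ` P)"
    have "\<tau> \<in> \<rho> ` P" unfolding \<tau>_def using P by (intro Min_in) auto
    then obtain k1 where k1: "k1 \<in> P" "\<tau> = \<rho> k1" by auto
    have \<tau>le: "\<tau> \<le> \<rho> k" if "k \<in> P" for k unfolding \<tau>_def using P that by simp
    have \<tau>0: "\<tau> \<ge> 0" unfolding k1 \<rho>_def using k1(1) u by (auto simp: P_def U_def intro!: divide_nonpos_pos)
    let ?u = "u + \<tau> *\<^sub>R w'"
    have "U ?u"
      unfolding U_def
    proof (intro conjI allI impI)
      have "u \<bullet> ?u = u \<bullet> u" using w'V[of u] by (simp add: inner_simps inner_commute)
      then show "?u \<noteq> 0" using u unfolding U_def by (metis inner_eq_zero_iff inner_zero_right)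
      show "?u \<bullet> e = 0" using w'V[of e] u by (simp add: U_def inner_simps)
      fix k assume k: "k \<le> N"
      show "?u \<bullet> d k \<le> 0"
      proof (cases "k \<in> P")
        case True
        then have "\<tau> * (w' \<bullet> d k) \<le> \<rho> k * (w' \<bullet> d k)"
          using \<tau>le[OF True] by (intro mult_right_mono) (auto simp: P_def)
        also have "\<dots> = - (u \<bullet> d k)" using True by (auto simp: \<rho>_def P_def)
        finally show ?thesis by (simp add: inner_simps)
      next
        case False
        then have "w' \<bullet> d k \<le> 0" using k by (auto simp: P_def)
        then have "\<tau> * (w' \<bullet> d k) \<le> 0" using \<tau>0 by (simp add: mult_nonneg_nonpos)
        then show ?thesis using u k by (auto simp: U_def inner_simps)
      qed
    qed
    have dA: "w' \<bullet> d k = 0" if "k \<in> A u" for k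
      using w'V[of "d k"] that by (cases "k = i") (auto simp: d_def)
    have "insert k1 (A u) \<subseteq> A ?u"
    proof
      fix k assume "k \<in> insert k1 (A u)"
      then consider "k = k1" | "k \<in> A u" by auto
      then show "k \<in> A ?u"
      proof cases
        case 1
        then show ?thesis using k1 by (auto simp: A_def P_def \<rho>_def inner_simps)
      next
        case 2
        then show ?thesis using dA[OF 2] by (auto simp: A_def inner_simps)
      qed
    qed
    moreover have "k1 \<notin> A u" using dA[of k1] k1(1) by (auto simp: P_def)
    ultimately have "Suc (card (A u)) \<le> card (A ?u)"
      using card_mono[OF fA, of "insert k1 (A u)" ?u] fA by simp
    then show False using max[OF \<open>U ?u\<close>] by simp
  qed
  moreover have "supp_face e N (A u) x"
    unfolding supp_face_def
  proof (intro exI[of _ "u /\<^sub>R norm u"] conjI ballI allI impI)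
    show "norm (u /\<^sub>R norm u) = 1" "(u /\<^sub>R norm u) \<bullet> e = 0" using u by (auto simp: U_def)
    fix j k assume j: "j \<in> A u" and k: "k \<le> N"
    have "u \<bullet> (psum x k - psum x j) = u \<bullet> d k - u \<bullet> d j" by (simp add: d_def inner_simps)
    also have "\<dots> \<le> 0" using j k u by (simp add: A_def U_def)
    finally show "(u /\<^sub>R norm u) \<bullet> (psum x k - psum x j) \<le> 0"
      by (simp add: mult_nonneg_nonpos)
  qed
  ultimately show ?thesis using that[of "A u"] iA by (auto simp: A_def)
qed

text \<open>The vertex set of a facet, coded by its first index \<open>p\<close> and its gaps
  \<open>j\<close>. The gaps become the block lengths of the rearrangement, and summing over them
  produces harmonic sums.\<close>

definition block_set :: "nat \<Rightarrow> (nat \<Rightarrow> nat) \<Rightarrow> nat \<Rightarrow> nat set" where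
  "block_set p j r = (\<lambda>l. p + sum j {..<l}) ` {..r}"

lemma block_set_exists:
  assumes "J \<subseteq> {..N}" "card J = Suc r"
  shows "\<exists>p j. j \<in> {..<r} \<rightarrow>\<^sub>E {1..N} \<and> p + sum j {..<r} \<le> N \<and> J = block_set p j r"
  using assms
proof (induction r arbitrary: J)
  case 0
  then obtain p where "J = {p}" by (metis One_nat_def card_1_singletonE)
  then show ?case using 0 by (intro exI[of _ p] exI[of _ "\<lambda>_. undefined"]) (auto simp: block_set_def)
next
  case (Suc r)
  have fin: "finite J" "J \<noteq> {}" using Suc.prems by (auto simp: finite_subset)
  define m where "m = Max J"
  have m: "m \<in> J" "\<And>k. k \<in> J \<Longrightarrow> k \<le> m" using fin by (auto simp: m_def)
  have "card (J - {m}) = Suc r" using Suc.prems m fin by simp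
  moreover have "J - {m} \<subseteq> {..N}" using Suc.prems by auto
  ultimately obtain p j where j: "j \<in> {..<r} \<rightarrow>\<^sub>E {1..N}" "p + sum j {..<r} \<le> N" "J - {m} = block_set p j r"
    using Suc.IH by blast
  let ?q = "p + sum j {..<r}"
  have "?q \<in> J - {m}" unfolding j(3) by (auto simp: block_set_def)
  then have qm: "?q < m" using m(2)[of ?q] by (auto simp: le_less)
  let ?j = "j(r := m - ?q)"
  have s: "sum ?j {..<l} = sum j {..<l}" if "l \<le> r" for l using that by (intro sum.cong) auto
  have mN: "m \<le> N" using m Suc.prems by auto
  have "?j \<in> {..<Suc r} \<rightarrow>\<^sub>E {1..N}"
    
  proof -
    have "m - ?q \<in> {1..N}" unfolding atLeastAtMost_iff using qm mN by arith
    from PiE_fun_upd[OF this j(1)] show ?thesis unfolding lessThan_Suc .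
  qed
  moreover have tot: "p + sum ?j {..<Suc r} = m" using s[of r] qm by simp
  moreover have "J = block_set p ?j (Suc r)"
  proof -
    have "block_set p ?j (Suc r) = insert (p + sum ?j {..<Suc r}) ((\<lambda>l. p + sum ?j {..<l}) ` {..r})"
      unfolding block_set_def atMost_Suc by simp
    also have "(\<lambda>l. p + sum ?j {..<l}) ` {..r} = block_set p j r"
      unfolding block_set_def using s by (intro image_cong) auto
    also have "insert (p + sum ?j {..<Suc r}) (block_set p j r) = J"
      unfolding tot j(3)[symmetric] using m(1) by (rule insert_Diff)
    finally show ?thesis ..
  qed
  moreover have "p + sum ?j {..<Suc r} \<le> N" unfolding tot by (rule mN)
  ultimately show ?case by blast
qed

section \<open>Measurability of the face and general position events\<close>

lemma psum_measurable:
  assumes "\<And>i. i < N \<Longrightarrow> (\<lambda>\<omega>. x \<omega> i) \<in> borel_measurable M" "k \<le> N"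
  shows "(\<lambda>\<omega>. psum (x \<omega>) k :: 'a::euclidean_space) \<in> borel_measurable M"
  unfolding psum_def using assms by (intro borel_measurable_sum) auto

lemma compact_unit_perp: "compact (sphere 0 1 \<inter> {u::'a::euclidean_space. u \<bullet> e = 0})"
  by (intro compact_Int_closed compact_sphere closed_Collect_eq continuous_intros)

lemma supp_face_measurable:
  fixes x :: "'b \<Rightarrow> nat \<Rightarrow> 'a::euclidean_space"
  assumes x: "\<And>i. i < N \<Longrightarrow> (\<lambda>\<omega>. x \<omega> i) \<in> borel_measurable M" and J: "J \<subseteq> {..N}"
  shows "{\<omega> \<in> space M. supp_face e N J (x \<omega>)} \<in> sets M"
proof -
  \<comment> \<open>A sum of positive parts vanishes exactly when \<open>u\<close> supports the walk
    at every element of \<open>J\<close>.\<close>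
  let ?g = "\<lambda>\<omega> u. \<Sum>j\<in>J. \<Sum>k\<le>N. max 0 (u \<bullet> (psum (x \<omega>) k - psum (x \<omega>) j))"
  let ?K = "sphere 0 1 \<inter> {u. u \<bullet> e = 0}"
  have fin: "finite J" using J finite_subset by blast
  have "{\<omega> \<in> space M. \<exists>u\<in>?K. ?g \<omega> u \<le> 0} \<in> sets M"
  proof (intro sets_ex_compact compact_unit_perp)
    show "(\<lambda>\<omega>. ?g \<omega> u) \<in> borel_measurable M" for u
      using J by (intro borel_measurable_sum borel_measurable_max borel_measurable_inner
        borel_measurable_diff psum_measurable[of N x] x borel_measurable_const) auto
    show "continuous_on ?K (?g \<omega>)" for \<omega> by (intro continuous_intros)
  qed
  also have "{\<omega> \<in> space M. \<exists>u\<in>?K. ?g \<omega> u \<le> 0} = {\<omega> \<in> space M. supp_face e N J (x \<omega>)}"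
  proof -
    have "?g \<omega> u \<le> 0 \<longleftrightarrow> (\<forall>j\<in>J. \<forall>k\<le>N. u \<bullet> (psum (x \<omega>) k - psum (x \<omega>) j) \<le> 0)" for \<omega> u
    proof -
      have "?g \<omega> u \<le> 0 \<longleftrightarrow> ?g \<omega> u = 0"
      proof -
        have "0 \<le> ?g \<omega> u" by (intro sum_nonneg) simp
        then show ?thesis by linarith
      qed
      also have "\<dots> \<longleftrightarrow> (\<forall>j\<in>J. \<forall>k\<in>{..N}. max 0 (u \<bullet> (psum (x \<omega>) k - psum (x \<omega>) j)) = 0)"
        using fin by (simp add: sum_nonneg_eq_0_iff sum_nonneg)
      also have "\<dots> \<longleftrightarrow> (\<forall>j\<in>J. \<forall>k\<le>N. u \<bullet> (psum (x \<omega>) k - psum (x \<omega>) j) \<le> 0)"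
        by (meson atMost_iff max.absorb_iff1 order_refl)
      finally show ?thesis .
    qed
    then show ?thesis by (auto simp: supp_face_def Bex_def)
  qed
  finally show ?thesis .
qed

lemma gen_pos_measurable:
  fixes x :: "'b \<Rightarrow> nat \<Rightarrow> 'a::euclidean_space"
  assumes x: "\<And>i. i < N \<Longrightarrow> (\<lambda>\<omega>. x \<omega> i) \<in> borel_measurable M"
  shows "{\<omega> \<in> space M. gen_pos e N (x \<omega>)} \<in> sets M"
proof -
  let ?T = "{T. T \<subseteq> {..N} \<and> card T = DIM('a)}"
  let ?y = "\<lambda>q \<omega>. psum (x \<omega>) (fst q) - psum (x \<omega>) (snd q)"
  let ?P = "\<lambda>T \<omega>. \<forall>u. (\<forall>v\<in>{e}. u \<bullet> v = 0) \<and> (\<forall>q\<in>T \<times> T. u \<bullet> ?y q \<omega> = 0) \<longrightarrow> u = 0"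
  have "{\<omega> \<in> space M. \<forall>T\<in>?T. ?P T \<omega>} \<in> sets M"
  proof (rule sets.sets_Collect_finite_All)
    fix T assume T: "T \<in> ?T"
    then have "finite (T \<times> T)" using finite_subset by blast
    moreover have "?y q \<in> borel_measurable M" if "q \<in> T \<times> T" for q
      using T that by (intro borel_measurable_diff psum_measurable[of N x] x) auto
    ultimately show "{\<omega> \<in> space M. ?P T \<omega>} \<in> sets M" by (rule annihilator_trivial_measurable)
  qed simp
  also have "{\<omega> \<in> space M. \<forall>T\<in>?T. ?P T \<omega>} = {\<omega> \<in> space M. gen_pos e N (x \<omega>)}"
    unfolding gen_pos_def by (intro Collect_cong conj_cong refl) (auto simp: inner_diff_right)
  finally show ?thesis .
qed

section \<open>Rearranging the increments of a walk\<close>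

lemma psum_add: "psum x (a + y) = psum x a + (\<Sum>i<y. x (a + i))"
  by (induction y) (simp_all add: psum_def add.assoc)

lemma psum_cong: "(\<And>i. i < k \<Longrightarrow> x i = y i) \<Longrightarrow> psum x k = psum y k"
  by (simp add: psum_def)

lemma supp_face_cong:
  assumes "\<And>i. i < N \<Longrightarrow> x i = y i" "J \<subseteq> {..N}"
  shows "supp_face e N J x \<longleftrightarrow> supp_face e N J y"
proof -
  have "psum x k = psum y k" if "k \<le> N" for k using that assms(1) by (intro psum_cong) auto
  moreover have "j \<le> N" if "j \<in> J" for j using that assms(2) by auto
  ultimately show ?thesis unfolding supp_face_def by (smt (verit, ccfv_SIG))
qed

lemma gen_pos_cong:
  assumes "\<And>i. i < N \<Longrightarrow> x i = y i"
  shows "gen_pos e N x \<longleftrightarrow> gen_pos e N y"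
proof -
  have "psum x k = psum y k" if "k \<le> N" for k using that assms(1) by (intro psum_cong) auto
  then have "(\<forall>s\<in>T. \<forall>t\<in>T. u \<bullet> psum x s = u \<bullet> psum x t) \<longleftrightarrow> (\<forall>s\<in>T. \<forall>t\<in>T. u \<bullet> psum y s = u \<bullet> psum y t)"
    if "T \<subseteq> {..N}" for T u
    using that by (intro ball_cong refl) (auto simp: subset_iff)
  then show ?thesis unfolding gen_pos_def by (intro iff_allI imp_cong refl)
qed

lemma sum_cyclic_shift:
  fixes s j :: nat
  assumes "s < j"
  shows "(\<Sum>i<j. f ((i + s) mod j)) = (\<Sum>i<j. f i)"
proof (rule sum.reindex_bij_witness[of _ "\<lambda>k. (k + (j - s)) mod j" "\<lambda>i. (i + s) mod j"])
  fix a assume "a \<in> {..<j}"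
  then have "(a + s + (j - s)) mod j = a" "(a + (j - s) + s) mod j = a"
    using assms by simp_all
  then show "((a + s) mod j + (j - s)) mod j = a" "((a + (j - s)) mod j + s) mod j = a"
    by (simp_all only: mod_add_left_eq)
qed (use assms in auto)

text \<open>Walking once around the cycle from \<open>s\<close> to \<open>s'\<close> and back to \<open>s\<close> has total height 0.\<close>

lemma cyclic_max_unique:
  fixes h :: "nat \<Rightarrow> real"
  assumes z: "(\<Sum>y<j. h y) = 0" and s: "s < j" "s' < j"
    and neg: "\<And>y. 0 < y \<Longrightarrow> y < j \<Longrightarrow> (\<Sum>i<y. h ((i + s) mod j)) < 0"
    and neg': "\<And>y. 0 < y \<Longrightarrow> y < j \<Longrightarrow> (\<Sum>i<y. h ((i + s') mod j)) < 0"
  shows "s = s'"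
proof -
  have *: False
    if s: "s < s'" "s' < j" and
       neg: "\<And>y. 0 < y \<Longrightarrow> y < j \<Longrightarrow> (\<Sum>i<y. h ((i + s) mod j)) < 0" and
       neg': "\<And>y. 0 < y \<Longrightarrow> y < j \<Longrightarrow> (\<Sum>i<y. h ((i + s') mod j)) < 0" for s s'
  proof -
    define y where "y = s' - s"
    have y: "0 < y" "y < j" using s by (auto simp: y_def)
    have "(\<Sum>i<j. h ((i + s) mod j)) = psum (\<lambda>i. h ((i + s) mod j)) (y + (j - y))"
      using y by (simp add: psum_def)
    also have "\<dots> = (\<Sum>i<y. h ((i + s) mod j)) + (\<Sum>i<j - y. h ((y + i + s) mod j))"
      unfolding psum_add by (simp add: psum_def)
    also have "(\<Sum>i<j - y. h ((y + i + s) mod j)) = (\<Sum>i<j - y. h ((i + s') mod j))"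
      using s by (intro sum.cong) (auto simp: y_def algebra_simps)
    also have "(\<Sum>i<y. h ((i + s) mod j)) + \<dots> < 0"
      using neg[OF y] neg'[of "j - y"] y by auto
    finally show False using z sum_cyclic_shift[of s j h] s by simp
  qed
  show ?thesis using *[of s s', OF _ s(2) neg neg'] *[of s' s, OF _ s(1) neg' neg] by (cases s s' rule: linorder_cases) auto
qed

text \<open>
  \<open>x \<circ> rearr r j p \<sigma>\<close> consists of \<open>r\<close> blocks of lengths \<open>j 0, \<dots>, j (r - 1)\<close>, starting at position \<open>p\<close>, and of
  the outer increments before and after them. Block \<open>l\<close> reads row \<open>l\<close> of the array \<open>x \<circ> prod_encode\<close>
  cyclically shifted by \<open>\<sigma> l\<close>, and the outer increments read row \<open>r\<close>. So neither \<open>p\<close> nor \<open>\<sigma>\<close> changes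
  the block sums.
\<close>

definition rearr :: "nat \<Rightarrow> (nat \<Rightarrow> nat) \<Rightarrow> nat \<Rightarrow> (nat \<Rightarrow> nat) \<Rightarrow> nat \<Rightarrow> nat" where
  "rearr r j p \<sigma> k =
     (if k < p then prod_encode (r, k)
      else if k < p + sum j {..<r} then
        (let l = (LEAST l. k < p + sum j {..<Suc l})
         in prod_encode (l, (k - p - sum j {..<l} + \<sigma> l) mod j l))
      else prod_encode (r, k - sum j {..<r}))"

context
  fixes r :: nat and j :: "nat \<Rightarrow> nat"
  assumes jpos: "\<And>l. l < r \<Longrightarrow> 0 < j l"
begin

lemma block_start_mono: "l \<le> l' \<Longrightarrow> sum j {..<l} \<le> sum j {..<l'}"
  by (intro sum_mono2) auto

lemma block_start_strict: "l < l' \<Longrightarrow> l' \<le> r \<Longrightarrow> sum j {..<l} < sum j {..<l'}"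
proof -
  assume l: "l < l'" "l' \<le> r"
  have "sum j {..<l} < sum j {..<Suc l}" using jpos[of l] l by simp
  also have "\<dots> \<le> sum j {..<l'}" using l by (intro block_start_mono) auto
  finally show ?thesis .
qed

lemma card_block_set: "card (block_set p j r) = Suc r"
proof -
  have "inj_on (\<lambda>l. p + sum j {..<l}) {..r}"
    by (intro inj_onI) (metis add_left_cancel atMost_iff block_start_strict linorder_neqE_nat less_irrefl)
  then show ?thesis by (simp add: block_set_def card_image)
qed

lemma block_set_subset: "p + sum j {..<r} \<le> N \<Longrightarrow> block_set p j r \<subseteq> {..N}"
  using block_start_mono[of _ r] unfolding block_set_def
  by (auto intro: order_trans[OF add_left_mono])

lemma rearr_pre: "k < p \<Longrightarrow> rearr r j p \<sigma> k = prod_encode (r, k)"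
  by (simp add: rearr_def)

lemma rearr_block:
  assumes l: "l < r" "y < j l"
  shows "rearr r j p \<sigma> (p + sum j {..<l} + y) = prod_encode (l, (y + \<sigma> l) mod j l)"
proof -
  have "p + sum j {..<l} + y < p + sum j {..<r}"
    using block_start_mono[of "Suc l" r] l by simp
  moreover have "(LEAST l'. p + sum j {..<l} + y < p + sum j {..<Suc l'}) = l"
  proof (rule Least_equality)
    show "p + sum j {..<l} + y < p + sum j {..<Suc l}" using l by simp
    fix l' assume *: "p + sum j {..<l} + y < p + sum j {..<Suc l'}"
    show "l \<le> l'"
    proof (rule ccontr)
      assume "\<not> l \<le> l'"
      then have "sum j {..<Suc l'} \<le> sum j {..<l}" by (intro block_start_mono) auto
      then show False using * by linarith
    qed
  qed
  ultimately show ?thesis unfolding rearr_def Let_def by simp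
qed

lemma rearr_post: "p + sum j {..<r} \<le> k \<Longrightarrow> rearr r j p \<sigma> k = prod_encode (r, k - sum j {..<r})"
  by (auto simp: rearr_def)

lemma rearr_cases:
  obtains "k < p" | l y where "l < r" "y < j l" "k = p + sum j {..<l} + y" | "p + sum j {..<r} \<le> k"
proof -
  have *: "\<exists>l<q. \<exists>y<j l. k' = sum j {..<l} + y" if "k' < sum j {..<q}" for k' q
    using that
  proof (induction q)
    case (Suc q)
    show ?case
    proof (cases "k' < sum j {..<q}")
      case True
      then show ?thesis using Suc.IH less_Suc_eq by blast
    next
      case False
      then have "k' = sum j {..<q} + (k' - sum j {..<q})" "k' - sum j {..<q} < j q" using Suc.prems by auto
      then show ?thesis by blast
    qed
  qed simp
  show ?thesis
  proof (cases "k < p \<or> p + sum j {..<r} \<le> k")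
    case False
    then have "k - p < sum j {..<r}" by auto
    then obtain l y where "l < r" "y < j l" "k - p = sum j {..<l} + y" using * by blast
    then show ?thesis using that(2)[of l y] False by auto
  qed (use that in auto)
qed

text \<open>Injectivity gives the rearranged increments the same joint law as the original ones.
  Different blocks read different rows, a cyclic shift is injective on a block, and the outer part
  skips exactly the positions of the blocks.\<close>

lemma inj_rearr: "inj (rearr r j p \<sigma>)"
proof (rule injI)
  have mod_le: "y' \<le> y" if "(y + s) mod q = (y' + s) mod q" "y < q" "y' < q" for y y' s q :: nat
  proof (rule ccontr)
    assume "\<not> y' \<le> y"
    then have "q dvd (y' + s) - (y + s)" using that(1) by (subst mod_eq_dvd_iff_nat[symmetric]) auto
    then show False using that \<open>\<not> y' \<le> y\<close> by (auto dest: dvd_imp_le)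
  qed
  have mod_eq: "y = y'" if "(y + s) mod q = (y' + s) mod q" "y < q" "y' < q" for y y' s q :: nat
    using mod_le[of y s q y'] mod_le[of y' s q y] that by simp
  fix k k' assume eq: "rearr r j p \<sigma> k = rearr r j p \<sigma> k'"
  show "k = k'"
    by (rule rearr_cases[of k p]; rule rearr_cases[of k' p])
      (use eq in \<open>auto simp: rearr_pre rearr_block rearr_post dest: mod_eq\<close>)
qed

context
  fixes x :: "nat \<Rightarrow> 'a::euclidean_space" and p :: nat and \<sigma> :: "nat \<Rightarrow> nat"
  assumes \<sigma>: "\<And>l. l < r \<Longrightarrow> \<sigma> l < j l"
begin

lemma psum_rearr_pre: "k \<le> p \<Longrightarrow> psum (\<lambda>i. x (rearr r j p \<sigma> i)) k = psum (\<lambda>i. x (prod_encode (r, i))) k"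
  by (intro psum_cong) (auto simp: rearr_pre)

lemma psum_rearr_block:
  assumes "l < r" "y \<le> j l"
  shows "psum (\<lambda>i. x (rearr r j p \<sigma> i)) (p + sum j {..<l} + y) =
    psum (\<lambda>i. x (rearr r j p \<sigma> i)) (p + sum j {..<l}) + (\<Sum>i<y. x (prod_encode (l, (i + \<sigma> l) mod j l)))"
  unfolding psum_add[of _ "p + sum j {..<l}" y] using assms
  by (intro arg_cong2[of _ _ _ _ "(+)"] sum.cong refl) (simp add: rearr_block)

text \<open>A full turn around a block has the same sum whatever the shift. So the corners do not
  depend on \<open>\<sigma>\<close>, and \<open>p\<close> changes them only by a common
  translation.\<close>

lemma psum_rearr_corner:
  "l \<le> r \<Longrightarrow> psum (\<lambda>i. x (rearr r j p \<sigma> i)) (p + sum j {..<l}) =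
     psum (\<lambda>i. x (prod_encode (r, i))) p + (\<Sum>l'<l. \<Sum>y<j l'. x (prod_encode (l', y)))"
proof (induction l)
  case 0
  then show ?case by (simp add: psum_rearr_pre)
next
  case (Suc l)
  let ?x = "\<lambda>i. x (rearr r j p \<sigma> i)"
  have "psum ?x (p + sum j {..<Suc l}) = psum ?x (p + sum j {..<l} + j l)"
    by (simp add: add.assoc)
  also have "\<dots> = psum ?x (p + sum j {..<l}) + (\<Sum>i<j l. x (prod_encode (l, (i + \<sigma> l) mod j l)))"
    using Suc.prems by (intro psum_rearr_block) auto
  also have "(\<Sum>i<j l. x (prod_encode (l, (i + \<sigma> l) mod j l))) = (\<Sum>i<j l. x (prod_encode (l, i)))"
    using Suc.prems \<sigma>[of l] sum_cyclic_shift[of "\<sigma> l" "j l" "\<lambda>i. x (prod_encode (l, i))"] by simp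
  finally show ?case using Suc by (simp add: add.assoc)
qed

lemma psum_rearr_post:
  assumes "p \<le> k"
  shows "psum (\<lambda>i. x (rearr r j p \<sigma> i)) (k + sum j {..<r}) =
     psum (\<lambda>i. x (prod_encode (r, i))) k + (\<Sum>l'<r. \<Sum>y<j l'. x (prod_encode (l', y)))"
proof -
  let ?x = "\<lambda>i. x (rearr r j p \<sigma> i)"
  have "psum ?x (k + sum j {..<r}) = psum ?x (p + sum j {..<r} + (k - p))"
    using assms by (simp add: ac_simps)
  also have "\<dots> = psum ?x (p + sum j {..<r}) + (\<Sum>i<k - p. x (prod_encode (r, p + i)))"
    unfolding psum_add[of _ "p + sum j {..<r}" "k - p"]
    by (intro arg_cong2[of _ _ _ _ "(+)"] sum.cong refl) (simp add: rearr_post)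
  also have "\<dots> = psum (\<lambda>i. x (prod_encode (r, i))) (p + (k - p)) + (\<Sum>l'<r. \<Sum>y<j l'. x (prod_encode (l', y)))"
    unfolding psum_add[of _ p "k - p"] by (simp add: psum_rearr_corner ac_simps)
  finally show ?thesis using assms by simp
qed

end

text \<open>Every normal in question is orthogonal to the block sums, which are common to all the
  walks, so by general position only two opposite unit normals can occur; this is the 2. A normal
  determines the rearrangement: \<open>p\<close> is the unique maximum of the outer walk in its
  direction, and \<open>\<sigma> l\<close> is the unique starting point from which the turn around
  block \<open>l\<close> stays strictly below its start.\<close>

lemma card_rearr_faces_le_2:
  fixes x :: "nat \<Rightarrow> 'a::euclidean_space"
  assumes D: "DIM('a) = r + 2" "r < N" and L: "sum j {..<r} \<le> N"
    and gp: "\<And>p \<sigma>. p \<le> N - sum j {..<r} \<Longrightarrow> \<sigma> \<in> Pi\<^sub>E {..<r} (\<lambda>l. {..<j l}) \<Longrightarrow> gen_pos e N (\<lambda>k. x (rearr r j p \<sigma> k))"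
  shows "card {(p, \<sigma>) \<in> {..N - sum j {..<r}} \<times> Pi\<^sub>E {..<r} (\<lambda>l. {..<j l}).
      supp_face e N (block_set p j r) (\<lambda>k. x (rearr r j p \<sigma> k))} \<le> 2"
proof -
  let ?L = "sum j {..<r}"
  let ?S = "Pi\<^sub>E {..<r} (\<lambda>l. {..<j l})"
  let ?A = "{(p, \<sigma>) \<in> {..N - ?L} \<times> ?S. supp_face e N (block_set p j r) (\<lambda>k. x (rearr r j p \<sigma> k))}"
  define V where "V l = (\<Sum>y<j l. x (prod_encode (l, y)))" for l
  define Out where "Out = psum (\<lambda>i. x (prod_encode (r, i)))"
  \<comment> \<open>The last two clauses pin down \<open>p\<close> and \<open>\<sigma>\<close> once
    \<open>u\<close> is given.\<close>
  define good where "good p \<sigma> u \<longleftrightarrow> norm u = 1 \<and> u \<bullet> e = 0 \<and> (\<forall>l<r. u \<bullet> V l = 0) \<and>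
     (\<forall>k\<le>N - ?L. k \<noteq> p \<longrightarrow> u \<bullet> Out k < u \<bullet> Out p) \<and>
     (\<forall>l<r. \<forall>y. 0 < y \<longrightarrow> y < j l \<longrightarrow> (\<Sum>i<y. u \<bullet> x (prod_encode (l, (i + \<sigma> l) mod j l))) < 0)" for p \<sigma> u
  have corner: "psum (\<lambda>i. x (rearr r j p \<sigma> i)) (p + sum j {..<l}) = Out p + (\<Sum>l'<l. V l')"
    if "\<sigma> \<in> ?S" "l \<le> r" for p \<sigma> l
    using psum_rearr_corner[of \<sigma> l x p] that unfolding V_def Out_def by (auto simp: PiE_iff)
  have ex: "\<exists>u. good p \<sigma> u" if "(p, \<sigma>) \<in> ?A" for p \<sigma>
  proof -
    let ?x = "\<lambda>k. x (rearr r j p \<sigma> k)"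
    let ?J = "block_set p j r"
    have p: "p \<le> N - ?L" and \<sigma>: "\<sigma> \<in> ?S" and face: "supp_face e N ?J ?x" using that by auto
    have \<sigma>lt: "\<And>l. l < r \<Longrightarrow> \<sigma> l < j l" using \<sigma> by (auto simp: PiE_iff)
    have JN: "?J \<subseteq> {..N}" using p L by (intro block_set_subset) auto
    obtain u where u: "norm u = 1" "u \<bullet> e = 0" "\<forall>j\<in>?J. \<forall>k\<le>N. u \<bullet> (psum ?x k - psum ?x j) \<le> 0"
      using face unfolding supp_face_def by blast
    have strict: "u \<bullet> psum ?x k < u \<bullet> psum ?x i" if "k \<le> N" "k \<notin> ?J" "i \<in> ?J" for k i
      using D card_block_set u that
      by (intro supp_face_strict[OF gp[OF p \<sigma>] JN]) auto
    have inJ: "p + sum j {..<l} \<in> ?J" if "l \<le> r" for l using that by (auto simp: block_set_def)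
    have const: "u \<bullet> psum ?x i = u \<bullet> psum ?x k" if "i \<in> ?J" "k \<in> ?J" for i k
    proof -
      have "u \<bullet> (psum ?x k - psum ?x i) \<le> 0" "u \<bullet> (psum ?x i - psum ?x k) \<le> 0" using u that JN by auto
      then show ?thesis by (simp add: inner_simps)
    qed
    have uV: "u \<bullet> V l = 0" if l: "l < r" for l
    proof -
      have "u \<bullet> psum ?x (p + sum j {..<Suc l}) = u \<bullet> psum ?x (p + sum j {..<l})"
        using l by (intro const inJ) auto
      then show ?thesis using l corner[OF \<sigma>, of "Suc l" p] corner[OF \<sigma>, of l p] by (simp add: inner_simps)
    qed
    then have uV': "u \<bullet> (\<Sum>l'<l. V l') = 0" if "l \<le> r" for l
      using that by (auto simp: inner_sum_right intro!: sum.neutral)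
    have "good p \<sigma> u"
      unfolding good_def
    proof (intro conjI allI impI u uV)
      fix k assume k: "k \<le> N - ?L" "k \<noteq> p"
      have P: "u \<bullet> psum ?x p = u \<bullet> Out p" using corner[OF \<sigma>, of 0 p] by simp
      have pJ: "p \<in> ?J" using inJ[of 0] by simp
      \<comment> \<open>Before \<open>p\<close> the walk is the outer walk; after the blocks it is
        the outer walk plus the block sums, which \<open>u\<close> does not see.\<close>
      show "u \<bullet> Out k < u \<bullet> Out p"
      proof (cases "k < p")
        case True
        have "k \<notin> ?J" using True by (auto simp: block_set_def)
        then have "u \<bullet> psum ?x k < u \<bullet> psum ?x p" using k pJ by (intro strict) auto
        then show ?thesis using psum_rearr_pre[OF \<sigma>lt, of k p x] True P by (simp add: Out_def)
      next
        case False
        have "k + ?L \<notin> ?J"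
        proof
          assume "k + ?L \<in> ?J"
          then obtain l where l: "l \<le> r" "k + ?L = p + sum j {..<l}" by (auto simp: block_set_def)
          then show False using block_start_mono[of l r] False k by linarith
        qed
        then have "u \<bullet> psum ?x (k + ?L) < u \<bullet> psum ?x p" using k pJ L by (intro strict) auto
        moreover have "u \<bullet> psum ?x (k + ?L) = u \<bullet> Out k"
          using psum_rearr_post[OF \<sigma>lt, of p k x] False uV'[of r] unfolding Out_def V_def by (simp add: inner_simps)
        ultimately show ?thesis using P by simp
      qed
    next
      fix l y assume l: "l < r" and y: "0 < y" "y < j l"
      have notJ: "p + sum j {..<l} + y \<notin> ?J"
      proof
        assume "p + sum j {..<l} + y \<in> ?J"
        then obtain l' where l': "l' \<le> r" "sum j {..<l} + y = sum j {..<l'}" by (auto simp: block_set_def)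
        have "l' \<le> l \<or> Suc l \<le> l'" by auto
        then show False using block_start_mono[of l' l] block_start_mono[of "Suc l" l'] l' y by auto
      qed
      have "p + sum j {..<l} + y \<le> p + sum j {..<Suc l}" using y by simp
      also have "\<dots> \<le> p + ?L" using l by (intro add_left_mono block_start_mono) auto
      also have "\<dots> \<le> N" using p L by simp
      finally have "u \<bullet> psum ?x (p + sum j {..<l} + y) < u \<bullet> psum ?x (p + sum j {..<l})"
        using l by (intro strict notJ inJ) auto
      then show "(\<Sum>i<y. u \<bullet> x (prod_encode (l, (i + \<sigma> l) mod j l))) < 0"
        using psum_rearr_block[OF \<sigma>lt l, of y x p] y by (simp add: inner_simps inner_sum_right)
    qed
    then show ?thesis by blast
  qed
  define uf where "uf a = (SOME u. good (fst a) (snd a) u)" for a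
  have uf: "good p \<sigma> (uf (p, \<sigma>))" if "(p, \<sigma>) \<in> ?A" for p \<sigma>
    using someI_ex[OF ex[OF that]] by (simp add: uf_def)
  show ?thesis
  proof (cases "?A = {}")
    case True
    then show ?thesis by (metis card.empty zero_le)
  next
    case False
    then obtain p0 \<sigma>0 where A0: "(p0, \<sigma>0) \<in> ?A" by auto
    define u0 where "u0 = uf (p0, \<sigma>0)"
    have u0: "good p0 \<sigma>0 u0" unfolding u0_def using A0 by (rule uf)
    have p0: "p0 \<le> N - ?L" and \<sigma>0: "\<sigma>0 \<in> ?S" using A0 by auto
    \<comment> \<open>A normal of any of the walks is constant on the corners of the reference walk
      \<open>(p0, \<sigma>0)\<close>; this lets \<open>face_normal_unique\<close> compare it with
      \<open>u0\<close>.\<close>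
    have const: "u \<bullet> psum (\<lambda>k. x (rearr r j p0 \<sigma>0 k)) i = u \<bullet> Out p0" if g: "good p \<sigma> u" and i: "i \<in> block_set p0 j r" for u p \<sigma> i
    proof -
      obtain l where l: "l \<le> r" "i = p0 + sum j {..<l}" using i by (auto simp: block_set_def)
      have "u \<bullet> (\<Sum>l'<l. V l') = 0" using g l by (auto simp: inner_sum_right good_def intro!: sum.neutral)
      then show ?thesis using corner[OF \<sigma>0 l(1), of p0] l by (simp add: inner_simps)
    qed
    have "uf ` ?A \<subseteq> {u0, - u0}"
    proof
      fix v assume "v \<in> uf ` ?A"
      then obtain p \<sigma> where A: "(p, \<sigma>) \<in> ?A" "v = uf (p, \<sigma>)" by auto
      then have v: "good p \<sigma> v" using uf by blast
      have "v = u0 \<or> v = - u0"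
      proof (rule face_normal_unique[OF gp[OF p0 \<sigma>0], of "block_set p0 j r"])
        show "block_set p0 j r \<subseteq> {..N}" using p0 L by (intro block_set_subset) auto
        show "Suc (card (block_set p0 j r)) = DIM('a)" "DIM('a) \<le> Suc N" using D card_block_set by auto
      qed (use u0 v const[OF u0] const[OF v] in \<open>auto simp: good_def\<close>)
      then show "v \<in> {u0, - u0}" by auto
    qed
    moreover have "inj_on uf ?A"
    proof (rule inj_onI)
      fix a a' assume a: "a \<in> ?A" "a' \<in> ?A" and eq: "uf a = uf a'"
      obtain p \<sigma> p' \<sigma>' where aa: "a = (p, \<sigma>)" "a' = (p', \<sigma>')" by (metis old.prod.exhaust)
      define u where "u = uf a"
      have g: "good p \<sigma> u" "good p' \<sigma>' u"
        using uf[OF a(1)[unfolded aa]] uf[OF a(2)[unfolded aa]] eq unfolding aa u_def by simp_all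
      have "p = p'"
      proof (rule ccontr)
        assume "p \<noteq> p'"
        then have "u \<bullet> Out p' < u \<bullet> Out p" "u \<bullet> Out p < u \<bullet> Out p'"
          using g a unfolding aa good_def by auto
        then show False by simp
      qed
      moreover have "\<sigma> = \<sigma>'"
      proof (rule PiE_ext)
        show S: "\<sigma> \<in> ?S" "\<sigma>' \<in> ?S" using a unfolding aa by auto
        fix l assume l: "l \<in> {..<r}"
        show "\<sigma> l = \<sigma>' l"
        proof (rule cyclic_max_unique[of "\<lambda>y. u \<bullet> x (prod_encode (l, y))" "j l"])
          show "(\<Sum>y<j l. u \<bullet> x (prod_encode (l, y))) = 0"
            using g(1) l unfolding good_def V_def by (simp add: inner_sum_right)
          show "\<sigma> l < j l" "\<sigma>' l < j l" using S l by (auto simp: PiE_iff)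
        qed (use g l in \<open>auto simp: good_def\<close>)
      qed
      ultimately show "a = a'" unfolding aa by simp
    qed
    ultimately have "card ?A \<le> card {u0, - u0}" by (intro card_inj_on_le) auto
    also have "\<dots> \<le> 2" by (simp add: card_insert_if)
    finally show ?thesis .
  qed
qed

end

section \<open>Faces of the hull of Brownian motion on a grid\<close>

locale brownian = prob_space M for M :: "'w measure" +
  fixes B :: "real \<Rightarrow> 'w \<Rightarrow> real ^ 'n"
  assumes sbm: "standard_brownian_motion M B"
begin

lemma B_measurable: "0 \<le> t \<Longrightarrow> B t \<in> borel_measurable M"
  using sbm by (simp add: standard_brownian_motion_def)

lemma B_0: "\<omega> \<in> space M \<Longrightarrow> B 0 \<omega> = 0"
  using sbm by (simp add: standard_brownian_motion_def)

lemma B_continuous: "AE \<omega> in M. continuous_on {0..} (\<lambda>t. B t \<omega>)"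
  using sbm by (simp add: standard_brownian_motion_def)

lemma B_increment:
  "0 \<le> s \<Longrightarrow> s < t \<Longrightarrow> distributed M lborel (\<lambda>\<omega>. B t \<omega> - B s \<omega>)
     (\<lambda>x. ennreal (gaussian_vec_density (sqrt (t - s)) x))"
  using sbm by (simp add: standard_brownian_motion_def)

lemma indep_increments:
  fixes \<tau> :: "nat \<Rightarrow> real"
  assumes "0 \<le> \<tau> 0" "\<And>i. i < K \<Longrightarrow> \<tau> i < \<tau> (Suc i)"
  shows "indep_vars (\<lambda>_. borel) (\<lambda>i \<omega>. B (\<tau> (Suc i)) \<omega> - B (\<tau> i) \<omega>) {..<K}"
proof -
  \<comment> \<open>The independence clause of Brownian motion speaks of infinite increasing
    sequences of times, so the finite one is continued in steps of 1.\<close>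
  define ts where "ts i = (if i \<le> K then \<tau> i else \<tau> K + real (i - K))" for i
  have "strict_mono ts"
    unfolding strict_mono_Suc_iff
  proof
    fix i show "ts i < ts (Suc i)"
      using assms(2)[of i] by (cases "i < K"; cases "i = K") (auto simp: ts_def)
  qed
  moreover have "0 \<le> ts 0" using assms by (simp add: ts_def)
  ultimately have "indep_vars (\<lambda>_. borel) (\<lambda>i \<omega>. B (ts (Suc i)) \<omega> - B (ts i) \<omega>) {..<K}"
    using sbm unfolding standard_brownian_motion_def by blast
  then show ?thesis
    by (subst indep_vars_cong[OF refl _ refl, where Y="\<lambda>i \<omega>. B (ts (Suc i)) \<omega> - B (ts i) \<omega>"])
      (auto simp: ts_def)
qed

text \<open>The increments run beyond time 1, because the rearrangements read them as the rows of an
  infinite array.\<close>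

definition xi :: "nat \<Rightarrow> nat \<Rightarrow> 'w \<Rightarrow> real ^ 'n" where
  "xi N k \<omega> = B (real (Suc k) / real N) \<omega> - B (real k / real N) \<omega>"

lemma xi_measurable[measurable]: "xi N k \<in> borel_measurable M"
  unfolding xi_def[abs_def] by (intro borel_measurable_diff B_measurable) auto

lemma psum_xi: "\<omega> \<in> space M \<Longrightarrow> psum (\<lambda>i. xi N i \<omega>) k = B (real k / real N) \<omega>"
  unfolding psum_def xi_def
  using sum_lessThan_telescope[of "\<lambda>i. B (real i / real N) \<omega>" k] by (simp add: B_0)

lemma distr_xi:
  assumes "N > 0"
  shows "distr M borel (xi N k) = distr M borel (xi N 0)"
proof -
  have "distr M borel (xi N k) = density lborel (\<lambda>x. ennreal (gaussian_vec_density (sqrt (1 / real N)) x))" for k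
  proof -
    have "distr M borel (xi N k) = distr M lborel (xi N k)" by (intro distr_cong) auto
    also have "\<dots> = density lborel (\<lambda>x. ennreal (gaussian_vec_density (sqrt (real (Suc k) / real N - real k / real N)) x))"
      unfolding xi_def[abs_def] using assms
      by (intro distributed_distr_eq_density B_increment) (auto simp: divide_strict_right_mono)
    also have "real (Suc k) / real N - real k / real N = 1 / real N"
      by (simp add: diff_divide_distrib[symmetric])
    finally show ?thesis .
  qed
  then show ?thesis by simp
qed

lemma indep_xi: "N > 0 \<Longrightarrow> indep_vars (\<lambda>_. borel) (xi N) {..<m}"
  using indep_increments[of "\<lambda>i. real i / real N" m] unfolding xi_def[abs_def]
  by (simp add: divide_strict_right_mono)

lemma law_xi:
  fixes \<pi> :: "nat \<Rightarrow> nat"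
  assumes "N > 0" "m > 0" "inj \<pi>"
  shows "distr M (PiM {..<m} (\<lambda>_. borel)) (\<lambda>\<omega>. \<lambda>k\<in>{..<m}. xi N (\<pi> k) \<omega>) =
    PiM {..<m} (\<lambda>_. distr M borel (xi N 0))"
proof -
  have "\<pi> ` {..<m} \<subseteq> {..<Suc (Max (\<pi> ` {..<m}))}"
    by (auto simp: less_Suc_eq_le intro!: Max_ge finite_imageI)
  then have "indep_vars (\<lambda>_. borel) (\<lambda>k. xi N (\<pi> k)) {..<m}"
    using indep_vars_reindex[OF indep_xi[OF assms(1)], of \<pi> "{..<m}"] assms(3)
    by (meson inj_on_subset subset_UNIV)
  then have "distr M (PiM {..<m} (\<lambda>_. borel)) (\<lambda>\<omega>. \<lambda>k\<in>{..<m}. xi N (\<pi> k) \<omega>) =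
    PiM {..<m} (\<lambda>k. distr M borel (xi N (\<pi> k)))"
    using assms(2) by (subst (asm) indep_vars_iff_distr_eq_PiM') auto
  also have "(\<lambda>k. distr M borel (xi N (\<pi> k))) = (\<lambda>_. distr M borel (xi N 0))"
    using distr_xi[OF assms(1)] by blast
  finally show ?thesis .
qed

lemma AE_increment_not_orthogonal:
  assumes "0 \<le> s" "s < t" "a \<noteq> 0"
  shows "AE y in distr M borel (\<lambda>\<omega>. B t \<omega> - B s \<omega>). a \<bullet> y \<noteq> 0"
proof -
  let ?f = "\<lambda>x::real^'n. ennreal (gaussian_vec_density (sqrt (t - s)) x)"
  have "distr M borel (\<lambda>\<omega>. B t \<omega> - B s \<omega>) = distr M lborel (\<lambda>\<omega>. B t \<omega> - B s \<omega>)"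
    by (intro distr_cong) auto
  also have "\<dots> = density lborel ?f"
    using assms by (intro distributed_distr_eq_density B_increment)
  finally have eq: "distr M borel (\<lambda>\<omega>. B t \<omega> - B s \<omega>) = density lborel ?f" .
  have "negligible {y. a \<bullet> y = 0}" using assms by (intro negligible_hyperplane) auto
  then have "{y. a \<bullet> y = 0} \<in> null_sets (completion lborel)" by (simp add: negligible_iff_null_sets)
  moreover have "{y. a \<bullet> y = 0} \<in> sets lborel" by (simp add: closed_hyperplane)
  ultimately have "{y. a \<bullet> y = 0} \<in> null_sets lborel"
    by (simp add: null_sets_completion_iff)
  then have "AE y in lborel. a \<bullet> y \<noteq> 0"
    by (rule AE_I'[of _ lborel]) auto
  then show ?thesis unfolding eq by (subst AE_density) auto
qed

text \<open>For a fixed \<open>T\<close>, the vector \<open>u\<close> annihilates the increments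
  between consecutive times of \<open>T\<close>. These are \<open>CARD('n) - 1\<close> independent
  vectors with densities, and together with the axis they almost surely leave no nonzero
  \<open>u\<close>.\<close>

lemma AE_gen_pos:
  assumes N: "N > 0" and card: "CARD('n) \<ge> 2"
  shows "AE \<omega> in M. gen_pos (axis k0 1) N (\<lambda>i. xi N i \<omega>)"
proof -
  let ?n = "CARD('n)" and ?e = "axis k0 1 :: real ^ 'n"
  let ?con = "\<lambda>T u \<omega>. \<forall>s\<in>T. \<forall>t\<in>T. u \<bullet> B (real s / real N) \<omega> = u \<bullet> B (real t / real N) \<omega>"
  have T: "AE \<omega> in M. \<forall>u. u \<bullet> ?e = 0 \<longrightarrow> ?con T u \<omega> \<longrightarrow> u = 0"
    if T: "T \<subseteq> {..N}" "card T = ?n" for T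
  proof -
    let ?L = "sorted_list_of_set T"
    have fin: "finite T" using T finite_subset by blast
    have len: "length ?L = ?n" using T by simp
    have nthT: "?L ! l \<in> T" if "l < ?n" for l using that len fin by (metis nth_mem set_sorted_list_of_set)
    \<comment> \<open>Past the elements of \<open>T\<close> the sequence continues beyond
      \<open>N\<close>, so that it is strictly increasing on all naturals.\<close>
    define t where "t l = (if l < ?n then ?L ! l else N + 1 + l)" for l
    have sm: "strict_mono t"
      unfolding strict_mono_Suc_iff
    proof
      fix l
      have "?L ! l < ?L ! Suc l" if "Suc l < ?n"
        using sorted_wrt_nth_less[OF strict_sorted_list_of_set[of T], of l "Suc l"] that len by simp
      moreover have "?L ! l \<le> N" if "l < ?n" using nthT[OF that] T by auto
      ultimately show "t l < t (Suc l)"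
        by (cases "Suc l < ?n"; cases "l < ?n") (fastforce simp: t_def)+
    qed
    define w where "w l \<omega> = B (real (t (Suc l)) / real N) \<omega> - B (real (t l) / real N) \<omega>" for l \<omega>
    have tm: "real (t l) / real N < real (t (Suc l)) / real N" for l
      using sm N by (simp add: strict_mono_Suc_iff divide_strict_right_mono)
    have ind: "indep_vars (\<lambda>_. borel) w {..<?n - 1}"
      using indep_increments[of "\<lambda>l. real (t l) / real N" "?n - 1"] tm unfolding w_def[abs_def] by simp
    have [measurable]: "w l \<in> borel_measurable M" for l
      unfolding w_def[abs_def] by (intro borel_measurable_diff B_measurable) auto
    have law: "distr M (PiM {..<?n - 1} (\<lambda>_. borel)) (\<lambda>\<omega>. \<lambda>k\<in>{..<?n - 1}. w k \<omega>) =
        PiM {..<?n - 1} (\<lambda>k. distr M borel (w k))"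
      using ind card by (subst (asm) indep_vars_iff_distr_eq_PiM') (auto simp: lessThan_empty_iff)
    \<comment> \<open>\<open>AE_PiM_annihilator_trivial\<close> asks for one deterministic choice of
      vectors that works; the other coordinate axes, enumerated by \<open>h\<close>, are such a
      choice.\<close>
    have "card (UNIV - {k0}) = ?n - 1" by (simp add: card_Diff_singleton)
    then obtain h where h: "bij_betw h {..<?n - 1} (UNIV - {k0})"
      using finite_same_card_bij[of "{..<?n - 1}" "UNIV - {k0}"] by auto
    have "AE x in PiM {..<?n - 1} (\<lambda>k. distr M borel (w k)). \<forall>u. (\<forall>v\<in>{?e}. u \<bullet> v = 0) \<and> (\<forall>i\<in>{..<?n - 1}. u \<bullet> x i = 0) \<longrightarrow> u = 0"
    proof (rule AE_PiM_annihilator_trivial[where z="\<lambda>l. axis (h l) 1"])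
      show "prob_space (distr M borel (w i))" for i by (rule prob_space_distr) auto
      show "AE y in distr M borel (w i). a \<bullet> y \<noteq> 0" if "a \<noteq> 0" for i a
        unfolding w_def[abs_def] using tm that by (intro AE_increment_not_orthogonal) auto
      show "u = 0" if u: "\<forall>v\<in>{?e}. u \<bullet> v = 0" "\<forall>i\<in>{..<?n - 1}. u \<bullet> axis (h i) 1 = 0" for u :: "real ^ 'n"
      proof -
        have "u $ c = 0" for c
        proof (cases "c = k0")
          case True then show ?thesis using u(1) by (simp add: inner_axis)
        next
          case False
          then have "c \<in> h ` {..<?n - 1}" using h by (auto simp: bij_betw_def)
          then obtain i where "i < ?n - 1" "c = h i" by auto
          then show ?thesis using u(2) by (auto simp: inner_axis)
        qed
        then show ?thesis by (simp add: vec_eq_iff)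
      qed
    qed auto
    then have "AE \<omega> in M. \<forall>u. (\<forall>v\<in>{?e}. u \<bullet> v = 0) \<and> (\<forall>i\<in>{..<?n - 1}. u \<bullet> (\<lambda>k\<in>{..<?n - 1}. w k \<omega>) i = 0) \<longrightarrow> u = 0"
      unfolding law[symmetric] by (rule AE_distrD[rotated]) (auto intro!: measurable_restrict)
    then show ?thesis
    proof eventually_elim
      case (elim \<omega>)
      show ?case
      proof (intro allI impI)
        fix u assume u: "u \<bullet> ?e = 0" "?con T u \<omega>"
        have "u \<bullet> w l \<omega> = 0" if "l < ?n - 1" for l
          using that u(2) nthT[of l] nthT[of "Suc l"] by (auto simp: w_def t_def inner_simps)
        then show "u = 0" using elim u(1) by auto
      qed
    qed
  qed
  have "AE \<omega> in M. \<forall>T\<in>{T. T \<subseteq> {..N} \<and> card T = ?n}. \<forall>u. u \<bullet> ?e = 0 \<longrightarrow>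
      ?con T u \<omega> \<longrightarrow> u = 0"
    using T by (intro AE_finite_allI) auto
  then show ?thesis
    using AE_space
  proof eventually_elim
    case (elim \<omega>)
    show ?case unfolding gen_pos_def
    proof (intro allI impI)
      fix T u assume T: "T \<subseteq> {..N}" "card T = DIM(real^'n)" and u: "u \<bullet> ?e = 0"
        "\<forall>s\<in>T. \<forall>t\<in>T. u \<bullet> psum (\<lambda>i. xi N i \<omega>) s = u \<bullet> psum (\<lambda>i. xi N i \<omega>) t"
      have "T \<in> {T. T \<subseteq> {..N} \<and> card T = ?n}" using T by simp
      from elim(1)[rule_format, OF this u(1)] show "u = 0"
        using u(2) unfolding psum_xi[OF elim(2)] by blast
    qed
  qed
qed

text \<open>General position is an event of the joint law of \<open>N\<close> increments, and this
  law is the same for every injective selection.\<close>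

lemma AE_gen_pos_reindex:
  assumes N: "N > 0" and card: "CARD('n) \<ge> 2" and \<pi>: "inj \<pi>"
  shows "AE \<omega> in M. gen_pos (axis k0 1) N (\<lambda>i. xi N (\<pi> i) \<omega>)"
proof -
  let ?P = "PiM {..<N} (\<lambda>_. borel :: (real^'n) measure)"
  let ?G = "gen_pos (axis k0 1) N"
  have cong: "?G (restrict x {..<N}) = ?G x" for x by (rule gen_pos_cong) auto
  have m: "(\<lambda>\<omega>. \<lambda>k\<in>{..<N}. xi N (\<pi> k) \<omega>) \<in> M \<rightarrow>\<^sub>M ?P" for \<pi> by (intro measurable_restrict) auto
  have G: "{x \<in> space ?P. ?G x} \<in> sets ?P" by (intro gen_pos_measurable) auto
  have "AE \<omega> in M. ?G (\<lambda>k\<in>{..<N}. xi N k \<omega>)" using AE_gen_pos[OF N card, of k0] by (simp add: cong)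
  then have "AE x in distr M ?P (\<lambda>\<omega>. \<lambda>k\<in>{..<N}. xi N k \<omega>). ?G x"
    using m[of "\<lambda>k. k"] by (subst AE_distr_iff[OF _ G]) auto
  also have "distr M ?P (\<lambda>\<omega>. \<lambda>k\<in>{..<N}. xi N k \<omega>) = distr M ?P (\<lambda>\<omega>. \<lambda>k\<in>{..<N}. xi N (\<pi> k) \<omega>)"
    using law_xi[OF N N \<pi>] law_xi[OF N N, of "\<lambda>k. k"] by simp
  finally have "AE \<omega> in M. ?G (\<lambda>k\<in>{..<N}. xi N (\<pi> k) \<omega>)"
    using m[of \<pi>] by (subst (asm) AE_distr_iff[OF _ G]) auto
  then show ?thesis by (simp add: cong)
qed

lemma supp_face_xi_measurable:
  "J \<subseteq> {..N} \<Longrightarrow> {\<omega> \<in> space M. supp_face e N J (\<lambda>i. xi N (\<pi> i) \<omega>)} \<in> events"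
  by (intro supp_face_measurable) auto

lemma prob_supp_face_reindex:
  assumes N: "N > 0" and \<pi>: "inj \<pi>" and J: "J \<subseteq> {..N}"
  shows "prob {\<omega> \<in> space M. supp_face e N J (\<lambda>i. xi N (\<pi> i) \<omega>)} = prob {\<omega> \<in> space M. supp_face e N J (\<lambda>i. xi N i \<omega>)}"
proof -
  let ?P = "PiM {..<N} (\<lambda>_. borel :: (real^'n) measure)"
  let ?Q = "PiM {..<N} (\<lambda>_. distr M borel (xi N 0))"
  have m: "(\<lambda>\<omega>. \<lambda>k\<in>{..<N}. xi N (\<pi> k) \<omega>) \<in> M \<rightarrow>\<^sub>M ?P" for \<pi> by (intro measurable_restrict) auto
  have F: "{x \<in> space ?P. supp_face e N J x} \<in> sets ?P" using J by (intro supp_face_measurable) auto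
  have "prob {\<omega> \<in> space M. supp_face e N J (\<lambda>i. xi N (\<pi> i) \<omega>)} = measure ?Q {x \<in> space ?P. supp_face e N J x}"
    if \<pi>: "inj \<pi>" for \<pi>
  proof -
    have "(\<lambda>\<omega>. \<lambda>k\<in>{..<N}. xi N (\<pi> k) \<omega>) -` {x \<in> space ?P. supp_face e N J x} \<inter> space M =
      {\<omega> \<in> space M. supp_face e N J (\<lambda>i. xi N (\<pi> i) \<omega>)}"
      using measurable_space[OF m[of \<pi>]]
        supp_face_cong[OF _ J, of "\<lambda>k\<in>{..<N}. xi N (\<pi> k) _" "\<lambda>k. xi N (\<pi> k) _"] by auto
    then show ?thesis
      unfolding law_xi[OF N N \<pi>, symmetric] by (simp add: measure_distr[OF m F])
  qed
  from this[OF \<pi>] this[of "\<lambda>k. k"] show ?thesis by simp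
qed

text \<open>All the rearranged walks have the same law, and the product of the gaps is the number of
  shifts \<open>\<sigma>\<close>. So the left-hand side is the expected number of pairs
  \<open>(p, \<sigma>)\<close> whose walk has the face, and this number is almost surely at most
  2.\<close>

lemma sum_prob_block_faces:
  assumes card: "CARD('n) = r + 2" and N: "r < N" and j: "\<And>l. l < r \<Longrightarrow> 0 < j l" and L: "sum j {..<r} \<le> N"
  shows "real (\<Prod>l<r. j l) * (\<Sum>p\<le>N - sum j {..<r}.
     prob {\<omega> \<in> space M. supp_face (axis k0 1) N (block_set p j r) (\<lambda>i. xi N i \<omega>)}) \<le> 2"
proof -
  let ?S = "Pi\<^sub>E {..<r} (\<lambda>l. {..<j l})" and ?e = "axis k0 1 :: real^'n" and ?L = "sum j {..<r}"
  let ?I = "{..N - ?L} \<times> ?S"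
  define E where "E a = {\<omega> \<in> space M. supp_face ?e N (block_set (fst a) j r) (\<lambda>i. xi N (rearr r j (fst a) (snd a) i) \<omega>)}" for a
  have N0: "N > 0" and card2: "CARD('n) \<ge> 2" using N card by auto
  have finS: "finite ?S" by (intro finite_PiE) auto
  have J: "block_set p j r \<subseteq> {..N}" if "p \<le> N - ?L" for p
    using that L by (intro block_set_subset[of r j] j) auto
  have inj: "inj (rearr r j p \<sigma>)" for p \<sigma> by (intro inj_rearr j)
  have Em: "E a \<in> events" if "a \<in> ?I" for a
  proof -
    have "fst a \<le> N - ?L" using that by (simp add: mem_Times_iff)
    then show ?thesis unfolding E_def by (intro supp_face_xi_measurable J)
  qed
  have Ei: "integrable M (indicator (E a) :: 'w \<Rightarrow> real)" if "a \<in> ?I" for a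
    using Em[OF that] by (simp add: emeasure_eq_measure)
  have "real (\<Prod>l<r. j l) * (\<Sum>p\<le>N - ?L. prob {\<omega> \<in> space M. supp_face ?e N (block_set p j r) (\<lambda>i. xi N i \<omega>)})
      = (\<Sum>p\<le>N - ?L. \<Sum>\<sigma>\<in>?S. prob (E (p, \<sigma>)))"
  proof -
    have "(\<Sum>p\<le>N - ?L. \<Sum>\<sigma>\<in>?S. prob (E (p, \<sigma>))) = (\<Sum>p\<le>N - ?L. \<Sum>\<sigma>\<in>?S. prob {\<omega> \<in> space M. supp_face ?e N (block_set p j r) (\<lambda>i. xi N i \<omega>)})"
      unfolding E_def fst_conv snd_conv by (intro sum.cong refl prob_supp_face_reindex N0 inj J) auto
    then show ?thesis by (simp add: card_PiE sum_distrib_left)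
  qed
  also have "\<dots> = (\<Sum>a\<in>?I. prob (E a))"
    by (simp add: sum.cartesian_product split_beta')
  also have "\<dots> = (\<Sum>a\<in>?I. expectation (indicator (E a)))"
    by (intro sum.cong refl) (simp add: Em sets.Int_space_eq2)
  also have "\<dots> = expectation (\<lambda>\<omega>. \<Sum>a\<in>?I. indicator (E a) \<omega>)"
    by (rule Bochner_Integration.integral_sum[symmetric]) (rule Ei)
  also have "\<dots> \<le> expectation (\<lambda>\<omega>. 2)"
  proof (rule integral_mono_AE)
    show "integrable M (\<lambda>\<omega>. \<Sum>a\<in>?I. indicator (E a) \<omega> :: real)"
      by (intro Bochner_Integration.integrable_sum Ei)
    have "AE \<omega> in M. \<forall>a\<in>?I. gen_pos ?e N (\<lambda>i. xi N (rearr r j (fst a) (snd a) i) \<omega>)"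
      using finS by (intro AE_finite_allI AE_gen_pos_reindex N0 card2 inj) auto
    then show "AE \<omega> in M. (\<Sum>a\<in>?I. indicator (E a) \<omega>) \<le> (2::real)"
      using AE_space
    proof eventually_elim
      case (elim \<omega>)
      have "(\<Sum>a\<in>?I. indicator (E a) \<omega>) =
        real (card {a \<in> ?I. \<omega> \<in> E a})"
        
      proof -
        have fin: "finite (?I)" using finS by simp
        show ?thesis by (simp only: indicator_def of_bool_def sum.inter_filter[OF fin, symmetric] real_of_card)
      qed
      also have "{a \<in> ?I. \<omega> \<in> E a} =
         {(p, \<sigma>) \<in> ?I. supp_face ?e N (block_set p j r) (\<lambda>k. xi N (rearr r j p \<sigma> k) \<omega>)}"
        unfolding E_def by (intro Collect_cong) (simp add: split_beta' elim(2) mem_Times_iff)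
      also have "real (card \<dots>) \<le> real 2"
        unfolding of_nat_le_iff
      proof (rule card_rearr_faces_le_2[of r j, OF j])
        show "gen_pos ?e N (\<lambda>k. xi N (rearr r j p \<sigma> k) \<omega>)" if "p \<le> N - ?L" "\<sigma> \<in> ?S" for p \<sigma>
          using bspec[OF elim(1), of "(p, \<sigma>)"] that by simp
      qed (simp_all add: card N L)
      finally show ?case by simp
    qed
  qed simp
  finally show ?thesis by (simp add: prob_space)
qed

end

section \<open>Gaussian estimates\<close>

lemma borel_measurable_vec_nth:
  "f \<in> borel_measurable M \<Longrightarrow> (\<lambda>x. (f x :: real ^ 'n) $ c) \<in> borel_measurable M"
  using borel_measurable_inner[of f M "\<lambda>_. axis c 1"] by (simp add: inner_axis)

lemma ennreal_power_mono: "a \<le> b \<Longrightarrow> a ^ n \<le> (b :: ennreal) ^ n"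
  by (induction n) (auto intro: mult_mono)

lemma nn_integral_lborel_vec_prod:
  fixes f :: "'n::finite \<Rightarrow> real \<Rightarrow> ennreal"
  assumes [measurable]: "\<And>c. f c \<in> borel_measurable borel"
  shows "(\<integral>\<^sup>+x. (\<Prod>c\<in>UNIV. f c (x $ c)) \<partial>(lborel :: (real ^ 'n) measure)) = (\<Prod>c\<in>UNIV. \<integral>\<^sup>+x. f c x \<partial>lborel)"
proof -
  let ?a = "\<lambda>c. axis c 1 :: real ^ 'n"
  have inj: "inj ?a" by (auto simp: inj_def axis_eq_axis)
  have Basis: "(Basis :: (real ^ 'n) set) = range ?a" by (auto simp: Basis_vec_def)
  define g where "g b = f (inv ?a b)" for b
  have g: "g (?a c) = f c" for c unfolding g_def by (simp only: inv_f_f[OF inj, of c])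
  have "(\<integral>\<^sup>+x. (\<Prod>b\<in>Basis. g b (x \<bullet> b)) \<partial>(lborel :: (real ^ 'n) measure)) = (\<Prod>b\<in>Basis. \<integral>\<^sup>+x. g b x \<partial>lborel)"
    by (rule nn_integral_lborel_prod) (auto simp: g_def)
  then show ?thesis unfolding Basis by (simp add: prod.reindex[OF inj] g inner_axis)
qed

lemma nn_integral_normal_density: "0 < \<sigma> \<Longrightarrow> (\<integral>\<^sup>+x. ennreal (normal_density \<mu> \<sigma> x) \<partial>lborel) = 1"
  by (subst nn_integral_eq_integral) auto

text \<open>Bound exp(a|x|) by exp(ax) + exp(-ax) and complete the square: each term is a shifted
  Gaussian density times exp((a \<sigma>)^2 / 2), which is at most exp(1/2).\<close>

lemma nn_integral_normal_exp_abs_le: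
  assumes "0 < \<sigma>" "0 \<le> a" "a * \<sigma> \<le> 1"
  shows "(\<integral>\<^sup>+x. ennreal (normal_density 0 \<sigma> x * exp (a * \<bar>x\<bar>)) \<partial>lborel) \<le> ennreal (2 * exp (1/2))"
proof -
  let ?h = "\<lambda>\<mu> x. ennreal (exp (1/2)) * ennreal (normal_density \<mu> \<sigma> x)"
  have shift: "normal_density 0 \<sigma> x * exp (t * x) = exp ((t * \<sigma>)\<^sup>2 / 2) * normal_density (t * \<sigma>\<^sup>2) \<sigma> x" for t x
  proof -
    have "- x\<^sup>2 / (2 * \<sigma>\<^sup>2) + t * x = (t * \<sigma>)\<^sup>2 / 2 + - (x - t * \<sigma>\<^sup>2)\<^sup>2 / (2 * \<sigma>\<^sup>2)"
      using assms by (simp add: field_simps power2_eq_square)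
    then have "exp (- x\<^sup>2 / (2 * \<sigma>\<^sup>2)) * exp (t * x) = exp ((t * \<sigma>)\<^sup>2 / 2) * exp (- (x - t * \<sigma>\<^sup>2)\<^sup>2 / (2 * \<sigma>\<^sup>2))"
      by (metis exp_add)
    then show ?thesis unfolding normal_density_def by simp
  qed
  have "(a * \<sigma>)\<^sup>2 \<le> 1" using assms by (simp add: power_le_one)
  then have e: "exp ((a * \<sigma>)\<^sup>2 / 2) \<le> exp (1/2)" by simp
  have "(\<integral>\<^sup>+x. ennreal (normal_density 0 \<sigma> x * exp (a * \<bar>x\<bar>)) \<partial>lborel) \<le>
     (\<integral>\<^sup>+x. ?h (a * \<sigma>\<^sup>2) x + ?h (- a * \<sigma>\<^sup>2) x \<partial>lborel)"
  proof (rule nn_integral_mono)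
    fix x
    have "exp (a * \<bar>x\<bar>) \<le> exp (a * x) + exp (- a * x)" by (cases "x \<ge> 0") auto
    then have "normal_density 0 \<sigma> x * exp (a * \<bar>x\<bar>) \<le> normal_density 0 \<sigma> x * exp (a * x) + normal_density 0 \<sigma> x * exp (- a * x)"
      by (metis distrib_left mult_left_mono normal_density_nonneg)
    also have "\<dots> = exp ((a * \<sigma>)\<^sup>2 / 2) * normal_density (a * \<sigma>\<^sup>2) \<sigma> x + exp ((a * \<sigma>)\<^sup>2 / 2) * normal_density (- a * \<sigma>\<^sup>2) \<sigma> x"
      unfolding shift by simp
    also have "\<dots> \<le> exp (1/2) * normal_density (a * \<sigma>\<^sup>2) \<sigma> x + exp (1/2) * normal_density (- a * \<sigma>\<^sup>2) \<sigma> x"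
      by (intro add_mono mult_right_mono e) auto
    finally show "ennreal (normal_density 0 \<sigma> x * exp (a * \<bar>x\<bar>)) \<le> ?h (a * \<sigma>\<^sup>2) x + ?h (- a * \<sigma>\<^sup>2) x"
      by (simp add: ennreal_mult'[symmetric] ennreal_plus[symmetric] ennreal_leI del: ennreal_plus)
  qed
  also have "\<dots> = ennreal (exp (1/2)) + ennreal (exp (1/2))"
    using assms by (subst nn_integral_add) (auto simp: nn_integral_cmult nn_integral_normal_density)
  also have "\<dots> = ennreal (2 * exp (1/2))" by (simp add: ennreal_plus[symmetric] del: ennreal_plus)
  finally show ?thesis .
qed

lemma (in prob_space) exp_Markov:
  fixes Z :: "'a \<Rightarrow> real"
  assumes [measurable]: "Z \<in> borel_measurable M" and c: "0 \<le> c"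
    and Z: "(\<integral>\<^sup>+\<omega>. ennreal (exp (Z \<omega>)) \<partial>M) \<le> ennreal c"
  shows "prob {\<omega> \<in> space M. y < Z \<omega>} \<le> c * exp (- y)"
proof -
  let ?u = "\<lambda>\<omega>. ennreal (exp (Z \<omega>))" and ?c = "ennreal (exp (- y))"
  have "emeasure M {\<omega> \<in> space M. y < Z \<omega>} \<le> emeasure M {\<omega> \<in> space M. 1 \<le> ?c * ?u \<omega>}"
  proof (rule emeasure_mono)
    show "{\<omega> \<in> space M. y < Z \<omega>} \<subseteq> {\<omega> \<in> space M. 1 \<le> ?c * ?u \<omega>}"
    proof
      fix \<omega> assume w: "\<omega> \<in> {\<omega> \<in> space M. y < Z \<omega>}"
      have "?c * ?u \<omega> = ennreal (exp (- y + Z \<omega>))"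
        by (simp only: ennreal_mult''[symmetric] exp_add exp_ge_zero)
      also have "\<dots> \<ge> ennreal 1" using w by (intro ennreal_leI) auto
      finally show "\<omega> \<in> {\<omega> \<in> space M. 1 \<le> ?c * ?u \<omega>}" using w by auto
    qed
  qed measurable
  also have "\<dots> \<le> ?c * (\<integral>\<^sup>+\<omega>. ?u \<omega> * indicator (space M) \<omega> \<partial>M)"
    by (rule nn_integral_Markov_inequality) measurable
  also have "\<dots> = ?c * (\<integral>\<^sup>+\<omega>. ?u \<omega> \<partial>M)"
    by (intro arg_cong[of _ _ "\<lambda>x. ?c * x"] nn_integral_cong) auto
  also have "\<dots> \<le> ?c * ennreal c" by (intro mult_left_mono Z) auto
  also have "\<dots> = ennreal (c * exp (- y))"
    using c by (simp add: ennreal_mult''[symmetric] mult.commute)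
  finally show ?thesis using c by (simp add: emeasure_eq_measure)
qed

context brownian
begin

lemma increment_measurable: "0 \<le> s \<Longrightarrow> 0 \<le> t \<Longrightarrow> (\<lambda>\<omega>. B t \<omega> - B s \<omega>) \<in> borel_measurable M"
  by (intro borel_measurable_diff B_measurable)

definition exp_const :: real where "exp_const = (2 * exp (1/2)) ^ CARD('n)"

text \<open>The Euclidean norm is at most the sum of the absolute coordinates, so the exponential
  splits into one-dimensional factors. The bound is the same for every length of time as long as
  \<open>a\<close> is at most the inverse standard deviation.\<close>

lemma exp_moment:
  assumes st: "0 \<le> s" "s < t" and a: "0 \<le> a" "a\<^sup>2 * (t - s) \<le> 1"
  shows "(\<integral>\<^sup>+\<omega>. ennreal (exp (a * norm (B t \<omega> - B s \<omega>))) \<partial>M) \<le> ennreal exp_const"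
proof -
  let ?\<sigma> = "sqrt (t - s)"
  let ?h = "\<lambda>x. normal_density 0 ?\<sigma> x * exp (a * \<bar>x\<bar>)"
  have \<sigma>: "0 < ?\<sigma>" using st by simp
  have "a * ?\<sigma> = sqrt (a\<^sup>2 * (t - s))" using a by (simp add: real_sqrt_mult)
  then have a\<sigma>: "a * ?\<sigma> \<le> 1" using a(2) by simp
  have "(\<integral>\<^sup>+\<omega>. ennreal (exp (a * norm (B t \<omega> - B s \<omega>))) \<partial>M) =
    (\<integral>\<^sup>+x. ennreal (gaussian_vec_density ?\<sigma> x) * ennreal (exp (a * norm x)) \<partial>(lborel :: (real^'n) measure))"
    by (rule distributed_nn_integral[OF B_increment[OF st], symmetric]) measurable
  also have "\<dots> \<le> (\<integral>\<^sup>+x. (\<Prod>c\<in>UNIV. ennreal (?h (x $ c))) \<partial>(lborel :: (real^'n) measure))"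
  proof (rule nn_integral_mono)
    fix x :: "real ^ 'n"
    have "exp (a * norm x) \<le> exp (\<Sum>c\<in>UNIV. a * \<bar>x $ c\<bar>)"
      using norm_le_l1_cart[of x] a by (simp add: sum_distrib_left[symmetric] mult_left_mono)
    also have "\<dots> = (\<Prod>c\<in>UNIV. exp (a * \<bar>x $ c\<bar>))" by (simp add: exp_sum)
    finally have "gaussian_vec_density ?\<sigma> x * exp (a * norm x) \<le> (\<Prod>c\<in>UNIV. ?h (x $ c))"
      unfolding gaussian_vec_density_def prod.distrib by (intro mult_left_mono prod_nonneg) auto
    then show "ennreal (gaussian_vec_density ?\<sigma> x) * ennreal (exp (a * norm x)) \<le> (\<Prod>c\<in>UNIV. ennreal (?h (x $ c)))"
      by (simp add: ennreal_mult''[symmetric] prod_ennreal ennreal_leI)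
  qed
  also have "\<dots> = (\<Prod>c\<in>(UNIV :: 'n set). \<integral>\<^sup>+x. ennreal (?h x) \<partial>lborel)"
    by (rule nn_integral_lborel_vec_prod) measurable
  also have "\<dots> \<le> (\<Prod>c\<in>(UNIV :: 'n set). ennreal (2 * exp (1/2)))"
    using nn_integral_normal_exp_abs_le[OF \<sigma> a(1) a\<sigma>] by (simp only: prod_constant ennreal_power_mono)
  also have "\<dots> = ennreal exp_const" by (simp add: exp_const_def ennreal_power)
  finally show ?thesis .
qed

section \<open>Independence of the scalar increments\<close>

lemma coord_prob:
  assumes st: "0 \<le> s" "s < t" and A: "\<And>c. A c \<in> sets borel"
  shows "emeasure M {\<omega> \<in> space M. \<forall>c. (B t \<omega> - B s \<omega>) $ c \<in> A c} =
    (\<Prod>c\<in>UNIV. \<integral>\<^sup>+x. ennreal (normal_density 0 (sqrt (t - s)) x) * indicator (A c) x \<partial>lborel)"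
proof -
  let ?\<sigma> = "sqrt (t - s)" and ?A = "{x :: real ^ 'n. \<forall>c. x $ c \<in> A c}"
  have [measurable]: "A c \<in> sets borel" for c by (rule A)
  have "?A = (\<Inter>c. (\<lambda>x. x $ c) -` A c)" by auto
  also have "\<dots> \<in> sets borel" by (intro sets.countable_INT'') (auto intro!: measurable_sets_borel[OF _ A])
  finally have mA: "?A \<in> sets lborel" by simp
  have "{\<omega> \<in> space M. \<forall>c. (B t \<omega> - B s \<omega>) $ c \<in> A c} = (\<lambda>\<omega>. B t \<omega> - B s \<omega>) -` ?A \<inter> space M" by auto
  then have "emeasure M {\<omega> \<in> space M. \<forall>c. (B t \<omega> - B s \<omega>) $ c \<in> A c} =
     (\<integral>\<^sup>+x. ennreal (gaussian_vec_density ?\<sigma> x) * indicator ?A x \<partial>lborel)"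
    using distributed_emeasure[OF B_increment[OF st] mA] by simp
  also have "\<dots> = (\<integral>\<^sup>+x. (\<Prod>c\<in>UNIV. ennreal (normal_density 0 ?\<sigma> (x $ c)) * indicator (A c) (x $ c)) \<partial>(lborel :: (real^'n) measure))"
  proof (rule nn_integral_cong)
    fix x :: "real^'n"
    have "(\<Prod>c\<in>UNIV. indicator (A c) (x $ c) :: ennreal) = indicator ?A x"
      by (auto simp: indicator_def intro!: prod.neutral)
    then show "ennreal (gaussian_vec_density ?\<sigma> x) * indicator ?A x = (\<Prod>c\<in>UNIV. ennreal (normal_density 0 ?\<sigma> (x $ c)) * indicator (A c) (x $ c))"
      by (simp add: prod.distrib gaussian_vec_density_def prod_ennreal)
  qed
  also have "\<dots> = (\<Prod>c\<in>UNIV. \<integral>\<^sup>+x. ennreal (normal_density 0 ?\<sigma> x) * indicator (A c) x \<partial>lborel)"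
    by (rule nn_integral_lborel_vec_prod) measurable
  finally show ?thesis .
qed

lemma coord_prob_single:
  assumes st: "0 \<le> s" "s < t" and A: "A \<in> sets borel"
  shows "emeasure M {\<omega> \<in> space M. (B t \<omega> - B s \<omega>) $ c \<in> A} =
    (\<integral>\<^sup>+x. ennreal (normal_density 0 (sqrt (t - s)) x) * indicator A x \<partial>lborel)"
proof -
  let ?q = "\<lambda>A. \<integral>\<^sup>+x. ennreal (normal_density 0 (sqrt (t - s)) x) * indicator A x \<partial>lborel"
  let ?A = "\<lambda>c'. if c' = c then A else UNIV"
  have "{\<omega> \<in> space M. (B t \<omega> - B s \<omega>) $ c \<in> A} = {\<omega> \<in> space M. \<forall>c'. (B t \<omega> - B s \<omega>) $ c' \<in> ?A c'}" by auto
  also have "emeasure M \<dots> = (\<Prod>c'\<in>UNIV. ?q (?A c'))"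
    using A by (intro coord_prob st) auto
  also have "\<dots> = (\<Prod>c'\<in>UNIV. if c' = c then ?q A else 1)"
    using st by (intro prod.cong) (auto simp: nn_integral_normal_density)
  finally show ?thesis by simp
qed

lemma coord_prob_prod:
  assumes st: "0 \<le> s" "s < t" and A: "\<And>c. A c \<in> sets borel"
  shows "prob {\<omega> \<in> space M. \<forall>c. (B t \<omega> - B s \<omega>) $ c \<in> A c} =
    (\<Prod>c\<in>UNIV. prob {\<omega> \<in> space M. (B t \<omega> - B s \<omega>) $ c \<in> A c})"
proof -
  let ?p = "\<lambda>c. prob {\<omega> \<in> space M. (B t \<omega> - B s \<omega>) $ c \<in> A c}"
  have "ennreal (prob {\<omega> \<in> space M. \<forall>c. (B t \<omega> - B s \<omega>) $ c \<in> A c}) =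
    (\<Prod>c\<in>UNIV. ennreal (?p c))"
    unfolding emeasure_eq_measure[symmetric] coord_prob[OF st A] coord_prob_single[OF st A] ..
  also have "\<dots> = ennreal (\<Prod>c\<in>UNIV. ?p c)"
    by (simp add: prod_ennreal)
  finally show ?thesis by (simp add: prod_nonneg)
qed

text \<open>The independence of X and Y comes from here: the vector increments are independent of
  each other, and within each one the probabilities of the coordinates multiply.\<close>

lemma indep_coords:
  assumes N: "N > 0"
  shows "indep_vars (\<lambda>_. borel) (\<lambda>(k, c) \<omega>. xi N k \<omega> $ c) ({..<N} \<times> UNIV)"
proof -
  let ?X = "\<lambda>(k, c) \<omega>. xi N k \<omega> $ c" and ?I = "{..<N} \<times> (UNIV :: 'n set)"
  let ?G = "\<lambda>i. {?X i -` A \<inter> space M |A. A \<in> sets borel}"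
  let ?d = "\<lambda>k \<omega>. B (real (Suc k) / real N) \<omega> - B (real k / real N) \<omega>"
  have rv: "random_variable borel (?X i)" for i
    by (cases i) (simp add: borel_measurable_vec_nth)
  have "indep_sets ?G ?I"
  proof (subst indep_sets_finite)
    show "?I \<noteq> {}" "finite ?I" using N by auto
    show "?G i \<subseteq> events" for i using measurable_sets[OF rv] by blast
    show "space M \<in> ?G i" for i
      by (intro CollectI exI[of _ UNIV]) auto
    show "\<forall>A\<in>\<Pi> i\<in>?I. ?G i. prob (\<Inter>i\<in>?I. A i) = (\<Prod>i\<in>?I. prob (A i))"
    proof
      fix A assume A: "A \<in> (\<Pi> i\<in>?I. ?G i)"
      have "\<forall>i\<in>?I. \<exists>E. E \<in> sets borel \<and> A i = ?X i -` E \<inter> space M"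
        using Pi_mem[OF A] by blast
      then obtain E where E: "\<And>i. i \<in> ?I \<Longrightarrow> E i \<in> sets borel" "\<And>i. i \<in> ?I \<Longrightarrow> A i = ?X i -` E i \<inter> space M"
        by metis
      define F where "F k = {v :: real ^ 'n. \<forall>c. v $ c \<in> E (k, c)}" for k
      have F: "F k \<in> sets borel" if "k < N" for k
      proof -
        have "F k = (\<Inter>c. (\<lambda>x. x $ c) -` E (k, c))" by (auto simp: F_def)
        also have "\<dots> \<in> sets borel"
        proof (intro sets.countable_INT'')
          show "(\<lambda>x. x $ c) -` E (k, c) \<in> sets borel" for c
            by (rule measurable_sets_borel[OF _ E(1)]) (use that in \<open>auto intro!: borel_measurable_vec_nth\<close>)
        qed auto
        finally show ?thesis .
      qed
      have "(\<Inter>i\<in>?I. A i) = (\<Inter>k\<in>{..<N}. xi N k -` F k \<inter> space M)"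
        using N by (auto simp: E(2) F_def)
      also have "prob \<dots> = (\<Prod>k\<in>{..<N}. prob (xi N k -` F k \<inter> space M))"
        using N F by (intro indep_varsD_finite[OF indep_xi]) auto
      also have "\<dots> = (\<Prod>k\<in>{..<N}. \<Prod>c\<in>UNIV. prob (A (k, c)))"
      proof (intro prod.cong refl)
        fix k assume k: "k \<in> {..<N}"
        have "xi N k -` F k \<inter> space M = {\<omega> \<in> space M. \<forall>c. ?d k \<omega> $ c \<in> E (k, c)}"
          by (auto simp: xi_def F_def)
        also have "prob \<dots> = (\<Prod>c\<in>UNIV. prob {\<omega> \<in> space M. ?d k \<omega> $ c \<in> E (k, c)})"
          using N k E(1) by (intro coord_prob_prod) (auto simp: divide_strict_right_mono)
        also have "\<dots> = (\<Prod>c\<in>UNIV. prob (A (k, c)))"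
          using k by (intro prod.cong refl arg_cong[of _ _ prob]) (auto simp: E(2) xi_def)
        finally show "prob (xi N k -` F k \<inter> space M) = (\<Prod>c\<in>UNIV. prob (A (k, c)))" .
      qed
      also have "\<dots> = (\<Prod>i\<in>?I. prob (A i))"
        by (simp add: prod.cartesian_product)
      finally show "prob (\<Inter>i\<in>?I. A i) = (\<Prod>i\<in>?I. prob (A i))" .
    qed
  qed
  then show ?thesis unfolding indep_vars_def2 using rv by auto
qed

text \<open>The interval reaches to \<open>2 * \<rho>\<close> because the bound
  \<open>\<rho> / 2 ^ l\<close> on a coordinate of a scale increment will be compared with the lower
  bound \<open>1 / 2 ^ Suc l\<close> for its standard deviation.\<close>

definition small_prob :: "real \<Rightarrow> real" where
  "small_prob \<rho> = measure (density lborel (\<lambda>x. ennreal (std_normal_density x))) {- 2 * \<rho>..2 * \<rho>}"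

lemma small_prob_less_1: "small_prob \<rho> < 1"
proof -
  let ?G = "density lborel (\<lambda>x. ennreal (std_normal_density x))"
  \<comment> \<open>With the absolute value this interval is disjoint from the other one for either
    sign of \<open>\<rho>\<close>.\<close>
  let ?I = "{2 * \<bar>\<rho>\<bar><..<2 * \<bar>\<rho>\<bar> + 1}"
  interpret G: prob_space ?G by (rule prob_space_normal_density) simp
  have "G.prob ?I \<noteq> 0"
  proof
    assume "G.prob ?I = 0"
    then have "emeasure ?G ?I = 0" by (simp add: G.emeasure_eq_measure)
    then have "AE x in lborel. std_normal_density x * indicator ?I x = 0"
      by (subst (asm) emeasure_density) (auto simp: nn_integral_0_iff_AE indicator_def elim!: eventually_mono split: if_splits)
    then have "AE x in lborel. x \<notin> ?I"
    proof eventually_elim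
      case (elim x)
      then show ?case using normal_density_pos[of 1 0 x] by (auto simp: indicator_def split: if_splits)
    qed
    then have "?I \<in> null_sets lborel"
      by (subst AE_iff_null_sets) auto
    then have "emeasure lborel ?I = 0" by (rule null_setsD1)
    then show False by simp
  qed
  then have pos: "0 < G.prob ?I" by (simp add: zero_less_measure_iff)
  have "small_prob \<rho> + G.prob ?I = G.prob ({- 2 * \<rho>..2 * \<rho>} \<union> ?I)"
    unfolding small_prob_def by (rule G.finite_measure_Union[symmetric]) auto
  also have "\<dots> \<le> 1" by simp
  finally show ?thesis using pos by linarith
qed

lemma small_prob_nonneg: "0 \<le> small_prob \<rho>"
  by (simp add: small_prob_def)

lemma abs_coord_prob_le:
  assumes st: "0 \<le> s" "s < t" and a: "0 \<le> a" "a\<^sup>2 \<le> 4 * (t - s)" and \<rho>: "0 \<le> \<rho>"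
  shows "prob {\<omega> \<in> space M. \<bar>(B t \<omega> - B s \<omega>) $ c\<bar> \<le> \<rho> * a} \<le> small_prob \<rho>"
proof -
  let ?\<sigma> = "sqrt (t - s)"
  define V where "V \<omega> = (B t \<omega> - B s \<omega>) $ c" for \<omega>
  have \<sigma>: "0 < ?\<sigma>" using st by simp
  have mV[measurable]: "V \<in> borel_measurable M"
    unfolding V_def[abs_def] by (intro borel_measurable_vec_nth increment_measurable) (use st in auto)
  have "distributed M lborel V (\<lambda>x. ennreal (normal_density 0 ?\<sigma> x))"
    unfolding distributed_def
  proof (intro conjI)
    show "distr M lborel V = density lborel (\<lambda>x. ennreal (normal_density 0 ?\<sigma> x))"
    proof (rule measure_eqI)
      fix A assume "A \<in> sets (distr M lborel V)"
      then have A[measurable]: "A \<in> sets borel" by simp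
      have "emeasure (distr M lborel V) A = emeasure M {\<omega> \<in> space M. V \<omega> \<in> A}"
        by (subst emeasure_distr) (auto intro!: arg_cong[where f="emeasure M"])
      then show "emeasure (distr M lborel V) A = emeasure (density lborel (\<lambda>x. ennreal (normal_density 0 ?\<sigma> x))) A"
        using coord_prob_single[OF st A, of c] unfolding V_def[symmetric] by (simp add: emeasure_density)
    qed simp
  qed auto
  then have Z: "distributed M lborel (\<lambda>\<omega>. (V \<omega> - 0) / ?\<sigma>) (\<lambda>x. ennreal (std_normal_density x))"
    using normal_standard_normal_convert[OF \<sigma>, of V 0] by simp
  have "a \<le> 2 * ?\<sigma>"
    by (rule power2_le_imp_le) (use a st in \<open>auto simp: power_mult_distrib\<close>)
  then have bound: "\<rho> * a \<le> 2 * \<rho> * ?\<sigma>" using mult_left_mono[OF _ \<rho>, of a "2 * ?\<sigma>"] by simp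
  have "prob {\<omega> \<in> space M. \<bar>V \<omega>\<bar> \<le> \<rho> * a} \<le> prob ((\<lambda>\<omega>. (V \<omega> - 0) / ?\<sigma>) -` {- 2 * \<rho>..2 * \<rho>} \<inter> space M)"
  proof (rule finite_measure_mono)
    show "{\<omega> \<in> space M. \<bar>V \<omega>\<bar> \<le> \<rho> * a} \<subseteq> (\<lambda>\<omega>. (V \<omega> - 0) / ?\<sigma>) -` {- 2 * \<rho>..2 * \<rho>} \<inter> space M"
    proof
      fix \<omega> assume w: "\<omega> \<in> {\<omega> \<in> space M. \<bar>V \<omega>\<bar> \<le> \<rho> * a}"
      then have "\<bar>V \<omega>\<bar> \<le> 2 * \<rho> * ?\<sigma>" using bound by auto
      then have "\<bar>V \<omega> / ?\<sigma>\<bar> \<le> 2 * \<rho>" using \<sigma> by (simp add: pos_divide_le_eq)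
      then have "- 2 * \<rho> \<le> V \<omega> / ?\<sigma> \<and> V \<omega> / ?\<sigma> \<le> 2 * \<rho>" by linarith
      then show "\<omega> \<in> (\<lambda>\<omega>. (V \<omega> - 0) / ?\<sigma>) -` {- 2 * \<rho>..2 * \<rho>} \<inter> space M"
        using w by simp
    qed
  qed measurable
  also have "\<dots> = measure (distr M lborel (\<lambda>\<omega>. (V \<omega> - 0) / ?\<sigma>)) {- 2 * \<rho>..2 * \<rho>}"
    by (rule measure_distr[symmetric]) auto
  also have "\<dots> = small_prob \<rho>"
    unfolding small_prob_def distributed_distr_eq_density[OF Z] ..
  finally show ?thesis unfolding V_def .
qed

end

section \<open>Increments at geometric scales\<close>

text \<open>With w l = 2^l \<delta> l the recursion reads w l \<le> w (l + 1) / 2 + A l, and summing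
  over l bounds the total by 2 C K. Hence at most K / 8 indices have w l > 16 C. Each of them spoils
  itself and its predecessor, so at least K - 1 - K / 4 of the indices below K are left, and this is
  at least K / 2 because K \<ge> 4.\<close>

lemma many_good_scales:
  fixes \<delta> A :: "nat \<Rightarrow> real"
  assumes K: "K \<ge> 4" and C: "C > 0" and \<delta>0: "\<And>l. 0 \<le> \<delta> l" "\<delta> (Suc K) = 0"
    and step: "\<And>l. l \<in> {1..K} \<Longrightarrow> \<delta> l \<le> \<delta> (Suc l) + A l / 2 ^ l"
    and A: "(\<Sum>l=1..K. A l) \<le> C * real K"
  shows "K \<le> 2 * card {l \<in> {1..<K}. 2 ^ l * \<delta> l \<le> 16 * C \<and> 2 ^ Suc l * \<delta> (Suc l) \<le> 16 * C}"
proof -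
  define w where "w l = 2 ^ l * \<delta> l" for l
  have w0: "0 \<le> w l" for l using \<delta>0 by (simp add: w_def)
  have "w l \<le> w (Suc l) / 2 + A l" if "l \<in> {1..K}" for l
  proof -
    have "w l \<le> 2 ^ l * (\<delta> (Suc l) + A l / 2 ^ l)" unfolding w_def using step[OF that] by (intro mult_left_mono) auto
    then show ?thesis by (simp add: w_def algebra_simps)
  qed
  then have "(\<Sum>l=1..K. w l) \<le> (\<Sum>l=1..K. w (Suc l) / 2 + A l)" by (intro sum_mono) auto
  also have "\<dots> = (\<Sum>l=1..K. w (Suc l)) / 2 + (\<Sum>l=1..K. A l)" by (simp add: sum.distrib sum_divide_distrib)
  also have "(\<Sum>l=1..K. w (Suc l)) = (\<Sum>l=1..K. w l) + w (Suc K) - w 1"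
    using K by (induction K rule: dec_induct) (auto simp: sum.atLeast_Suc_atMost numeral_eq_Suc)
  finally have sum_w: "(\<Sum>l=1..K. w l) \<le> 2 * C * real K" using A w0[of 1] \<delta>0(2) by (simp add: w_def field_simps)
  define Bad where "Bad = {l \<in> {1..K}. w l > 16 * C}"
  have "16 * C * real (card Bad) \<le> (\<Sum>l\<in>Bad. w l)"
    using sum_bounded_below[of Bad "16 * C" w] by (auto simp: Bad_def mult.commute)
  also have "\<dots> \<le> (\<Sum>l=1..K. w l)" by (intro sum_mono2) (auto simp: Bad_def w0)
  finally have "C * (8 * real (card Bad)) \<le> C * real K" using sum_w by simp
  then have "8 * real (card Bad) \<le> real K" using C by simp
  then have bad: "8 * card Bad \<le> K" by linarith
  let ?G = "{l \<in> {1..<K}. 2 ^ l * \<delta> l \<le> 16 * C \<and> 2 ^ Suc l * \<delta> (Suc l) \<le> 16 * C}"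
  have "{1..<K} \<subseteq> ?G \<union> Bad \<union> (\<lambda>l. l - 1) ` Bad"
  proof
    fix l assume l: "l \<in> {1..<K}"
    show "l \<in> ?G \<union> Bad \<union> (\<lambda>l. l - 1) ` Bad"
    proof (cases "w (Suc l) > 16 * C")
      case True
      then have "Suc l \<in> Bad" using l by (auto simp: Bad_def)
      then have "l \<in> (\<lambda>l. l - 1) ` Bad" by (intro image_eqI[of _ _ "Suc l"]) auto
      then show ?thesis by blast
    qed (use l in \<open>auto simp: Bad_def w_def\<close>)
  qed
  then have "card {1..<K} \<le> card (?G \<union> Bad \<union> (\<lambda>l. l - 1) ` Bad)"
    by (intro card_mono) (auto simp: Bad_def)
  also have "\<dots> \<le> card ?G + card Bad + card ((\<lambda>l. l - 1) ` Bad)"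
    by (meson add_le_mono1 card_Un_le le_trans)
  also have "card ((\<lambda>l. l - 1) ` Bad) \<le> card Bad" by (rule card_image_le) (auto simp: Bad_def)
  finally have "K - 1 \<le> card ?G + 2 * card Bad" by simp
  then show ?thesis using bad K by linarith
qed

text \<open>Grid index of the time at distance \<open>4\<^sup>-\<^sup>l\<close> from \<open>i / 64\<^sup>K\<close>, towards the centre of the unit interval.\<close>

definition scale_index :: "nat \<Rightarrow> nat \<Rightarrow> nat \<Rightarrow> nat" where
  "scale_index K i l =
     (if l > K then i else if 2 * i \<le> 64 ^ K then i + 4 ^ (3 * K - l) else i - 4 ^ (3 * K - l))"

lemma pow64: "(64::'a::comm_semiring_1) ^ K = 4 ^ (3 * K)"
  by (simp add: power_mult)

lemma scale_index_props:
  assumes i: "i \<le> 64 ^ K" and l: "1 \<le> l"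
  shows "scale_index K i l \<le> 64 ^ K"
    and "l \<le> K \<Longrightarrow> 2 * i \<le> 64 ^ K \<Longrightarrow> real (scale_index K i l) / 64 ^ K = real i / 64 ^ K + 1 / 4 ^ l"
    and "l \<le> K \<Longrightarrow> \<not> 2 * i \<le> 64 ^ K \<Longrightarrow> real (scale_index K i l) / 64 ^ K = real i / 64 ^ K - 1 / 4 ^ l"
proof -
  have le: "4 * (4::nat) ^ (3 * K - l) \<le> 64 ^ K" if "l \<le> K"
  proof -
    have "4 * (4::nat) ^ (3 * K - l) = 4 ^ Suc (3 * K - l)" by simp
    also have "\<dots> \<le> 4 ^ (3 * K)" using l that by (intro power_increasing) auto
    finally show ?thesis by (simp add: pow64)
  qed
  have r: "real (4 ^ (3 * K - l)) / 64 ^ K = 1 / 4 ^ l" if "l \<le> K"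
  proof -
    have "(4::real) ^ (3 * K) = 4 ^ (3 * K - l) * 4 ^ l" using that by (simp flip: power_add)
    then show ?thesis by (simp add: pow64)
  qed
  show "scale_index K i l \<le> 64 ^ K" using le i by (auto simp: scale_index_def)
  show "real (scale_index K i l) / 64 ^ K = real i / 64 ^ K + 1 / 4 ^ l" if "l \<le> K" "2 * i \<le> 64 ^ K"
    using that r by (simp add: scale_index_def add_divide_distrib)
  show "real (scale_index K i l) / 64 ^ K = real i / 64 ^ K - 1 / 4 ^ l" if "l \<le> K" "\<not> 2 * i \<le> 64 ^ K"
  proof -
    have "4 ^ (3 * K - l) \<le> i" using le[OF that(1)] that(2) by linarith
    then have "real (scale_index K i l) = real i - real (4 ^ (3 * K - l))"
      using that by (simp add: scale_index_def of_nat_diff)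
    then show ?thesis using r[OF that(1)] by (simp add: diff_divide_distrib)
  qed
qed

section \<open>Independence and size of the scale increments\<close>

context brownian
begin

definition scale_incr :: "nat \<Rightarrow> nat \<Rightarrow> nat \<Rightarrow> 'w \<Rightarrow> real ^ 'n" where
  "scale_incr K i l \<omega> = B (real (scale_index K i l) / 64 ^ K) \<omega> - B (real (scale_index K i (Suc l)) / 64 ^ K) \<omega>"

lemma scale_incr_measurable: "scale_incr K i l \<in> borel_measurable M"
  unfolding scale_incr_def[abs_def] by (intro increment_measurable) auto

lemma scale_incr_increment:
  assumes i: "i \<le> 64 ^ K" and l: "l \<in> {1..K}"
  obtains s t where "0 \<le> s" "s < t" "4 ^ l * (t - s) \<le> 1" "1 \<le> 4 * (4 ^ l * (t - s))"
    "(\<forall>\<omega>. scale_incr K i l \<omega> = B t \<omega> - B s \<omega>) \<or> (\<forall>\<omega>. scale_incr K i l \<omega> = - (B t \<omega> - B s \<omega>))"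
proof -
  let ?t = "real i / 64 ^ K"
  let ?g = "\<lambda>l. real (scale_index K i l) / 64 ^ K"
  \<comment> \<open>\<open>v\<close> is the distance of the next scale from the point
    \<open>i\<close>; it is 0 for \<open>l = K\<close>, since \<open>scale_index\<close> returns
    \<open>i\<close> past \<open>K\<close>. So the time interval has length 3/4 of 4^-l for
    \<open>l < K\<close> and exactly 4^-K for \<open>l = K\<close>.\<close>
  define v :: real where "v = (if l = K then 0 else 1 / 4 ^ Suc l)"
  have v: "0 \<le> v" "v < 1 / 4 ^ l" "4 ^ l * (1 / 4 ^ l - v) \<le> 1" "1 \<le> 4 * (4 ^ l * (1 / 4 ^ l - v))"
    by (auto simp: v_def field_simps)
  have g0: "0 \<le> ?g l" "0 \<le> ?g (Suc l)" by auto
  show ?thesis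
  proof (cases "2 * i \<le> 64 ^ K")
    case True
    have "?g l = ?t + 1 / 4 ^ l" using scale_index_props(2)[OF i, of l] l True by simp
    moreover have "?g (Suc l) = ?t + v"
      using scale_index_props(2)[OF i, of "Suc l"] l True by (auto simp: v_def scale_index_def)
    ultimately show ?thesis
      using v g0 by (intro that[of "?g (Suc l)" "?g l"]) (auto simp: scale_incr_def)
  next
    case False
    have "?g l = ?t - 1 / 4 ^ l" using scale_index_props(3)[OF i, of l] l False by simp
    moreover have "?g (Suc l) = ?t - v"
      using scale_index_props(3)[OF i, of "Suc l"] l False by (auto simp: v_def scale_index_def)
    ultimately show ?thesis
      using v g0 by (intro that[of "?g l" "?g (Suc l)"]) (auto simp: scale_incr_def)
  qed
qed

text \<open>The scale increments belong to adjacent time intervals. If these lie to the right of the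
  point \<open>i\<close>, the times decrease with \<open>l\<close> and the enumeration is reversed;
  if they lie to the left, the sign is flipped.\<close>

lemma indep_scale_incr:
  assumes i: "i \<le> 64 ^ K"
  shows "indep_vars (\<lambda>_. borel) (scale_incr K i) {1..K}"
proof -
  let ?t = "real i / 64 ^ K"
  let ?g = "\<lambda>l. real (scale_index K i l) / 64 ^ K"
  have p: "1 / 4 ^ Suc l < 1 / (4::real) ^ l" for l by (simp add: field_simps)
  show ?thesis
  proof (cases "2 * i \<le> 64 ^ K")
    case True
    have lt: "?g (Suc l) < ?g l" if "l \<in> {1..K}" for l
      using scale_index_props(2)[OF i, of l] scale_index_props(2)[OF i, of "Suc l"] that True p[of l]
      by (cases "l = K") (auto simp: scale_index_def)
    define \<tau> where "\<tau> m = ?g (Suc K - m)" for m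
    have "indep_vars (\<lambda>_. borel) (\<lambda>m \<omega>. B (\<tau> (Suc m)) \<omega> - B (\<tau> m) \<omega>) {..<K}"
    proof (rule indep_increments)
      show "0 \<le> \<tau> 0" by (simp add: \<tau>_def)
      show "\<tau> m < \<tau> (Suc m)" if "m < K" for m
        using lt[of "K - m"] that by (auto simp: \<tau>_def Suc_diff_le)
    qed
    moreover have "inj_on (\<lambda>l. K - l) {1..K}" "(\<lambda>l. K - l) ` {1..K} \<subseteq> {..<K}" by (auto simp: inj_on_def)
    ultimately have "indep_vars (\<lambda>_. borel) (\<lambda>l \<omega>. B (\<tau> (Suc (K - l))) \<omega> - B (\<tau> (K - l)) \<omega>) {1..K}"
      by (rule indep_vars_reindex)
    then show ?thesis
      by (subst indep_vars_cong[OF refl _ refl, where Y="\<lambda>l \<omega>. B (\<tau> (Suc (K - l))) \<omega> - B (\<tau> (K - l)) \<omega>"])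
        (auto simp: scale_incr_def[abs_def] \<tau>_def Suc_diff_le)
  next
    case False
    have lt: "?g l < ?g (Suc l)" if "l \<in> {1..K}" for l
      using scale_index_props(3)[OF i, of l] scale_index_props(3)[OF i, of "Suc l"] that False p[of l]
      by (cases "l = K") (auto simp: scale_index_def)
    define \<tau> where "\<tau> m = ?g (Suc m)" for m
    have "indep_vars (\<lambda>_. borel) (\<lambda>m \<omega>. B (\<tau> (Suc m)) \<omega> - B (\<tau> m) \<omega>) {..<K}"
    proof (rule indep_increments)
      show "0 \<le> \<tau> 0" by (simp add: \<tau>_def)
      show "\<tau> m < \<tau> (Suc m)" if "m < K" for m
        using lt[of "Suc m"] that by (auto simp: \<tau>_def)
    qed
    moreover have "inj_on (\<lambda>l. l - 1) {1..K}" "(\<lambda>l. l - 1) ` {1..K} \<subseteq> {..<K}" by (auto simp: inj_on_def)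
    ultimately have "indep_vars (\<lambda>_. borel) (\<lambda>l \<omega>. B (\<tau> (Suc (l - 1))) \<omega> - B (\<tau> (l - 1)) \<omega>) {1..K}"
      by (rule indep_vars_reindex)
    then have "indep_vars (\<lambda>_. borel) (\<lambda>l \<omega>. - (B (\<tau> (Suc (l - 1))) \<omega> - B (\<tau> (l - 1)) \<omega>)) {1..K}"
      by (rule indep_vars_compose2[where Y="\<lambda>_. uminus"]) auto
    then show ?thesis
      by (subst indep_vars_cong[OF refl _ refl, where Y="\<lambda>l \<omega>. - (B (\<tau> (Suc (l - 1))) \<omega> - B (\<tau> (l - 1)) \<omega>)"])
        (auto simp: scale_incr_def[abs_def] \<tau>_def)
  qed
qed

text \<open>The weight \<open>2 ^ l\<close> undoes Brownian scaling, so that the summands are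
  typically of order 1. Off this event the sum hypothesis of \<open>many_good_scales\<close> holds
  with the same \<open>C\<close>.\<close>

definition rough_at :: "real \<Rightarrow> nat \<Rightarrow> nat \<Rightarrow> 'w set" where
  "rough_at C K i = {\<omega> \<in> space M. C * real K < (\<Sum>l=1..K. 2 ^ l * norm (scale_incr K i l \<omega>))}"

lemma rough_at_measurable: "rough_at C K i \<in> events"
proof -
  note [measurable] = scale_incr_measurable
  show ?thesis unfolding rough_at_def by measurable
qed

text \<open>An exponential Markov bound: independence multiplies the \<open>K\<close> exponential
  moments, each at most \<open>exp_const\<close>. As \<open>C\<close> is free, the result beats any
  number of points that is exponential in \<open>K\<close>.\<close>

lemma prob_rough_at:
  assumes i: "i \<le> 64 ^ K"
  shows "prob (rough_at C K i) \<le> (exp_const * exp (- C)) ^ K"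
proof -
  note [measurable] = scale_incr_measurable
  let ?Y = "\<lambda>l \<omega>. ennreal (exp (2 ^ l * norm (scale_incr K i l \<omega>)))"
  have e0: "0 \<le> exp_const" by (simp add: exp_const_def)
  have ind: "indep_vars (\<lambda>_. borel) ?Y {1..K}"
    by (rule indep_vars_compose2[OF indep_scale_incr[OF i], where Y="\<lambda>l v. ennreal (exp (2 ^ l * norm v))"]) measurable
  have one: "(\<integral>\<^sup>+\<omega>. ?Y l \<omega> \<partial>M) \<le> ennreal exp_const" if l: "l \<in> {1..K}" for l
  proof -
    obtain s t where st: "0 \<le> s" "s < t" "4 ^ l * (t - s) \<le> 1"
      "(\<forall>\<omega>. scale_incr K i l \<omega> = B t \<omega> - B s \<omega>) \<or> (\<forall>\<omega>. scale_incr K i l \<omega> = - (B t \<omega> - B s \<omega>))"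
      using scale_incr_increment[OF i l] by metis
    have "norm (scale_incr K i l \<omega>) = norm (B t \<omega> - B s \<omega>)" for \<omega> using st(4) by (metis norm_minus_cancel)
    moreover have "((2::real) ^ l)\<^sup>2 = 4 ^ l" by (simp add: power2_eq_square power_mult_distrib[symmetric])
    ultimately show ?thesis using exp_moment[OF st(1,2), of "2 ^ l"] st(3) by simp
  qed
  have prod: "(\<integral>\<^sup>+\<omega>. (\<Prod>l\<in>{1..K}. ?Y l \<omega>) \<partial>M) \<le> ennreal exp_const ^ K"
  proof -
    have "(\<integral>\<^sup>+\<omega>. (\<Prod>l\<in>{1..K}. ?Y l \<omega>) \<partial>M) = (\<Prod>l\<in>{1..K}. \<integral>\<^sup>+\<omega>. ?Y l \<omega> \<partial>M)"
      by (rule indep_vars_nn_integral[OF _ ind]) auto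
    also have "\<dots> \<le> (\<Prod>l\<in>{1..K}. ennreal exp_const)"
    proof -
      have "(\<Prod>l\<in>S. \<integral>\<^sup>+\<omega>. ?Y l \<omega> \<partial>M) \<le> (\<Prod>l\<in>S. ennreal exp_const)" if "finite S" "S \<subseteq> {1..K}" for S
        using that by (induction S rule: finite_induct) (auto intro!: mult_mono one)
      then show ?thesis by blast
    qed
    finally show ?thesis by simp
  qed
  have "prob (rough_at C K i) \<le> exp_const ^ K * exp (- (C * real K))"
    unfolding rough_at_def
  proof (rule exp_Markov)
    have "ennreal (exp (\<Sum>l=1..K. 2 ^ l * norm (scale_incr K i l \<omega>))) = (\<Prod>l\<in>{1..K}. ?Y l \<omega>)" for \<omega>
      by (simp add: prod_ennreal exp_sum)
    then show "(\<integral>\<^sup>+\<omega>. ennreal (exp (\<Sum>l=1..K. 2 ^ l * norm (scale_incr K i l \<omega>))) \<partial>M) \<le> ennreal (exp_const ^ K)"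
      using prod e0 by (simp add: ennreal_power)
  qed (measurable, use e0 in simp)
  also have "\<dots> = (exp_const * exp (- C)) ^ K"
    by (simp add: power_mult_distrib exp_of_nat_mult[symmetric] mult.commute)
  finally show ?thesis .
qed

end

section \<open>The projection X and its good scales\<close>

definition flat :: "'n::finite \<Rightarrow> real ^ 'n \<Rightarrow> real ^ 'n" where
  "flat k0 v = (\<chi> c. if c = k0 then 0 else v $ c)"

lemma flat_diff: "flat k0 (v - w) = flat k0 v - flat k0 w"
  by (simp add: flat_def vec_eq_iff)

lemma flat_add: "flat k0 (v + w) = flat k0 v + flat k0 w"
  by (simp add: flat_def vec_eq_iff)

lemma psum_flat: "psum (\<lambda>i. flat k0 (x i)) k = flat k0 (psum x k)"
  by (induction k) (simp_all add: psum_def flat_add, simp add: flat_def vec_eq_iff)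

lemma norm_flat_le: "norm (flat k0 v) \<le> norm v"
  by (rule norm_le_componentwise_cart) (simp add: flat_def)

lemma inner_flat:
  assumes "u \<bullet> axis k0 1 = 0"
  shows "u \<bullet> flat k0 v = u \<bullet> v"
proof -
  have "u $ k0 = 0" using assms by (simp add: inner_axis)
  then show ?thesis unfolding inner_vec_def flat_def by (intro sum.cong) auto
qed

text \<open>Hence the face event is determined by X alone.\<close>

lemma supp_face_flat: "supp_face (axis k0 1) N J (\<lambda>i. flat k0 (x i)) \<longleftrightarrow> supp_face (axis k0 1) N J x"
  unfolding supp_face_def psum_flat flat_diff[symmetric] using inner_flat by metis

text \<open>Two successive scales are controlled, because the increment of Y between them will be
  estimated through the distances of both its endpoints from the vertex. Applied to the flattened
  walk, the set is a function of X.\<close>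

definition good_scales :: "real \<Rightarrow> nat \<Rightarrow> nat \<Rightarrow> (nat \<Rightarrow> 'a::real_normed_vector) \<Rightarrow> nat set" where
  "good_scales C K i x = {l \<in> {1..<K}.
     2 ^ l * norm (psum x (scale_index K i l) - psum x i) \<le> 16 * C \<and>
     2 ^ Suc l * norm (psum x (scale_index K i (Suc l)) - psum x i) \<le> 16 * C}"

lemma good_scales_subset: "good_scales C K i x \<subseteq> {1..<K}"
  by (auto simp: good_scales_def)

lemma good_scales_cong:
  assumes "\<And>k. k < 64 ^ K \<Longrightarrow> x k = y k" "i \<le> 64 ^ K"
  shows "good_scales C K i x = good_scales C K i y"
proof -
  have "psum x k = psum y k" if "k \<le> 64 ^ K" for k using that assms(1) by (intro psum_cong) auto
  moreover have "scale_index K i l \<le> 64 ^ K" if "1 \<le> l" for l using scale_index_props(1)[OF assms(2) that] .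
  ultimately show ?thesis unfolding good_scales_def using assms(2) by (intro Collect_cong conj_cong refl) auto
qed

lemma borel_measurable_vec_lambda:
  fixes f :: "'b \<Rightarrow> real ^ 'n"
  assumes "\<And>c. (\<lambda>x. f x $ c) \<in> borel_measurable M"
  shows "f \<in> borel_measurable M"
  by (subst borel_measurable_euclidean_space) (use assms in \<open>auto simp: Basis_vec_def inner_axis\<close>)

lemma good_scales_measurable:
  fixes x :: "'b \<Rightarrow> nat \<Rightarrow> real ^ 'n"
  assumes x: "\<And>k. k < 64 ^ K \<Longrightarrow> (\<lambda>\<omega>. x \<omega> k) \<in> borel_measurable M" and i: "i \<le> 64 ^ K"
  shows "{\<omega> \<in> space M. good_scales C K i (x \<omega>) = \<Sigma>} \<in> sets M"
proof (cases "\<Sigma> \<subseteq> {1..<K}")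
  case True
  define P where "P l \<omega> \<longleftrightarrow> 2 ^ l * norm (psum (x \<omega>) (scale_index K i l) - psum (x \<omega>) i) \<le> 16 * C \<and>
     2 ^ Suc l * norm (psum (x \<omega>) (scale_index K i (Suc l)) - psum (x \<omega>) i) \<le> 16 * C" for l \<omega>
  have m: "(\<lambda>\<omega>. psum (x \<omega>) (scale_index K i l)) \<in> borel_measurable M" if "1 \<le> l" for l
    by (rule psum_measurable[of "64 ^ K" x, OF x scale_index_props(1)[OF i that]])
  have mi: "(\<lambda>\<omega>. psum (x \<omega>) i) \<in> borel_measurable M"
    by (rule psum_measurable[of "64 ^ K" x, OF x i])
  have P: "{\<omega> \<in> space M. P l \<omega>} \<in> sets M" if "l \<in> {1..<K}" for l
  proof -
    have [measurable]: "(\<lambda>\<omega>. psum (x \<omega>) (scale_index K i l)) \<in> borel_measurable M"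
      "(\<lambda>\<omega>. psum (x \<omega>) (scale_index K i (Suc l))) \<in> borel_measurable M"
      "(\<lambda>\<omega>. psum (x \<omega>) i) \<in> borel_measurable M"
      using m[of l] m[of "Suc l"] mi that by auto
    show ?thesis unfolding P_def by measurable
  qed
  have "{\<omega> \<in> space M. \<forall>l\<in>{1..<K}. P l \<omega> \<longleftrightarrow> l \<in> \<Sigma>} \<in> sets M"
  proof (intro sets.sets_Collect_finite_All)
    fix l assume l: "l \<in> {1..<K}"
    show "{\<omega> \<in> space M. P l \<omega> \<longleftrightarrow> l \<in> \<Sigma>} \<in> sets M"
      using P[OF l] sets.sets_Collect_neg[OF P[OF l]] by (cases "l \<in> \<Sigma>") auto
  qed simp
  also have "{\<omega> \<in> space M. \<forall>l\<in>{1..<K}. P l \<omega> \<longleftrightarrow> l \<in> \<Sigma>} = {\<omega> \<in> space M. good_scales C K i (x \<omega>) = \<Sigma>}"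
  proof -
    have "good_scales C K i (x \<omega>) = {l \<in> {1..<K}. P l \<omega>}" for \<omega> by (simp add: good_scales_def P_def)
    moreover have "({l \<in> {1..<K}. P l \<omega>} = \<Sigma>) \<longleftrightarrow> (\<forall>l\<in>{1..<K}. P l \<omega> \<longleftrightarrow> l \<in> \<Sigma>)" for \<omega> using True by blast
    ultimately show ?thesis by simp
  qed
  finally show ?thesis .
next
  case False
  then have "{\<omega> \<in> space M. good_scales C K i (x \<omega>) = \<Sigma>} = {}" using good_scales_subset by blast
  then show ?thesis by (simp only: sets.empty_sets)
qed

context brownian
begin

text \<open>The scale increments are independent, each restriction has probability at most
  \<open>small_prob \<rho>\<close>, and at least half of the \<open>K\<close> scales are restricted;
  the square root stands for this half.\<close>

lemma prob_scale_incr_small: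
  assumes i: "i \<le> 64 ^ K" and \<Sigma>: "\<Sigma> \<subseteq> {1..K}" "K \<le> 2 * card \<Sigma>" "0 < K" and \<rho>: "0 \<le> \<rho>"
  shows "prob {\<omega> \<in> space M. \<forall>l\<in>\<Sigma>. \<bar>scale_incr K i l \<omega> $ c\<bar> \<le> \<rho> / 2 ^ l} \<le> sqrt (small_prob \<rho>) ^ K"
proof -
  have fin: "finite \<Sigma>" using \<Sigma> finite_subset by blast
  have ne: "\<Sigma> \<noteq> {}" using \<Sigma> by auto
  let ?A = "\<lambda>l. {v :: real ^ 'n. \<bar>v $ c\<bar> \<le> \<rho> / 2 ^ l}"
  have [measurable]: "(\<lambda>v :: real ^ 'n. v $ c) \<in> borel_measurable borel" by (rule borel_measurable_vec_nth) simp
  have A: "?A l \<in> sets borel" for l by measurable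
  have "{\<omega> \<in> space M. \<forall>l\<in>\<Sigma>. \<bar>scale_incr K i l \<omega> $ c\<bar> \<le> \<rho> / 2 ^ l} = (\<Inter>l\<in>\<Sigma>. scale_incr K i l -` ?A l \<inter> space M)"
    using ne by auto
  also have "prob \<dots> = (\<Prod>l\<in>\<Sigma>. prob (scale_incr K i l -` ?A l \<inter> space M))"
    using ne fin \<Sigma> A by (intro indep_varsD[OF indep_scale_incr[OF i]]) auto
  also have "\<dots> \<le> (\<Prod>l\<in>\<Sigma>. small_prob \<rho>)"
  proof (intro prod_mono conjI)
    fix l assume "l \<in> \<Sigma>"
    then have l: "l \<in> {1..K}" using \<Sigma> by auto
    obtain s t where st: "0 \<le> s" "s < t" "1 \<le> 4 * (4 ^ l * (t - s))"
      "(\<forall>\<omega>. scale_incr K i l \<omega> = B t \<omega> - B s \<omega>) \<or> (\<forall>\<omega>. scale_incr K i l \<omega> = - (B t \<omega> - B s \<omega>))"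
      using scale_incr_increment[OF i l] by metis
    have "\<bar>scale_incr K i l \<omega> $ c\<bar> = \<bar>(B t \<omega> - B s \<omega>) $ c\<bar>" for \<omega>
      using st(4) by (metis abs_minus_cancel vector_uminus_component)
    then have eq: "scale_incr K i l -` ?A l \<inter> space M = {\<omega> \<in> space M. \<bar>(B t \<omega> - B s \<omega>) $ c\<bar> \<le> \<rho> * (1 / 2 ^ l)}"
      by auto
    have "(1 / 2 ^ l)\<^sup>2 = 1 / (4::real) ^ l" by (simp add: power2_eq_square power_mult_distrib[symmetric] field_simps)
    also have "\<dots> \<le> 4 * (t - s)" using st(3) by (simp add: field_simps)
    finally show "prob (scale_incr K i l -` ?A l \<inter> space M) \<le> small_prob \<rho>"
      unfolding eq using st(1,2) \<rho> by (intro abs_coord_prob_le) auto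
  qed auto
  also have "\<dots> = sqrt (small_prob \<rho>) ^ (2 * card \<Sigma>)"
    using small_prob_nonneg[of \<rho>] by (simp add: power_mult)
  also have "\<dots> \<le> sqrt (small_prob \<rho>) ^ K"
    using small_prob_nonneg[of \<rho>] small_prob_less_1[of \<rho>] \<Sigma> by (intro power_decreasing) auto
  finally show ?thesis .
qed

text \<open>
  The first two conditions concern only \<open>X\<close>; once the set of good scales is fixed, the last one concerns only \<open>Y\<close>.
\<close>

definition pinched :: "'n \<Rightarrow> real \<Rightarrow> real \<Rightarrow> nat \<Rightarrow> nat set \<Rightarrow> nat \<Rightarrow> 'w set" where
  "pinched k0 C \<rho> K J i = {\<omega> \<in> space M. supp_face (axis k0 1) (64 ^ K) J (\<lambda>k. xi (64 ^ K) k \<omega>) \<and>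
     K \<le> 2 * card (good_scales C K i (\<lambda>k. flat k0 (xi (64 ^ K) k \<omega>))) \<and>
     (\<forall>l\<in>good_scales C K i (\<lambda>k. flat k0 (xi (64 ^ K) k \<omega>)). \<bar>scale_incr K i l \<omega> $ k0\<bar> \<le> \<rho> / 2 ^ l)}"

text \<open>Conditioning on X takes the form of a finite partition by the set \<Sigma> of good
  scales. For fixed \<Sigma>, the face and the equality with \<Sigma> are events of X, the smallness
  of the increments is an event of Y, and the probabilities multiply. The factor from Y is bounded
  uniformly in \<Sigma>, and the events from X are disjoint parts of the face event.\<close>

lemma pinched_measurable_prob:
  assumes K: "0 < K" and i: "i \<le> 64 ^ K" and J: "J \<subseteq> {..64 ^ K}" and \<rho>: "0 \<le> \<rho>"
  shows "pinched k0 C \<rho> K J i \<in> events"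
    and "prob (pinched k0 C \<rho> K J i) \<le>
      sqrt (small_prob \<rho>) ^ K * prob {\<omega> \<in> space M. supp_face (axis k0 1) (64 ^ K) J (\<lambda>k. xi (64 ^ K) k \<omega>)}"
proof -
  define N :: nat where "N = 64 ^ K"
  have N0: "N > 0" by (simp add: N_def)
  let ?e = "axis k0 1 :: real ^ 'n"
  define XA where "XA = {..<N} \<times> (UNIV - {k0})"
  define YA where "YA = {..<N} \<times> {k0}"
  let ?PX = "PiM XA (\<lambda>_. borel :: real measure)" and ?PY = "PiM YA (\<lambda>_. borel :: real measure)"
  let ?X = "\<lambda>(k, c) \<omega>. xi N k \<omega> $ c"
  define Xr where "Xr \<omega> = restrict (\<lambda>a. ?X a \<omega>) XA" for \<omega>
  define Yr where "Yr \<omega> = restrict (\<lambda>a. ?X a \<omega>) YA" for \<omega>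
  have ind: "indep_var ?PX Xr ?PY Yr"
    unfolding Xr_def[abs_def] Yr_def[abs_def]
    by (rule indep_var_restrict[OF indep_coords[OF N0]]) (auto simp: XA_def YA_def)
  have coord: "(\<lambda>\<omega>. ?X a \<omega>) \<in> borel_measurable M" for a
    by (cases a) (simp add: borel_measurable_vec_nth)
  have mXr: "Xr \<in> M \<rightarrow>\<^sub>M ?PX" unfolding Xr_def[abs_def] by (intro measurable_restrict coord)
  have mYr: "Yr \<in> M \<rightarrow>\<^sub>M ?PY" unfolding Yr_def[abs_def] by (intro measurable_restrict coord)
  \<comment> \<open>The walks are rebuilt from the scalar coordinates, so that the events become
    preimages under the independent families \<open>Xr\<close> and \<open>Yr\<close>.\<close>
  define xw :: "(nat \<times> 'n \<Rightarrow> real) \<Rightarrow> nat \<Rightarrow> real ^ 'n" where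
    "xw y k = (\<chi> c. if c = k0 then 0 else y (k, c))" for y k
  have xw: "xw (Xr \<omega>) k = flat k0 (xi N k \<omega>)" if "k < N" for k \<omega>
    using that by (auto simp: xw_def Xr_def flat_def XA_def vec_eq_iff)
  have mxw: "(\<lambda>y. xw y k) \<in> borel_measurable ?PX" if "k < N" for k
  proof (rule borel_measurable_vec_lambda)
    fix c
    show "(\<lambda>y. xw y k $ c) \<in> borel_measurable ?PX"
      using that by (cases "c = k0") (auto simp: xw_def XA_def intro!: measurable_component_singleton)
  qed
  define yw :: "(nat \<times> 'n \<Rightarrow> real) \<Rightarrow> nat \<Rightarrow> real" where "yw y k = y (k, k0)" for y k
  have yw: "psum (yw (Yr \<omega>)) k = psum (\<lambda>k. xi N k \<omega>) k $ k0" if "k \<le> N" for k \<omega>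
    using that by (auto simp: psum_def yw_def Yr_def YA_def intro!: sum.cong)
  have myw: "(\<lambda>y. psum (yw y) k) \<in> borel_measurable ?PY" if "k \<le> N" for k
    using that by (intro psum_measurable[of N]) (auto simp: yw_def YA_def intro!: measurable_component_singleton)
  define F where "F = {\<omega> \<in> space M. supp_face ?e N J (\<lambda>k. xi N k \<omega>)}"
  define gs where "gs \<omega> = good_scales C K i (\<lambda>k. flat k0 (xi N k \<omega>))" for \<omega>
  define A where "A \<Sigma> = {\<omega> \<in> space M. supp_face ?e N J (\<lambda>k. xi N k \<omega>) \<and> gs \<omega> = \<Sigma>}" for \<Sigma>
  define H where "H \<Sigma> = {\<omega> \<in> space M. \<forall>l\<in>\<Sigma>. \<bar>scale_incr K i l \<omega> $ k0\<bar> \<le> \<rho> / 2 ^ l}" for \<Sigma>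
  define A' where "A' \<Sigma> = {y \<in> space ?PX. supp_face ?e N J (xw y) \<and> good_scales C K i (xw y) = \<Sigma>}" for \<Sigma>
  define H' where "H' \<Sigma> = {y \<in> space ?PY. \<forall>l\<in>\<Sigma>.
     \<bar>psum (yw y) (scale_index K i l) - psum (yw y) (scale_index K i (Suc l))\<bar> \<le> \<rho> / 2 ^ l}" for \<Sigma>
  have mA': "A' \<Sigma> \<in> sets ?PX" for \<Sigma>
    unfolding A'_def
  proof (rule sets.sets_Collect_conj)
    show "{y \<in> space ?PX. supp_face ?e N J (xw y)} \<in> sets ?PX"
      using J mxw by (intro supp_face_measurable) (auto simp: N_def)
    show "{y \<in> space ?PX. good_scales C K i (xw y) = \<Sigma>} \<in> sets ?PX"
      using i mxw by (intro good_scales_measurable) (auto simp: N_def)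
  qed
  have sN: "scale_index K i l \<le> N" if "1 \<le> l" for l using scale_index_props(1)[OF i that] by (simp add: N_def)
  have mH': "H' \<Sigma> \<in> sets ?PY" if "\<Sigma> \<subseteq> {1..K}" for \<Sigma>
    unfolding H'_def
  proof (rule sets.sets_Collect_finite_All)
    show "finite \<Sigma>" using that finite_subset by blast
    fix l assume "l \<in> \<Sigma>"
    then have l: "1 \<le> l" using that by auto
    have [measurable]: "(\<lambda>y. psum (yw y) (scale_index K i l)) \<in> borel_measurable ?PY"
      "(\<lambda>y. psum (yw y) (scale_index K i (Suc l))) \<in> borel_measurable ?PY"
      using l by (auto intro!: myw sN)
    show "{y \<in> space ?PY. \<bar>psum (yw y) (scale_index K i l) - psum (yw y) (scale_index K i (Suc l))\<bar> \<le> \<rho> / 2 ^ l} \<in> sets ?PY"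
      by measurable
  qed
  have A_eq: "A \<Sigma> = Xr -` A' \<Sigma> \<inter> space M" for \<Sigma>
  proof -
    have "supp_face ?e N J (xw (Xr \<omega>)) = supp_face ?e N J (\<lambda>k. xi N k \<omega>)" for \<omega>
      using supp_face_cong[of N "xw (Xr \<omega>)" "\<lambda>k. flat k0 (xi N k \<omega>)" J ?e] xw J supp_face_flat by (simp add: N_def)
    moreover have "good_scales C K i (xw (Xr \<omega>)) = gs \<omega>" for \<omega>
      unfolding gs_def using i xw by (intro good_scales_cong) (auto simp: N_def)
    ultimately show ?thesis
      using measurable_space[OF mXr] by (auto simp: A_def A'_def)
  qed
  have H_eq: "H \<Sigma> = Yr -` H' \<Sigma> \<inter> space M" if "\<Sigma> \<subseteq> {1..K}" for \<Sigma>
  proof -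
    have "psum (yw (Yr \<omega>)) (scale_index K i l) - psum (yw (Yr \<omega>)) (scale_index K i (Suc l)) = scale_incr K i l \<omega> $ k0"
      if "\<omega> \<in> space M" "l \<in> \<Sigma>" for \<omega> l
    proof -
      have "1 \<le> l" using that \<open>\<Sigma> \<subseteq> {1..K}\<close> by auto
      then show ?thesis using that yw[OF sN, of l] yw[OF sN, of "Suc l"]
        by (simp add: psum_xi scale_incr_def N_def)
    qed
    then show ?thesis using measurable_space[OF mYr] unfolding H_def H'_def by auto
  qed
  have mA: "A \<Sigma> \<in> events" for \<Sigma> unfolding A_eq by (rule measurable_sets[OF mXr mA'])
  have mH: "H \<Sigma> \<in> events" if "\<Sigma> \<subseteq> {1..K}" for \<Sigma>
    unfolding H_eq[OF that] by (rule measurable_sets[OF mYr mH'[OF that]])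
  define Sg where "Sg = {\<Sigma>. \<Sigma> \<subseteq> {1..<K} \<and> K \<le> 2 * card \<Sigma>}"
  have finSg: "finite Sg" by (rule finite_subset[of _ "Pow {1..<K}"]) (auto simp: Sg_def)
  have SgK: "\<Sigma> \<subseteq> {1..K}" if "\<Sigma> \<in> Sg" for \<Sigma> using that by (auto simp: Sg_def)
  have eq: "pinched k0 C \<rho> K J i = (\<Union>\<Sigma>\<in>Sg. A \<Sigma> \<inter> H \<Sigma>)"
  proof -
    have pin: "pinched k0 C \<rho> K J i = {\<omega> \<in> space M. supp_face ?e N J (\<lambda>k. xi N k \<omega>) \<and>
        K \<le> 2 * card (gs \<omega>) \<and> (\<forall>l\<in>gs \<omega>. \<bar>scale_incr K i l \<omega> $ k0\<bar> \<le> \<rho> / 2 ^ l)}"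
      by (simp add: pinched_def gs_def N_def)
    show ?thesis
    proof (intro equalityI subsetI)
      fix \<omega> assume "\<omega> \<in> pinched k0 C \<rho> K J i"
      then have "gs \<omega> \<in> Sg" "\<omega> \<in> A (gs \<omega>) \<inter> H (gs \<omega>)"
        using good_scales_subset unfolding pin by (simp_all add: A_def H_def Sg_def gs_def)
      then show "\<omega> \<in> (\<Union>\<Sigma>\<in>Sg. A \<Sigma> \<inter> H \<Sigma>)" by blast
    next
      fix \<omega> assume "\<omega> \<in> (\<Union>\<Sigma>\<in>Sg. A \<Sigma> \<inter> H \<Sigma>)"
      then obtain \<Sigma> where "\<Sigma> \<in> Sg" "\<omega> \<in> A \<Sigma>" "\<omega> \<in> H \<Sigma>" by blast
      then show "\<omega> \<in> pinched k0 C \<rho> K J i" unfolding pin by (simp add: A_def H_def Sg_def)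
    qed
  qed
  have AH: "A \<Sigma> \<inter> H \<Sigma> \<in> events" if "\<Sigma> \<in> Sg" for \<Sigma> using mA mH[OF SgK[OF that]] by blast
  show "pinched k0 C \<rho> K J i \<in> events" unfolding eq using finSg AH by (intro sets.finite_UN) auto
  have "prob (pinched k0 C \<rho> K J i) \<le> (\<Sum>\<Sigma>\<in>Sg. prob (A \<Sigma> \<inter> H \<Sigma>))"
    unfolding eq using finSg AH by (intro finite_measure_subadditive_finite) auto
  also have "\<dots> \<le> (\<Sum>\<Sigma>\<in>Sg. sqrt (small_prob \<rho>) ^ K * prob (A \<Sigma>))"
  proof (rule sum_mono)
    fix \<Sigma> assume S: "\<Sigma> \<in> Sg"
    have "A \<Sigma> \<inter> H \<Sigma> = (\<lambda>x. (Xr x, Yr x)) -` (A' \<Sigma> \<times> H' \<Sigma>) \<inter> space M"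
      unfolding A_eq H_eq[OF SgK[OF S]] by auto
    then have "prob (A \<Sigma> \<inter> H \<Sigma>) = prob (A \<Sigma>) * prob (H \<Sigma>)"
      using indep_varD[OF ind mA' mH'[OF SgK[OF S]]] unfolding A_eq H_eq[OF SgK[OF S]] by simp
    also have "\<dots> \<le> prob (A \<Sigma>) * sqrt (small_prob \<rho>) ^ K"
      unfolding H_def using S K \<rho> by (intro mult_left_mono prob_scale_incr_small i SgK) (auto simp: Sg_def)
    finally show "prob (A \<Sigma> \<inter> H \<Sigma>) \<le> sqrt (small_prob \<rho>) ^ K * prob (A \<Sigma>)" by (simp add: mult.commute)
  qed
  also have "\<dots> = sqrt (small_prob \<rho>) ^ K * prob (\<Union>\<Sigma>\<in>Sg. A \<Sigma>)"
  proof -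
    have "disjoint_family_on A Sg" by (auto simp: disjoint_family_on_def A_def)
    then have "prob (\<Union>\<Sigma>\<in>Sg. A \<Sigma>) = (\<Sum>\<Sigma>\<in>Sg. prob (A \<Sigma>))"
      using mA finSg by (intro finite_measure_finite_Union) auto
    then show ?thesis by (simp add: sum_distrib_left)
  qed
  also have "\<dots> \<le> sqrt (small_prob \<rho>) ^ K * prob F"
  proof (intro mult_left_mono finite_measure_mono)
    show "(\<Union>\<Sigma>\<in>Sg. A \<Sigma>) \<subseteq> F" by (auto simp: A_def F_def)
    show "F \<in> events" unfolding F_def using J supp_face_xi_measurable[of J N ?e "\<lambda>k. k"] by (simp add: N_def)
  qed (use small_prob_nonneg[of \<rho>] in auto)
  finally show "prob (pinched k0 C \<rho> K J i) \<le>
      sqrt (small_prob \<rho>) ^ K * prob {\<omega> \<in> space M. supp_face ?e (64 ^ K) J (\<lambda>k. xi (64 ^ K) k \<omega>)}"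
    unfolding F_def N_def .
qed

end

section \<open>Asymptotic estimates\<close>

lemma harm_le_ln: "n > 0 \<Longrightarrow> harm n \<le> 1 + ln (real n)"
proof -
  assume "n > 0"
  then obtain m where m: "n = Suc m" using gr0_implies_Suc by blast
  have "harm (Suc m) - ln (real (Suc m)) \<le> harm (Suc 0) - ln (real (Suc 0))"
    using decseqD[OF decseq_harm_diff_ln, of 0 m] by simp
  then show ?thesis by (simp add: m harm_def)
qed

text \<open>For positive \<open>r\<close> this is the \<open>r\<close>-th power of
  \<open>(1 + c * real K) * t ^ K\<close> with \<open>t\<close> the \<open>r\<close>-th root of
  \<open>s\<close>, so linear growth is enough to treat.\<close>

lemma tendsto_poly_times_geometric:
  fixes c s :: real
  assumes s: "0 \<le> s" "s < 1"
  shows "(\<lambda>K. (1 + c * real K) ^ r * s ^ K) \<longlonglongrightarrow> 0"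
proof (cases "r = 0")
  case True
  then show ?thesis using LIMSEQ_power_zero[of s] s by simp
next
  case False
  define t where "t = root r s"
  have t: "0 \<le> t" "t < 1" "t ^ r = s"
    using s False by (auto simp: t_def real_root_pow_pos2)
  have "(\<lambda>K. t ^ K + c * (real K * t ^ K)) \<longlonglongrightarrow> 0 + c * 0"
    using t by (intro tendsto_intros LIMSEQ_power_zero powser_times_n_limit_0) auto
  then have "(\<lambda>K. ((1 + c * real K) * t ^ K) ^ r) \<longlonglongrightarrow> 0 ^ r"
    by (intro tendsto_power) (simp add: algebra_simps)
  moreover have "((1 + c * real K) * t ^ K) ^ r = (1 + c * real K) ^ r * s ^ K" for K
    using t(3) by (simp add: power_mult_distrib power_mult[symmetric] mult.commute[of K]) (simp add: power_mult)
  ultimately show ?thesis using False by (simp add: zero_power)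
qed

text \<open>The fourth power of x / 4 \<le> exp (x / 4). The exponent 4 is the first that makes a
  union over a multiple of 4^m increments at threshold (3/2)^m summable: 4 (2/3)^4 = 64/81 <
  1.\<close>

lemma exp_neg_le: "0 < x \<Longrightarrow> exp (- x) \<le> 256 / x ^ 4" for x :: real
proof -
  assume x: "0 < x"
  have "x / 4 \<le> exp (x / 4)" using exp_ge_add_one_self[of "x / 4"] by linarith
  then have "(x / 4) ^ 4 \<le> exp (x / 4) ^ 4" using x by (intro power_mono) auto
  also have "\<dots> = exp x" by (simp add: exp_of_nat_mult[symmetric])
  finally show ?thesis using x by (simp add: exp_minus field_simps)
qed

text \<open>Chaining along the base 4 digits of \<open>t\<close>: \<open>c\<close> is the next
  digit, the digit 0 moves nothing, and the geometric series of the steps from level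
  \<open>m\<close> on sums to \<open>4 * (3/4) ^ m\<close>.\<close>

lemma dyadic_approximation:
  fixes f :: "real \<Rightarrow> 'a::real_normed_vector"
  assumes cont: "continuous_on {0..} f" and t: "0 \<le> t" "t \<le> 1"
    and step: "\<And>m j c. m0 \<le> m \<Longrightarrow> j < 4 ^ m \<Longrightarrow> c \<in> {1, 2, 3::nat} \<Longrightarrow>
      norm (f (real (4 * j + c) / 4 ^ Suc m) - f (real j / 4 ^ m)) \<le> (3/4) ^ m"
    and m: "m0 \<le> m"
  shows "norm (f t - f (real (nat \<lfloor>4 ^ m * t\<rfloor>) / 4 ^ m)) \<le> 4 * (3/4) ^ m"
proof -
  define j where "j k = nat \<lfloor>4 ^ k * t\<rfloor>" for k
  define d where "d k = f (real (j k) / 4 ^ k)" for k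
  have jb: "real (j k) \<le> 4 ^ k * t" "4 ^ k * t < real (j k) + 1" for k
  proof -
    have "0 \<le> 4 ^ k * t" using t by simp
    then have "real (j k) = of_int \<lfloor>4 ^ k * t\<rfloor>" unfolding j_def by (simp add: of_nat_nat)
    then show "real (j k) \<le> 4 ^ k * t" "4 ^ k * t < real (j k) + 1" by linarith+
  qed
  have one: "norm (d (Suc k) - d k) \<le> (3/4) ^ k" if k: "m0 \<le> k" for k
  proof -
    have "real (4 * j k) < real (j (Suc k)) + 1" using jb(1)[of k] jb(2)[of "Suc k"] by simp
    then have lo: "4 * j k \<le> j (Suc k)" by linarith
    have "real (j (Suc k)) < real (4 * j k + 4)" using jb(2)[of k] jb(1)[of "Suc k"] by simp
    then have hi: "j (Suc k) < 4 * j k + 4" by linarith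
    define c where "c = j (Suc k) - 4 * j k"
    have c: "j (Suc k) = 4 * j k + c" "c < 4" using lo hi by (auto simp: c_def)
    show ?thesis
    proof (cases "c = 0")
      case True
      then have "real (j (Suc k)) / 4 ^ Suc k = real (j k) / 4 ^ k" using c by simp
      then show ?thesis by (simp add: d_def)
    next
      case False
      \<comment> \<open>Only \<open>t = 1\<close> has \<open>j k = 4 ^ k\<close>, and then the next
        digit is 0.\<close>
      have "j k < 4 ^ k"
      proof (rule ccontr)
        assume "\<not> j k < 4 ^ k"
        then have "4 ^ k \<le> j k" by simp
        then have "(4::real) ^ k \<le> real (j k)" by (metis of_nat_le_iff of_nat_numeral of_nat_power)
        moreover have "real (j (Suc k)) = 4 * real (j k) + real c" "1 \<le> real c" using c False by simp_all
        ultimately have "4 * (4::real) ^ k + 1 \<le> real (j (Suc k))" by linarith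
        also have "\<dots> \<le> 4 ^ Suc k * t" by (rule jb)
        also have "\<dots> \<le> 4 ^ Suc k" using t by simp
        finally show False by simp
      qed
      moreover have "c \<in> {1, 2, 3}" using False c(2) by auto
      ultimately show ?thesis unfolding d_def c(1) by (intro step k)
    qed
  qed
  \<comment> \<open>The subtracted tail makes the induction close: it shrinks at each step by
    exactly the cost of that step.\<close>
  have geo: "norm (d (m + k) - d m) \<le> 4 * (3/4) ^ m - 4 * (3/4) ^ (m + k)" for k
  proof (induction k)
    case (Suc k)
    have "norm (d (m + Suc k) - d m) \<le> norm (d (Suc (m + k)) - d (m + k)) + norm (d (m + k) - d m)"
      using norm_triangle_ineq[of "d (Suc (m + k)) - d (m + k)" "d (m + k) - d m"] by simp
    also have "\<dots> \<le> (3/4) ^ (m + k) + (4 * (3/4) ^ m - 4 * (3/4) ^ (m + k))"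
      using one[of "m + k"] m Suc by (intro add_mono) auto
    finally show ?case by simp
  qed simp
  have conv: "(\<lambda>k. real (j k) / 4 ^ k) \<longlonglongrightarrow> t"
  proof (rule real_tendsto_sandwich[of "\<lambda>k. t - (1/4) ^ k" _ _ "\<lambda>_. t"])
    show "(\<lambda>k. t - (1/4) ^ k) \<longlonglongrightarrow> t"
      using tendsto_diff[OF tendsto_const LIMSEQ_power_zero[of "1/4::real"], of t] by simp
    show "\<forall>\<^sub>F k in sequentially. t - (1/4) ^ k \<le> real (j k) / 4 ^ k"
    proof (intro always_eventually allI)
      fix k
      have "t \<le> (real (j k) + 1) / 4 ^ k" using jb(2)[of k] by (simp add: pos_le_divide_eq mult.commute)
      also have "\<dots> = real (j k) / 4 ^ k + (1/4) ^ k" by (simp add: add_divide_distrib power_one_over)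
      finally show "t - (1/4) ^ k \<le> real (j k) / 4 ^ k" by simp
    qed
    show "\<forall>\<^sub>F k in sequentially. real (j k) / 4 ^ k \<le> t"
      using jb(1) by (intro always_eventually allI) (simp add: pos_divide_le_eq mult.commute)
  qed auto
  have "(\<lambda>k. d k) \<longlonglongrightarrow> f t"
    unfolding d_def using continuous_on_tendsto_compose[OF cont conv] t by simp
  then have "(\<lambda>k. norm (d (m + k) - d m)) \<longlonglongrightarrow> norm (f t - d m)"
    using LIMSEQ_ignore_initial_segment[of d "f t" m] by (intro tendsto_intros) (simp add: add.commute)
  moreover have "norm (d (m + k) - d m) \<le> 4 * (3/4) ^ m" for k
    using geo[of k] zero_le_power[of "3/4::real" "m + k"] by linarith
  ultimately have "norm (f t - d m) \<le> 4 * (3/4) ^ m"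
    by (intro LIMSEQ_le_const2[of _ _ "4 * (3/4) ^ m"]) auto
  then show ?thesis by (simp add: d_def j_def)
qed

section \<open>Modulus of continuity and the probability of a kink\<close>

context brownian
begin

lemma increment_tail:
  assumes st: "0 \<le> s" "s < t" and a: "0 < a" "a\<^sup>2 * (t - s) \<le> 1"
  shows "prob {\<omega> \<in> space M. y < norm (B t \<omega> - B s \<omega>)} \<le> exp_const * exp (- (a * y))"
proof -
  have [measurable]: "(\<lambda>\<omega>. B t \<omega> - B s \<omega>) \<in> borel_measurable M" using st by (intro increment_measurable) auto
  have "prob {\<omega> \<in> space M. y < norm (B t \<omega> - B s \<omega>)} \<le> prob {\<omega> \<in> space M. a * y < a * norm (B t \<omega> - B s \<omega>)}"
    using a by (intro finite_measure_mono) auto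
  also have "\<dots> \<le> exp_const * exp (- (a * y))"
    using st a by (intro exp_Markov exp_moment) (auto simp: exp_const_def)
  finally show ?thesis .
qed

text \<open>The standard deviations are of order 2^-m, which the threshold exceeds by a factor of
  order (3/2)^m. The union bound over the 3 * 4^m increments of level \<open>m\<close> is therefore
  summable, and Borel-Cantelli applies.\<close>

lemma AE_dyadic_increments:
  "AE \<omega> in M. \<exists>m0. \<forall>m\<ge>m0. \<forall>j<4 ^ m. \<forall>c\<in>{1, 2, 3::nat}.
     norm (B (real (4 * j + c) / 4 ^ Suc m) \<omega> - B (real j / 4 ^ m) \<omega>) \<le> (3/4) ^ m"
proof -
  let ?s = "\<lambda>m q. real (fst q) / 4 ^ m" and ?t = "\<lambda>m q. real (4 * fst q + snd q) / 4 ^ Suc m"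
  define E where "E m q = {\<omega> \<in> space M. (3/4) ^ m < norm (B (?t m q) \<omega> - B (?s m q) \<omega>)}"
    for m :: nat and q :: "nat \<times> nat"
  define Q where "Q m = {..<(4::nat) ^ m} \<times> {1, 2, 3::nat}" for m :: nat
  define A where "A m = (\<Union>q\<in>Q m. E m q)" for m
  have finQ: "finite (Q m)" for m by (simp add: Q_def)
  have mE: "E m q \<in> events" for m q
  proof -
    have [measurable]: "(\<lambda>\<omega>. B (?t m q) \<omega> - B (?s m q) \<omega>) \<in> borel_measurable M"
      by (intro increment_measurable) auto
    show ?thesis unfolding E_def by measurable
  qed
  have mA: "A m \<in> events" for m unfolding A_def using finQ mE by (intro sets.finite_UN) auto
  have e0: "0 \<le> exp_const" by (simp add: exp_const_def)
  have bound: "prob (A m) \<le> 768 * exp_const * (64/81) ^ m" for m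
  proof -
    have "prob (A m) \<le> (\<Sum>q\<in>Q m. prob (E m q))"
      unfolding A_def using finQ mE by (intro finite_measure_subadditive_finite) auto
    also have "\<dots> \<le> (\<Sum>q\<in>Q m. exp_const * exp (- (2 ^ m * (3/4) ^ m)))"
    proof (rule sum_mono)
      fix q assume "q \<in> Q m"
      then have q: "snd q \<in> {1, 2, 3}" by (auto simp: Q_def)
      have eq: "?t m q - ?s m q = real (snd q) / 4 ^ Suc m"
        by (simp add: field_simps)
      have "real (snd q) / 4 ^ Suc m > 0" using q by auto
      then have lt: "?s m q < ?t m q" using eq by linarith
      have "((2::real) ^ m)\<^sup>2 = 4 ^ m" by (simp add: power2_eq_square power_mult_distrib[symmetric])
      then have "((2::real) ^ m)\<^sup>2 * (?t m q - ?s m q) \<le> 1"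
        unfolding eq using q by auto
      then show "prob (E m q) \<le> exp_const * exp (- (2 ^ m * (3/4) ^ m))"
        unfolding E_def using lt by (intro increment_tail) auto
    qed
    also have "\<dots> = 3 * 4 ^ m * exp_const * exp (- ((3/2) ^ m))"
      by (simp add: Q_def card_cartesian_product power_mult_distrib[symmetric])
    also have "\<dots> \<le> 3 * 4 ^ m * exp_const * (256 / ((3/2) ^ m) ^ 4)"
      using e0 by (intro mult_left_mono exp_neg_le) auto
    also have "((3/2::real) ^ m) ^ 4 = (81/16) ^ m"
      by (simp add: power_mult[symmetric] mult.commute[of m]) (simp add: power_mult power_divide)
    also have "3 * 4 ^ m * exp_const * (256 / (81/16) ^ m) = 768 * exp_const * (64/81) ^ m"
      by (simp add: power_divide field_simps power_mult_distrib[symmetric])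
    finally show ?thesis .
  qed
  have "summable (\<lambda>m. prob (A m))"
  proof (rule summable_comparison_test')
    show "summable (\<lambda>m. 768 * exp_const * (64/81::real) ^ m)" by (intro summable_mult summable_geometric) auto
    show "norm (prob (A m)) \<le> 768 * exp_const * (64/81) ^ m" if "0 \<le> m" for m using bound[of m] by simp
  qed
  then have "AE \<omega> in M. eventually (\<lambda>m. \<omega> \<in> space M - A m) sequentially"
    by (intro borel_cantelli_AE1 mA) (auto simp: emeasure_eq_measure)
  then show ?thesis
    using AE_space
  proof eventually_elim
    case (elim \<omega>)
    then obtain m0 where m0: "\<And>m. m \<ge> m0 \<Longrightarrow> \<omega> \<notin> A m" by (auto simp: eventually_sequentially)
    show ?case
    proof (intro exI[of _ m0] allI impI ballI)
      fix m j c assume "m0 \<le> m" and j: "j < (4::nat) ^ m" and c: "c \<in> {1, 2, 3::nat}"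
      have "(j, c) \<in> Q m" using j c by (simp add: Q_def)
      then have "\<omega> \<notin> E m (j, c)" using m0[OF \<open>m0 \<le> m\<close>] by (auto simp: A_def)
      then show "norm (B (real (4 * j + c) / 4 ^ Suc m) \<omega> - B (real j / 4 ^ m) \<omega>) \<le> (3/4) ^ m"
        using elim(2) by (simp add: E_def)
    qed
  qed
qed

text \<open>Each gap vector contributes at most 2 divided by the product of its gaps. Summed over
  all gap vectors with entries up to \<open>N\<close>, this factorises into \<open>r\<close>
  harmonic sums.\<close>

lemma sum_prob_faces:
  assumes card: "CARD('n) = r + 2" and N: "r < N"
  shows "(\<Sum>(j, p)\<in>(SIGMA j:{j \<in> {..<r} \<rightarrow>\<^sub>E {1..N}. sum j {..<r} \<le> N}. {..N - sum j {..<r}}).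
     prob {\<omega> \<in> space M. supp_face (axis k0 1) N (block_set p j r) (\<lambda>i. xi N i \<omega>)}) \<le> 2 * harm N ^ r"
proof -
  let ?\<pi> = "\<lambda>j. \<Prod>l<r. inverse (real (j l))"
  let ?P = "{..<r} \<rightarrow>\<^sub>E {1..N}"
  let ?J = "{j \<in> ?P. sum j {..<r} \<le> N}"
  let ?F = "\<lambda>j p. prob {\<omega> \<in> space M. supp_face (axis k0 1) N (block_set p j r) (\<lambda>i. xi N i \<omega>)}"
  let ?\<Sigma> = "\<lambda>j. \<Sum>p\<le>N - sum j {..<r}. ?F j p"
  have finP: "finite ?P" by (intro finite_PiE) auto
  have "(\<Sum>(j, p)\<in>(SIGMA j:?J. {..N - sum j {..<r}}). ?F j p) = (\<Sum>j\<in>?J. \<Sum>p\<le>N - sum j {..<r}. ?F j p)"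
    using finP by (subst sum.Sigma) auto
  also have "\<dots> \<le> (\<Sum>j\<in>?J. 2 * ?\<pi> j)"
  proof (rule sum_mono)
    fix j assume j: "j \<in> ?J"
    then have jP: "j \<in> ?P" by simp
    have jpos: "0 < j l" if "l < r" for l using PiE_mem[OF jP, of l] that by auto
    have "real (\<Prod>l<r. j l) * ?\<Sigma> j \<le> 2"
      using j by (intro sum_prob_block_faces card N jpos) auto
    moreover have "real (\<Prod>l<r. j l) > 0" using jpos by (auto intro!: prod_pos)
    ultimately have "?\<Sigma> j \<le> 2 / real (\<Prod>l<r. j l)"
      by (simp add: field_simps)
    then show "?\<Sigma> j \<le> 2 * ?\<pi> j"
      by (simp add: divide_inverse prod_inversef[symmetric] comp_def)
  qed
  also have "\<dots> \<le> (\<Sum>j\<in>?P. 2 * ?\<pi> j)"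
  proof (rule sum_mono2[OF finP])
    show "?J \<subseteq> ?P" by blast
    show "0 \<le> 2 * ?\<pi> j" for j by (simp add: prod_nonneg)
  qed
  also have "\<dots> = 2 * (\<Prod>l<r. \<Sum>k\<in>{1..N}. inverse (real k))"
    by (subst prod_sum_PiE) (simp_all add: sum_distrib_left)
  also have "\<dots> = 2 * harm N ^ r" by (simp add: harm_def)
  finally show ?thesis .
qed

text \<open>The tolerance \<open>1 / 2 ^ K\<close> is the typical spatial size at the finest time
  scale 4^-K, so it is harmless at every scale \<open>l \<le> K\<close>.\<close>

definition kink :: "'n \<Rightarrow> real \<Rightarrow> nat \<Rightarrow> 'w set" where
  "kink k0 R K = {\<omega> \<in> space M. \<exists>i\<le>64 ^ K. supp_face (axis k0 1) (64 ^ K) {i} (\<lambda>k. xi (64 ^ K) k \<omega>) \<and>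
     (\<forall>j\<le>64 ^ K. \<bar>(B (real j / 64 ^ K) \<omega> - B (real i / 64 ^ K) \<omega>) $ k0\<bar> \<le>
        R * (norm (flat k0 (B (real j / 64 ^ K) \<omega> - B (real i / 64 ^ K) \<omega>)) + 1 / 2 ^ K))}"

text \<open>Between the scales l and l + 1 the increment of Y is at most R times the sum of two
  X-distances, each at most 16 C / 2^l at a good scale, and of two tolerances, each at most 1 / 2^l;
  this is the constant R (32 C + 2). The vertex is enlarged to a facet because facets are what can
  be counted.\<close>

lemma kink_pinched:
  assumes w: "\<omega> \<in> kink k0 R K" and gp: "gen_pos (axis k0 1) (64 ^ K) (\<lambda>k. xi (64 ^ K) k \<omega>)"
    and smooth: "\<And>i. i \<le> 64 ^ K \<Longrightarrow> \<omega> \<notin> rough_at C K i"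
    and card: "CARD('n) = r + 2" "r < 64 ^ K" and K: "4 \<le> K" and C: "0 < C" and R: "0 \<le> R"
  obtains J i where "J \<subseteq> {..64 ^ K}" "card J = Suc r" "i \<in> J" "\<omega> \<in> pinched k0 C (R * (32 * C + 2)) K J i"
proof -
  define N :: nat where "N = 64 ^ K"
  have sp: "\<omega> \<in> space M" using w by (simp add: kink_def)
  obtain i where i: "i \<le> N" and face: "supp_face (axis k0 1) N {i} (\<lambda>k. xi N k \<omega>)"
    and kinky: "\<And>j. j \<le> N \<Longrightarrow> \<bar>(B (real j / 64 ^ K) \<omega> - B (real i / 64 ^ K) \<omega>) $ k0\<bar> \<le>
        R * (norm (flat k0 (B (real j / 64 ^ K) \<omega> - B (real i / 64 ^ K) \<omega>)) + 1 / 2 ^ K)"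
    using w unfolding kink_def N_def by blast
  have iK: "i \<le> 64 ^ K" using i by (simp add: N_def)
  obtain J where J: "J \<subseteq> {..N}" "i \<in> J" "Suc (card J) = DIM(real ^ 'n)" "supp_face (axis k0 1) N J (\<lambda>k. xi N k \<omega>)"
    using supp_face_extend[OF gp[folded N_def] _ _ i face] card by (auto simp: N_def)
  define S where "S l = B (real (scale_index K i l) / 64 ^ K) \<omega>" for l
  define S0 where "S0 = B (real i / 64 ^ K) \<omega>"
  define \<delta> where "\<delta> l = norm (flat k0 (S l - S0))" for l
  let ?g = "good_scales C K i (\<lambda>k. flat k0 (xi N k \<omega>))"
  have ps: "psum (\<lambda>k. flat k0 (xi N k \<omega>)) k = flat k0 (B (real k / 64 ^ K) \<omega>)" for k
    using psum_xi[OF sp, of N k] by (simp add: psum_flat N_def)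
  have g_eq: "?g = {l \<in> {1..<K}. 2 ^ l * \<delta> l \<le> 16 * C \<and> 2 ^ Suc l * \<delta> (Suc l) \<le> 16 * C}"
    unfolding good_scales_def ps \<delta>_def S_def S0_def by (simp only: flat_diff)
  have inc: "scale_incr K i l \<omega> = S l - S (Suc l)" for l by (simp add: scale_incr_def S_def)
  have many: "K \<le> 2 * card ?g"
    unfolding g_eq
  proof (rule many_good_scales[OF K C])
    show "0 \<le> \<delta> l" for l by (simp add: \<delta>_def)
    show "\<delta> (Suc K) = 0" by (simp add: \<delta>_def S_def S0_def scale_index_def flat_def vec_eq_iff)
    show "(\<Sum>l=1..K. 2 ^ l * norm (scale_incr K i l \<omega>)) \<le> C * real K"
      using smooth[OF iK] sp by (simp add: rough_at_def)
    fix l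
    have "\<delta> l = norm (flat k0 (S (Suc l) - S0) + flat k0 (S l - S (Suc l)))"
      unfolding \<delta>_def by (simp add: flat_add[symmetric])
    also have "\<dots> \<le> \<delta> (Suc l) + norm (S l - S (Suc l))"
      unfolding \<delta>_def using norm_triangle_ineq norm_flat_le by (smt (verit))
    finally show "\<delta> l \<le> \<delta> (Suc l) + 2 ^ l * norm (scale_incr K i l \<omega>) / 2 ^ l" by (simp add: inc)
  qed
  have small: "\<bar>scale_incr K i l \<omega> $ k0\<bar> \<le> R * (32 * C + 2) / 2 ^ l" if "l \<in> ?g" for l
  proof -
    have l: "1 \<le> l" "l < K" and d: "\<delta> l \<le> 16 * C / 2 ^ l" "\<delta> (Suc l) \<le> 16 * C / 2 ^ Suc l"
      using that unfolding g_eq by (auto simp: field_simps)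
    have kl: "\<bar>(S l' - S0) $ k0\<bar> \<le> R * (\<delta> l' + 1 / 2 ^ K)" if "1 \<le> l'" for l'
      using kinky[of "scale_index K i l'"] scale_index_props(1)[OF iK that] by (simp add: S_def S0_def \<delta>_def N_def)
    have "scale_incr K i l \<omega> $ k0 = (S l - S0) $ k0 - (S (Suc l) - S0) $ k0" by (simp add: inc)
    then have "\<bar>scale_incr K i l \<omega> $ k0\<bar> \<le> \<bar>(S l - S0) $ k0\<bar> + \<bar>(S (Suc l) - S0) $ k0\<bar>" by linarith
    also have "\<dots> \<le> R * (\<delta> l + 1 / 2 ^ K) + R * (\<delta> (Suc l) + 1 / 2 ^ K)"
      using l by (intro add_mono kl) auto
    also have "\<dots> = R * (\<delta> l + \<delta> (Suc l) + 2 / 2 ^ K)" by (simp add: algebra_simps)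
    also have "\<dots> \<le> R * (16 * C / 2 ^ l + 16 * C / 2 ^ l + 2 / 2 ^ l)"
    proof (intro mult_left_mono add_mono d R)
      show "\<delta> (Suc l) \<le> 16 * C / 2 ^ l" by (rule order_trans[OF d(2)]) (use C in \<open>simp add: field_simps\<close>)
      show "2 / 2 ^ K \<le> 2 / (2::real) ^ l" using l by (intro divide_left_mono power_increasing) auto
    qed
    also have "\<dots> = R * (32 * C + 2) / 2 ^ l" by (simp add: add_divide_distrib[symmetric])
    finally show ?thesis .
  qed
  have "\<omega> \<in> pinched k0 C (R * (32 * C + 2)) K J i"
    unfolding pinched_def using sp J(4) many small by (simp add: N_def)
  then show ?thesis using that[of J i] J card by (simp add: N_def)
qed

lemma kink_measurable: "kink k0 R K \<in> events"
proof -
  let ?v = "\<lambda>i j \<omega>. B (real j / 64 ^ K) \<omega> - B (real i / 64 ^ K) \<omega>"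
  have [measurable]: "(\<lambda>\<omega>. ?v i j \<omega> $ k0) \<in> borel_measurable M"
    "(\<lambda>\<omega>. flat k0 (?v i j \<omega>)) \<in> borel_measurable M" for i j :: nat
  proof -
    have m: "(\<lambda>\<omega>. ?v i j \<omega> $ c) \<in> borel_measurable M" for c
      by (intro borel_measurable_vec_nth increment_measurable) auto
    then show "(\<lambda>\<omega>. ?v i j \<omega> $ k0) \<in> borel_measurable M" .
    show "(\<lambda>\<omega>. flat k0 (?v i j \<omega>)) \<in> borel_measurable M"
    proof (rule borel_measurable_vec_lambda)
      show "(\<lambda>\<omega>. flat k0 (?v i j \<omega>) $ c) \<in> borel_measurable M" for c
        using m[of c] by (cases "c = k0") (simp_all add: flat_def)
    qed
  qed
  have f: "{\<omega> \<in> space M. supp_face (axis k0 1) (64 ^ K) {i} (\<lambda>k. xi (64 ^ K) k \<omega>)} \<in> events" if "i \<le> 64 ^ K" for i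
    using supp_face_xi_measurable[of "{i}" "64 ^ K" _ "\<lambda>k. k"] that by simp
  have d: "{\<omega> \<in> space M. \<bar>?v i j \<omega> $ k0\<bar> \<le>
        R * (norm (flat k0 (?v i j \<omega>)) + 1 / 2 ^ K)} \<in> events" for i j :: nat
    by measurable
  have "{\<omega> \<in> space M. \<exists>i\<in>{..64 ^ K}. supp_face (axis k0 1) (64 ^ K) {i} (\<lambda>k. xi (64 ^ K) k \<omega>) \<and>
     (\<forall>j\<in>{..64 ^ K}. \<bar>?v i j \<omega> $ k0\<bar> \<le>
        R * (norm (flat k0 (?v i j \<omega>)) + 1 / 2 ^ K))} \<in> events"
    using f d by (intro sets.sets_Collect_finite_Ex sets.sets_Collect_conj sets.sets_Collect_finite_All) auto
  then show ?thesis unfolding kink_def by (simp only: atMost_iff Bex_def Ball_def)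
qed

text \<open>Up to a null set, a kink requires either a rough grid point, where a crude union over
  the grid is affordable, or a facet pinched at one of its \<open>Suc r\<close> vertices. In the
  second case every facet keeps its own probability next to the factor from Y, so the sum is
  controlled by the expected number of facets.\<close>

lemma prob_kink_le:
  assumes card: "CARD('n) = r + 2" "r < 64 ^ K" and K: "4 \<le> K" and C: "0 < C" and R: "0 \<le> R"
  shows "prob (kink k0 R K) \<le> (64 ^ K + 1) * (exp_const * exp (- C)) ^ K +
    2 * real (Suc r) * (harm (64 ^ K) ^ r * sqrt (small_prob (R * (32 * C + 2))) ^ K)"
proof -
  define N :: nat where "N = 64 ^ K"
  define \<rho> where "\<rho> = R * (32 * C + 2)"
  have \<rho>: "0 \<le> \<rho>" using R C by (simp add: \<rho>_def)
  have N0: "0 < N" by (simp add: N_def)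
  let ?s = "sqrt (small_prob \<rho>) ^ K"
  have s0: "0 \<le> ?s" using small_prob_nonneg by simp
  define Q where "Q = (SIGMA j:{j \<in> {..<r} \<rightarrow>\<^sub>E {1..N}. sum j {..<r} \<le> N}. {..N - sum j {..<r}})"
  have finP: "finite ({..<r} \<rightarrow>\<^sub>E {1..N})" by (intro finite_PiE) simp_all
  have finQ: "finite Q" unfolding Q_def by (intro finite_SigmaI finite_subset[OF _ finP]) blast+
  define bs where "bs q = block_set (snd q) (fst q) r" for q
  let ?F = "\<lambda>q. prob {\<omega> \<in> space M. supp_face (axis k0 1) N (bs q) (\<lambda>k. xi N k \<omega>)}"
  have bs: "bs q \<subseteq> {..N}" "card (bs q) = Suc r" "finite (bs q)" if "q \<in> Q" for q
  proof -
    obtain j p where jp: "q = (j, p)" by (cases q)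
    then have q: "q = (j, p)" "j \<in> {..<r} \<rightarrow>\<^sub>E {1..N}" "sum j {..<r} \<le> N" "p \<le> N - sum j {..<r}"
      using \<open>q \<in> Q\<close> by (simp_all add: Q_def)
    have jpos: "0 < j l" if "l < r" for l using PiE_mem[OF q(2), of l] that by auto
    show "bs q \<subseteq> {..N}" unfolding bs_def q(1) fst_conv snd_conv using q(3,4) by (intro block_set_subset jpos) auto
    then show "finite (bs q)" using finite_subset by blast
    show "card (bs q) = Suc r" unfolding bs_def q(1) fst_conv snd_conv by (intro card_block_set jpos)
  qed
  define U where "U q = (\<Union>i\<in>bs q. pinched k0 C \<rho> K (bs q) i)" for q
  define W where "W = (\<Union>i\<in>{..N}. rough_at C K i) \<union> (\<Union>q\<in>Q. U q)"
  have mp: "pinched k0 C \<rho> K (bs q) i \<in> events" if "q \<in> Q" "i \<in> bs q" for q i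
  proof (rule pinched_measurable_prob(1)[OF _ _ _ \<rho>])
    show "0 < K" "bs q \<subseteq> {..64 ^ K}" using K bs(1)[OF that(1)] by (simp_all add: N_def)
    then show "i \<le> 64 ^ K" using that(2) by blast
  qed
  have mU: "U q \<in> events" if "q \<in> Q" for q
    unfolding U_def using bs(3)[OF that] mp[OF that] by (intro sets.finite_UN) auto
  have m1: "(\<Union>i\<in>{..N}. rough_at C K i) \<in> events" using rough_at_measurable by (intro sets.finite_UN) auto
  have m2: "(\<Union>q\<in>Q. U q) \<in> events" by (intro sets.finite_UN finQ mU)
  have mW: "W \<in> events"
    unfolding W_def by (intro sets.Un m1 m2)
  have "prob (kink k0 R K) \<le> prob W"
  proof (rule finite_measure_mono_AE[OF _ mW])
    have "AE \<omega> in M. gen_pos (axis k0 1) N (\<lambda>i. xi N i \<omega>)" using card N0 by (intro AE_gen_pos) auto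
    then show "AE \<omega> in M. \<omega> \<in> kink k0 R K \<longrightarrow> \<omega> \<in> W"
    proof eventually_elim
      case (elim \<omega>)
      show ?case
      proof
        assume w: "\<omega> \<in> kink k0 R K"
        show "\<omega> \<in> W"
        proof (cases "\<exists>i\<le>N. \<omega> \<in> rough_at C K i")
          case True
          then show ?thesis by (auto simp: W_def)
        next
          case False
          then obtain J i where J: "J \<subseteq> {..N}" "card J = Suc r" "i \<in> J" "\<omega> \<in> pinched k0 C \<rho> K J i"
            using kink_pinched[OF w elim[unfolded N_def] _ card K C R] unfolding N_def \<rho>_def by metis
          obtain p j where pj: "j \<in> {..<r} \<rightarrow>\<^sub>E {1..N}" "p + sum j {..<r} \<le> N" "J = block_set p j r"
            using block_set_exists[OF J(1,2)] by blast
          have "(j, p) \<in> Q" using pj by (simp add: Q_def)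
          moreover have "bs (j, p) = J" by (simp add: bs_def pj)
          ultimately show ?thesis using J(3,4) unfolding W_def U_def by blast
        qed
      qed
    qed
  qed
  also have "\<dots> \<le> prob (\<Union>i\<in>{..N}. rough_at C K i) + prob (\<Union>q\<in>Q. U q)"
    unfolding W_def by (intro measure_Un_le m1 m2)
  finally have main: "prob (kink k0 R K) \<le> prob (\<Union>i\<in>{..N}. rough_at C K i) + prob (\<Union>q\<in>Q. U q)" .
  have "prob (\<Union>i\<in>{..N}. rough_at C K i) \<le> (\<Sum>i\<in>{..N}. prob (rough_at C K i))"
    using rough_at_measurable by (intro finite_measure_subadditive_finite) auto
  also have "\<dots> \<le> (\<Sum>i\<in>{..N}. (exp_const * exp (- C)) ^ K)"
    by (intro sum_mono prob_rough_at) (auto simp: N_def)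
  also have "\<dots> = (64 ^ K + 1) * (exp_const * exp (- C)) ^ K" by (simp add: N_def algebra_simps)
  finally have part1: "prob (\<Union>i\<in>{..N}. rough_at C K i) \<le> (64 ^ K + 1) * (exp_const * exp (- C)) ^ K" .
  have "prob (\<Union>q\<in>Q. U q) \<le> (\<Sum>q\<in>Q. prob (U q))"
    by (intro finite_measure_subadditive_finite finQ image_subsetI mU)
  also have "\<dots> \<le> (\<Sum>q\<in>Q. real (Suc r) * (?s * ?F q))"
  proof (rule sum_mono)
    fix q assume q: "q \<in> Q"
    have "prob (U q) \<le> (\<Sum>i\<in>bs q. prob (pinched k0 C \<rho> K (bs q) i))"
      unfolding U_def by (intro finite_measure_subadditive_finite image_subsetI bs(3)[OF q] mp[OF q])
    also have "\<dots> \<le> (\<Sum>i\<in>bs q. ?s * ?F q)"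
    proof (rule sum_mono)
      fix i assume i: "i \<in> bs q"
      have "0 < K" "bs q \<subseteq> {..64 ^ K}" using K bs(1)[OF q] by (simp_all add: N_def)
      moreover from this have "i \<le> 64 ^ K" using i by blast
      ultimately show "prob (pinched k0 C \<rho> K (bs q) i) \<le> ?s * ?F q"
        unfolding N_def by (intro pinched_measurable_prob(2) \<rho>)
    qed
    also have "\<dots> = real (Suc r) * (?s * ?F q)"
      using bs(2)[OF q] by simp
    finally show "prob (U q) \<le> real (Suc r) * (?s * ?F q)" .
  qed
  also have "\<dots> = real (Suc r) * ?s * (\<Sum>q\<in>Q. ?F q)"
    by (simp add: sum_distrib_left mult.assoc)
  also have "\<dots> \<le> real (Suc r) * ?s * (2 * harm N ^ r)"
    using sum_prob_faces[OF card(1), of N k0] card(2) s0 unfolding Q_def[symmetric]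
    by (intro mult_left_mono) (auto simp: N_def bs_def split_beta')
  also have "\<dots> = 2 * real (Suc r) * (harm N ^ r * ?s)" by (simp only: mult_ac)
  finally show ?thesis using main part1 unfolding N_def \<rho>_def by linarith
qed

lemma prob_kink_tendsto_0:
  assumes card: "CARD('n) \<ge> 2" and R: "0 \<le> R"
  shows "(\<lambda>K. prob (kink k0 R K)) \<longlonglongrightarrow> 0"
proof -
  define r where "r = CARD('n) - 2"
  have r: "CARD('n) = r + 2" using card by (simp add: r_def)
  have "1 \<le> (2 * exp (1/2::real)) ^ CARD('n)"
    using exp_ge_add_one_self[of "1/2::real"] by (intro one_le_power) linarith
  then have ec: "1 \<le> exp_const" by (simp add: exp_const_def)
  \<comment> \<open>This choice makes the rough part at most 2 (64 / 256)^K = 2 (1/4)^K.\<close>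
  define C where "C = ln (256 * exp_const)"
  have C: "0 < C" using ec by (simp add: C_def ln_gt_zero)
  have ce: "exp_const * exp (- C) = 1/256" using ec by (simp add: C_def exp_minus field_simps)
  define s where "s = sqrt (small_prob (R * (32 * C + 2)))"
  have s: "0 \<le> s" "s < 1" using small_prob_less_1 small_prob_nonneg by (auto simp: s_def)
  let ?h = "\<lambda>K. 2 * (1/4) ^ K + 2 * real (Suc r) * ((1 + ln 64 * real K) ^ r * s ^ K)"
  have "?h \<longlonglongrightarrow> 2 * 0 + 2 * real (Suc r) * 0"
    by (intro tendsto_intros tendsto_poly_times_geometric LIMSEQ_power_zero s) auto
  then have lim: "?h \<longlonglongrightarrow> 0" by simp
  have bound: "prob (kink k0 R K) \<le> ?h K"
    if K: "K \<ge> 4 + r" for K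
  proof -
    have "r < 64 ^ K"
    proof -
      have "r < 2 ^ r" by (rule less_exp)
      also have "\<dots> \<le> 2 ^ K" using K by (intro power_increasing) auto
      also have "\<dots> \<le> 64 ^ K" by (intro power_mono) auto
      finally show ?thesis .
    qed
    then have "prob (kink k0 R K) \<le> (64 ^ K + 1) * (exp_const * exp (- C)) ^ K +
        2 * real (Suc r) * (harm (64 ^ K) ^ r * s ^ K)"
      unfolding s_def using K by (intro prob_kink_le r C R) auto
    also have "\<dots> \<le> ?h K"
    proof (intro add_mono mult_left_mono mult_right_mono power_mono)
      have "(64 ^ K + 1) * (exp_const * exp (- C)) ^ K \<le> (64 ^ K + 64 ^ K) * (1/256::real) ^ K"
        unfolding ce by (intro mult_right_mono add_left_mono) auto
      also have "\<dots> = 2 * (64 * (1/256)) ^ K" unfolding power_mult_distrib by simp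
      finally show "(64 ^ K + 1) * (exp_const * exp (- C)) ^ K \<le> 2 * (1/4) ^ K" by simp
      show "harm (64 ^ K) \<le> 1 + ln 64 * real K"
        using harm_le_ln[of "64 ^ K"] by (simp add: ln_realpow mult.commute)
      show "0 \<le> (harm (64 ^ K) :: real)" by (rule harm_nonneg)
    qed (use s in auto)
    finally show ?thesis .
  qed
  show ?thesis
    by (rule tendsto_sandwich[OF _ _ tendsto_const lim])
      (use bound in \<open>auto simp: eventually_sequentially\<close>)
qed

text \<open>The intersection over all \<open>K \<ge> K0\<close> is at most as likely as each single
  kink event, and these probabilities tend to 0.\<close>

lemma AE_not_always_kink:
  assumes card: "CARD('n) \<ge> 2" and R: "0 \<le> R"
  shows "AE \<omega> in M. \<not> (\<exists>K0. \<forall>K\<ge>K0. \<omega> \<in> kink k0 R K)"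
proof -
  have "AE \<omega> in M. \<not> (\<forall>K\<ge>K0. \<omega> \<in> kink k0 R K)" for K0
  proof -
    let ?I = "\<Inter>K\<in>{K0..}. kink k0 R K"
    have m: "?I \<in> events" using kink_measurable by (intro sets.countable_INT') auto
    have "prob ?I \<le> prob (kink k0 R K)" if "K \<ge> K0" for K
      using that kink_measurable by (intro finite_measure_mono) auto
    then have "prob ?I \<le> 0"
      by (intro LIMSEQ_le_const[OF prob_kink_tendsto_0[OF assms]]) auto
    then have "emeasure M ?I = 0" by (simp add: emeasure_eq_measure measure_le_0_iff)
    then have "?I \<in> null_sets M" using m by auto
    then show ?thesis by (rule AE_I'[of _ M]) auto
  qed
  then have "AE \<omega> in M. \<forall>K0. \<not> (\<forall>K\<ge>K0. \<omega> \<in> kink k0 R K)" by (subst AE_all_countable) blast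
  then show ?thesis by simp
qed

end

section \<open>Corners of the path\<close>

context brownian
begin

text \<open>A positive combination \<open>a\<close> of the two normals is orthogonal to the axis,
  and a grid point \<open>i\<close> maximising it supports the projected hull. Some grid point is
  close to \<open>B t\<close>, so \<open>a\<close> exceeds its value at \<open>S i\<close> by at
  most O(2^-K) at \<open>B t\<close>. Both normals are nonnegative on \<open>B t - S i\<close>,
  hence each is O(2^-K) there, and all displacements from \<open>S i\<close> satisfy both wedge
  inequalities up to this error. The opposite signs of \<open>a1 $ k0\<close> and
  \<open>a2 $ k0\<close> turn them into an upper and a lower bound for the axis component.\<close>

lemma corner_imp_kink:
  assumes sp: "\<omega> \<in> space M" and cont: "continuous_on {0..} (\<lambda>t. B t \<omega>)"
    and dyadic: "\<forall>m\<ge>m0. \<forall>j<4 ^ m. \<forall>c\<in>{1, 2, 3::nat}.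
      norm (B (real (4 * j + c) / 4 ^ Suc m) \<omega> - B (real j / 4 ^ m) \<omega>) \<le> (3/4) ^ m"
    and t: "t \<in> {0..1}" and a1: "a1 $ k0 > 0" and a2: "a2 $ k0 < 0"
    and ne: "a1 $ k0 *\<^sub>R a2 - a2 $ k0 *\<^sub>R a1 \<noteq> 0"
    and corner: "\<forall>s\<in>{0..1}. a1 \<bullet> (B s \<omega> - B t \<omega>) \<le> 0 \<and> a2 \<bullet> (B s \<omega> - B t \<omega>) \<le> 0"
  shows "\<exists>R::nat. \<exists>K0. \<forall>K\<ge>K0. \<omega> \<in> kink k0 (real R) K"
proof -
  define \<alpha> \<beta> where "\<alpha> = - (a2 $ k0)" and "\<beta> = a1 $ k0"
  have pos: "\<alpha> > 0" "\<beta> > 0" using a1 a2 by (auto simp: \<alpha>_def \<beta>_def)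
  define a where "a = \<alpha> *\<^sub>R a1 + \<beta> *\<^sub>R a2"
  have a0: "a \<noteq> 0" using ne by (simp add: a_def \<alpha>_def \<beta>_def algebra_simps)
  have ak: "a \<bullet> axis k0 1 = 0" by (simp add: a_def \<alpha>_def \<beta>_def inner_axis)
  \<comment> \<open>\<open>c / 2 ^ K\<close> is the approximation error
    \<open>norm a * (4 / 2 ^ K)\<close> divided by both weights. The slope is rounded up to a
    natural number, so that countably many slopes suffice.\<close>
  define c where "c = 4 * norm a / (\<alpha> * \<beta>)"
  obtain R :: nat where R: "max c (max (norm a1 / \<beta>) (norm a2 / \<alpha>)) \<le> real R" using real_arch_simple by blast
  have "\<omega> \<in> kink k0 (real R) K" if K: "K \<ge> m0" for K
  proof -
    define N :: nat where "N = 64 ^ K"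
    define S where "S j = B (real j / 64 ^ K) \<omega>" for j
    have S01: "real j / 64 ^ K \<in> {0..1}" if "j \<le> N" for j
    proof -
      have "real j \<le> real N" using that by simp
      then show ?thesis by (simp add: N_def)
    qed
    define j0 where "j0 = nat \<lfloor>4 ^ (3 * K) * t\<rfloor>"
    have tb: "0 \<le> t" "t \<le> 1" using t by auto
    have "norm (B t \<omega> - B (real j0 / 4 ^ (3 * K)) \<omega>) \<le> 4 * (3/4) ^ (3 * K)"
      unfolding j0_def
      by (rule dyadic_approximation[OF cont tb, of m0]) (use dyadic K in auto)
    also have "(3/4::real) ^ (3 * K) = (27/64) ^ K" by (simp add: power_mult power_divide)
    also have "4 * (27/64::real) ^ K \<le> 4 * (1/2) ^ K" by (intro mult_left_mono power_mono) auto
    finally have eps: "norm (B t \<omega> - S j0) \<le> 4 / 2 ^ K" by (simp add: S_def pow64 power_one_over)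
    have j0N: "j0 \<le> N"
    proof -
      have "4 ^ (3 * K) * t \<le> 4 ^ (3 * K)" using tb by simp
      then have "\<lfloor>4 ^ (3 * K) * t\<rfloor> \<le> \<lfloor>4 ^ (3 * K) :: real\<rfloor>" by (rule floor_mono)
      then have "\<lfloor>4 ^ (3 * K) * t\<rfloor> \<le> 4 ^ (3 * K)" by (metis floor_of_int of_int_numeral of_int_power)
      then show ?thesis by (simp add: j0_def N_def pow64 nat_le_iff)
    qed
    obtain i where i: "i \<le> N" "\<And>j. j \<le> N \<Longrightarrow> a \<bullet> S j \<le> a \<bullet> S i"
    proof -
      have "finite ((\<lambda>j. a \<bullet> S j) ` {..N})" "(\<lambda>j. a \<bullet> S j) ` {..N} \<noteq> {}" by auto
      from Max_in[OF this] obtain i where i: "Max ((\<lambda>j. a \<bullet> S j) ` {..N}) = a \<bullet> S i" "i \<in> {..N}"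
        by (rule imageE)
      have "a \<bullet> S j \<le> a \<bullet> S i" if "j \<le> N" for j
        unfolding i(1)[symmetric] using that by (intro Max_ge) simp_all
      then show ?thesis using that i(2) by simp
    qed
    have ps: "psum (\<lambda>k. xi (64 ^ K) k \<omega>) j = S j" for j using psum_xi[OF sp] by (simp add: S_def)
    have "supp_face (axis k0 1) (64 ^ K) {i} (\<lambda>k. xi (64 ^ K) k \<omega>)"
      unfolding supp_face_def ps
    proof (intro exI[of _ "a /\<^sub>R norm a"] conjI ballI allI impI)
      show "norm (a /\<^sub>R norm a) = 1" using a0 by simp
      show "(a /\<^sub>R norm a) \<bullet> axis k0 1 = 0" using ak by simp
      fix j k :: nat assume "j \<in> {i}" "k \<le> 64 ^ K"
      then have "a \<bullet> (S k - S j) \<le> 0" using i(2)[of k] by (simp add: N_def inner_simps)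
      then show "(a /\<^sub>R norm a) \<bullet> (S k - S j) \<le> 0" by (simp add: mult_nonneg_nonpos)
    qed
    moreover have "\<bar>(S j - S i) $ k0\<bar> \<le> real R * (norm (flat k0 (S j - S i)) + 1 / 2 ^ K)" if j: "j \<le> N" for j
    proof -
      define v where "v = S j - S i"
      have split: "x \<bullet> v = x $ k0 * v $ k0 + x \<bullet> flat k0 v" for x
      proof -
        have "v = (v $ k0) *\<^sub>R axis k0 1 + flat k0 v" by (auto simp: vec_eq_iff flat_def axis_def)
        then have "x \<bullet> v = x \<bullet> ((v $ k0) *\<^sub>R axis k0 1 + flat k0 v)" by simp
        then show ?thesis by (simp add: inner_simps inner_axis)
      qed
      have ci: "a1 \<bullet> (S i - B t \<omega>) \<le> 0" "a2 \<bullet> (S i - B t \<omega>) \<le> 0"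
        using corner S01[OF i(1)] by (auto simp: S_def)
      have cj: "a1 \<bullet> (S j - B t \<omega>) \<le> 0" "a2 \<bullet> (S j - B t \<omega>) \<le> 0"
        using corner S01[OF j] by (auto simp: S_def)
      let ?w = "B t \<omega> - S i"
      have "a \<bullet> (B t \<omega> - S j0) \<le> norm a * (4 / 2 ^ K)"
        using norm_cauchy_schwarz[of a "B t \<omega> - S j0"] eps by (meson mult_left_mono norm_ge_zero order_trans)
      then have "a \<bullet> ?w \<le> norm a * (4 / 2 ^ K)" using i(2)[OF j0N] by (simp add: inner_simps)
      then have sum: "\<alpha> * (a1 \<bullet> ?w) + \<beta> * (a2 \<bullet> ?w) \<le> norm a * (4 / 2 ^ K)"
        by (simp only: a_def inner_add_left inner_scaleR_left)
      have nn: "0 \<le> a1 \<bullet> ?w" "0 \<le> a2 \<bullet> ?w" using ci by (simp_all add: inner_simps)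
      have "a1 \<bullet> v \<le> a1 \<bullet> ?w" "a2 \<bullet> v \<le> a2 \<bullet> ?w"
        using cj by (simp_all add: v_def inner_simps)
      then have "\<alpha> * (a1 \<bullet> v) \<le> \<alpha> * (a1 \<bullet> ?w)" "\<beta> * (a2 \<bullet> v) \<le> \<beta> * (a2 \<bullet> ?w)"
        using pos by (auto intro!: mult_left_mono)
      moreover have "0 \<le> \<alpha> * (a1 \<bullet> ?w)" "0 \<le> \<beta> * (a2 \<bullet> ?w)" using nn pos by auto
      ultimately have b: "\<alpha> * (a1 \<bullet> v) \<le> norm a * (4 / 2 ^ K)" "\<beta> * (a2 \<bullet> v) \<le> norm a * (4 / 2 ^ K)"
        using sum by linarith+
      have cab: "norm a * (4 / 2 ^ K) = \<alpha> * \<beta> * (c / 2 ^ K)" using pos by (simp add: c_def)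
      have u1: "\<beta> * v $ k0 \<le> \<beta> * (c / 2 ^ K) + norm a1 * norm (flat k0 v)"
      proof -
        have "\<alpha> * (a1 \<bullet> v) \<le> \<alpha> * (\<beta> * (c / 2 ^ K))" using b(1) unfolding cab by (simp only: mult.assoc)
        then have "a1 \<bullet> v \<le> \<beta> * (c / 2 ^ K)" by (rule mult_left_le_imp_le) (rule pos)
        moreover have "- (norm a1 * norm (flat k0 v)) \<le> a1 \<bullet> flat k0 v"
          using Cauchy_Schwarz_ineq2[of a1 "flat k0 v"] by (simp add: abs_le_iff)
        ultimately show ?thesis using split[of a1] by (simp add: \<beta>_def)
      qed
      have u2: "\<alpha> * (- v $ k0) \<le> \<alpha> * (c / 2 ^ K) + norm a2 * norm (flat k0 v)"
      proof -
        have "\<beta> * (a2 \<bullet> v) \<le> \<beta> * (\<alpha> * (c / 2 ^ K))" using b(2) unfolding cab by (simp only: mult.left_commute mult.assoc)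
        then have "a2 \<bullet> v \<le> \<alpha> * (c / 2 ^ K)" by (rule mult_left_le_imp_le) (rule pos)
        moreover have "- (norm a2 * norm (flat k0 v)) \<le> a2 \<bullet> flat k0 v"
          using Cauchy_Schwarz_ineq2[of a2 "flat k0 v"] by (simp add: abs_le_iff)
        ultimately show ?thesis using split[of a2] by (simp add: \<alpha>_def)
      qed
      have bound: "z \<le> real R * (norm (flat k0 v) + 1 / 2 ^ K)"
        if "\<gamma> > 0" "\<gamma> * z \<le> \<gamma> * (c / 2 ^ K) + n * norm (flat k0 v)" "n / \<gamma> \<le> real R" for \<gamma> z n
      proof -
        have "\<gamma> * z \<le> \<gamma> * (c / 2 ^ K + n / \<gamma> * norm (flat k0 v))"
          using that(1,2) by (simp add: distrib_left)
        then have "z \<le> c / 2 ^ K + n / \<gamma> * norm (flat k0 v)" by (rule mult_left_le_imp_le) (rule that(1))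
        also have "\<dots> \<le> real R * (1 / 2 ^ K) + real R * norm (flat k0 v)"
          using R that(3) by (intro add_mono mult_right_mono) (auto simp: divide_right_mono)
        finally show ?thesis by (simp add: algebra_simps)
      qed
      have 1: "v $ k0 \<le> real R * (norm (flat k0 v) + 1 / 2 ^ K)" using R by (intro bound[OF pos(2) u1]) simp
      have 2: "- v $ k0 \<le> real R * (norm (flat k0 v) + 1 / 2 ^ K)" using R by (intro bound[OF pos(1) u2]) simp
      show ?thesis using 1 2 unfolding v_def[symmetric] by (simp add: abs_le_iff)
    qed
    ultimately show ?thesis
      unfolding kink_def using sp i(1) by (auto simp: S_def N_def)
  qed
  then show ?thesis by blast
qed

lemma AE_no_corner:
  assumes card: "CARD('n) \<ge> 2"
  shows "AE \<omega> in M. \<forall>t\<in>{0..1}. \<forall>a1 a2. a1 $ k0 > 0 \<longrightarrow> a2 $ k0 < 0 \<longrightarrow>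
    (\<forall>s\<in>{0..1}. a1 \<bullet> (B s \<omega> - B t \<omega>) \<le> 0 \<and> a2 \<bullet> (B s \<omega> - B t \<omega>) \<le> 0) \<longrightarrow>
    a1 $ k0 *\<^sub>R a2 - a2 $ k0 *\<^sub>R a1 = 0"
proof -
  have "AE \<omega> in M. \<forall>R::nat. \<not> (\<exists>K0. \<forall>K\<ge>K0. \<omega> \<in> kink k0 (real R) K)"
    using AE_not_always_kink[OF card] by (subst AE_all_countable) simp
  then show ?thesis
    using B_continuous AE_dyadic_increments AE_space
  proof eventually_elim
    case (elim \<omega>)
    from elim(3) obtain m0 where m0: "\<forall>m\<ge>m0. \<forall>j<4 ^ m. \<forall>c\<in>{1, 2, 3::nat}.
      norm (B (real (4 * j + c) / 4 ^ Suc m) \<omega> - B (real j / 4 ^ m) \<omega>) \<le> (3/4) ^ m" by blast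
    show ?case
    proof (intro ballI allI impI, rule ccontr)
      fix t a1 a2 assume "t \<in> {0..1}" "0 < a1 $ k0" "a2 $ k0 < 0"
        "\<forall>s\<in>{0..1}. a1 \<bullet> (B s \<omega> - B t \<omega>) \<le> 0 \<and> a2 \<bullet> (B s \<omega> - B t \<omega>) \<le> 0"
        "a1 $ k0 *\<^sub>R a2 - a2 $ k0 *\<^sub>R a1 \<noteq> 0"
      from corner_imp_kink[OF elim(4,2) m0 this(1,2,3,5,4)] elim(1) show False by blast
    qed
  qed
qed

end

lemma AE_no_corner_direction:
  fixes B :: "real \<Rightarrow> 'w \<Rightarrow> real ^ 'n" and e :: "real ^ 'n"
  assumes card: "CARD('n) \<ge> 2" and B: "standard_brownian_motion M B" and e: "e \<noteq> 0"
  shows "AE \<omega> in M. \<forall>t\<in>{0..1}. \<forall>a1 a2. a1 \<bullet> e > 0 \<longrightarrow> a2 \<bullet> e < 0 \<longrightarrow>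
    (\<forall>s\<in>{0..1}. a1 \<bullet> (B s \<omega> - B t \<omega>) \<le> 0 \<and> a2 \<bullet> (B s \<omega> - B t \<omega>) \<le> 0) \<longrightarrow>
    (a1 \<bullet> e) *\<^sub>R a2 - (a2 \<bullet> e) *\<^sub>R a1 = 0"
proof -
  \<comment> \<open>This only names an arbitrary coordinate, to whose axis \<open>e\<close> is
    rotated.\<close>
  obtain k0 :: 'n where True by simp
  have "norm (e /\<^sub>R norm e) = norm (axis k0 1 :: real ^ 'n)" using e by simp
  then obtain f :: "real ^ 'n \<Rightarrow> real ^ 'n" where f: "orthogonal_transformation f" "f (e /\<^sub>R norm e) = axis k0 1"
    using orthogonal_transformation_exists by blast
  have lin: "linear f" using f by (simp add: orthogonal_transformation_linear)
  have inner: "f x \<bullet> f y = x \<bullet> y" for x y using f(1) by (simp add: orthogonal_transformation_def)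
  interpret brownian M "\<lambda>t \<omega>. f (B t \<omega>)"
  proof -
    have "prob_space M" using B by (simp add: standard_brownian_motion_def)
    then show "brownian M (\<lambda>t \<omega>. f (B t \<omega>))"
      unfolding brownian_def brownian_axioms_def using standard_brownian_motion_orthogonal[OF B f(1)] by simp
  qed
  have comp: "f x $ k0 = (x \<bullet> e) / norm e" for x
  proof -
    have "f x $ k0 = f x \<bullet> f (e /\<^sub>R norm e)" unfolding f(2) by (simp add: inner_axis)
    then show ?thesis by (simp add: inner divide_inverse_commute)
  qed
  show ?thesis
    using AE_no_corner[OF card, of k0]
  proof eventually_elim
    case (elim \<omega>)
    show ?case
    proof (intro ballI allI impI)
      fix t a1 a2 assume t: "t \<in> {0..1::real}" and a: "0 < a1 \<bullet> e" "a2 \<bullet> e < 0"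
        and c: "\<forall>s\<in>{0..1}. a1 \<bullet> (B s \<omega> - B t \<omega>) \<le> 0 \<and> a2 \<bullet> (B s \<omega> - B t \<omega>) \<le> 0"
      have "f a1 $ k0 *\<^sub>R f a2 - f a2 $ k0 *\<^sub>R f a1 = 0"
      proof (rule elim[rule_format, OF t])
        show "0 < f a1 $ k0" "f a2 $ k0 < 0" using a e by (auto simp: comp divide_neg_pos)
        show "f a1 \<bullet> (f (B s \<omega>) - f (B t \<omega>)) \<le> 0 \<and> f a2 \<bullet> (f (B s \<omega>) - f (B t \<omega>)) \<le> 0" if "s \<in> {0..1}" for s
          using c that by (simp add: linear_diff[OF lin, symmetric] inner)
      qed
      then have "f ((a1 \<bullet> e / norm e) *\<^sub>R a2 - (a2 \<bullet> e / norm e) *\<^sub>R a1) = 0"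
        by (simp add: linear_diff[OF lin] linear_scale[OF lin] comp)
      then have "(a1 \<bullet> e / norm e) *\<^sub>R a2 - (a2 \<bullet> e / norm e) *\<^sub>R a1 = 0"
        using orthogonal_transformation_norm[OF f(1)] by (metis norm_eq_zero)
      then have "norm e *\<^sub>R ((a1 \<bullet> e / norm e) *\<^sub>R a2 - (a2 \<bullet> e / norm e) *\<^sub>R a1) = 0" by simp
      then show "(a1 \<bullet> e) *\<^sub>R a2 - (a2 \<bullet> e) *\<^sub>R a1 = 0" using e by (simp add: scaleR_diff_right)
    qed
  qed
qed

section \<open>Smoothness of the hull from the absence of corners\<close>

lemma hyperplane_eqI:
  fixes a b :: "'a::real_inner"
  assumes "c \<noteq> 0" "b = c *\<^sub>R a"
  shows "{y. a \<bullet> y = a \<bullet> x} = {y. b \<bullet> y = b \<bullet> x}"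
  using assms by auto

text \<open>If two normals support the hull at \<open>x\<close>, their sum is at least as large at
  some point \<open>p t\<close> of the path as at \<open>x\<close>, so both are maximal at
  \<open>p t\<close>. If they are not parallel, they have opposite signs on some direction; this is
  an open condition, so the direction can be taken from \<open>D\<close>.\<close>

lemma smooth_convex_hull_pathI:
  fixes p :: "real \<Rightarrow> 'a::euclidean_space"
  assumes cont: "continuous_on {0..1} p" and dense: "closure D = UNIV"
    and no_corner: "\<And>e t a1 a2. e \<in> D \<Longrightarrow> t \<in> {0..1} \<Longrightarrow> a1 \<bullet> e > 0 \<Longrightarrow> a2 \<bullet> e < 0 \<Longrightarrow>
      (\<forall>s\<in>{0..1}. a1 \<bullet> (p s - p t) \<le> 0 \<and> a2 \<bullet> (p s - p t) \<le> 0) \<Longrightarrow> (a1 \<bullet> e) *\<^sub>R a2 - (a2 \<bullet> e) *\<^sub>R a1 = 0"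
  shows "smooth_convex (convex hull (p ` {0..1}))"
proof -
  let ?K = "convex hull (p ` {0..1})"
  have comp: "compact ?K" by (intro compact_convex_hull compact_continuous_image cont) simp
  show ?thesis
    unfolding smooth_convex_def
  proof (intro ballI ex_ex1I)
    fix x assume x: "x \<in> frontier ?K"
    then have xK: "x \<in> ?K" using comp compact_imp_closed frontier_subset_closed by blast
    show "\<exists>H. supporting_hyperplane_at ?K x H"
    proof -
      have xi: "x \<notin> interior ?K" using x by (simp add: frontier_def)
      \<comment> \<open>A hull with empty interior lies in a hyperplane, which supports it at each
        of its points; otherwise the interior and the relative interior agree.\<close>
      have "\<exists>a. a \<noteq> 0 \<and> (\<forall>y\<in>?K. a \<bullet> x \<le> a \<bullet> y)"
      proof (cases "interior ?K = {}")
        case True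
        then obtain a b where ab: "a \<noteq> 0" "?K \<subseteq> {x. a \<bullet> x = b}"
          using empty_interior_subset_hyperplane[OF convex_convex_hull] by metis
        have "a \<bullet> y = b" if "y \<in> ?K" for y using ab(2) that by blast
        then show ?thesis using ab(1) xK by (metis order_refl)
      next
        case False
        then have "x \<notin> rel_interior ?K" using xi rel_interior_nonempty_interior by blast
        then show ?thesis
          using supporting_hyperplane_rel_boundary[OF convex_convex_hull xK] by metis
      qed
      then obtain a where "a \<noteq> 0" "\<And>y. y \<in> ?K \<Longrightarrow> a \<bullet> x \<le> a \<bullet> y" by blast
      then show ?thesis unfolding supporting_hyperplane_at_def
        by (intro exI[of _ "{y. (- a) \<bullet> y = (- a) \<bullet> x}"] exI[of _ "- a"]) auto
    qed
    fix H1 H2 assume "supporting_hyperplane_at ?K x H1" "supporting_hyperplane_at ?K x H2"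
    then obtain a1 a2 where a1: "a1 \<noteq> 0" "H1 = {y. a1 \<bullet> y = a1 \<bullet> x}" "\<forall>y\<in>?K. a1 \<bullet> y \<le> a1 \<bullet> x"
      and a2: "a2 \<noteq> 0" "H2 = {y. a2 \<bullet> y = a2 \<bullet> x}" "\<forall>y\<in>?K. a2 \<bullet> y \<le> a2 \<bullet> x"
      unfolding supporting_hyperplane_at_def by blast
    have sub: "p s \<in> ?K" if "s \<in> {0..1}" for s by (rule hull_inc[OF imageI[OF that]])
    have "\<exists>t\<in>{0..1}. (a1 + a2) \<bullet> x \<le> (a1 + a2) \<bullet> p t"
    proof (rule ccontr)
      assume "\<not> ?thesis"
      then have "p ` {0..1} \<subseteq> {y. (a1 + a2) \<bullet> y < (a1 + a2) \<bullet> x}" by (auto simp: not_le)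
      then have "?K \<subseteq> {y. (a1 + a2) \<bullet> y < (a1 + a2) \<bullet> x}" by (intro hull_minimal convex_halfspace_lt)
      then show False using xK by blast
    qed
    then obtain t where t: "t \<in> {0..1}" "(a1 + a2) \<bullet> x \<le> (a1 + a2) \<bullet> p t" by blast
    have "a1 \<bullet> p t \<le> a1 \<bullet> x" "a2 \<bullet> p t \<le> a2 \<bullet> x" using a1(3) a2(3) sub[OF t(1)] by auto
    then have eq: "a1 \<bullet> p t = a1 \<bullet> x" "a2 \<bullet> p t = a2 \<bullet> x" using t(2) by (auto simp: inner_simps)
    have corner: "\<forall>s\<in>{0..1}. a1 \<bullet> (p s - p t) \<le> 0 \<and> a2 \<bullet> (p s - p t) \<le> 0"
      using a1(3) a2(3) sub eq by (auto simp: inner_simps)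
    show "H1 = H2"
    proof (cases "\<exists>c. c \<noteq> 0 \<and> a2 = c *\<^sub>R a1")
      case True
      then show ?thesis unfolding a1(2) a2(2) using hyperplane_eqI by blast
    next
      case False
      \<comment> \<open>On the difference of the unit normals the two functionals have opposite
        signs, because Cauchy-Schwarz is strict unless the normals are positive multiples of each
        other.\<close>
      define e0 where "e0 = a1 /\<^sub>R norm a1 - a2 /\<^sub>R norm a2"
      have ne: "a1 \<bullet> a2 < norm a1 * norm a2"
      proof -
        have "a1 \<bullet> a2 \<noteq> norm a1 * norm a2"
        proof
          assume "a1 \<bullet> a2 = norm a1 * norm a2"
          then have "norm a1 *\<^sub>R a2 = norm a2 *\<^sub>R a1" by (simp add: norm_cauchy_schwarz_eq)
          then have "a2 = (norm a2 / norm a1) *\<^sub>R a1"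
            using a1(1) by (metis divide_inverse_commute left_inverse norm_eq_zero scaleR_one scaleR_scaleR)
          then show False using False a1(1) a2(1) by (metis divide_eq_0_iff norm_eq_zero)
        qed
        then show ?thesis using norm_cauchy_schwarz[of a1 a2] by simp
      qed
      have n: "norm a1 > 0" "norm a2 > 0" using a1 a2 by auto
      have e1: "a1 \<bullet> e0 > 0"
      proof -
        have "a1 \<bullet> e0 = (norm a1 * norm a2 - a1 \<bullet> a2) / norm a2"
          using n by (simp add: e0_def inner_simps dot_square_norm power2_eq_square divide_simps)
        then show ?thesis using ne n by simp
      qed
      have e2: "a2 \<bullet> e0 < 0"
      proof -
        have "a2 \<bullet> e0 = - (norm a1 * norm a2 - a1 \<bullet> a2) / norm a1"
          using n by (simp add: e0_def inner_simps inner_commute[of a2 a1] dot_square_norm power2_eq_square divide_simps)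
        then show ?thesis using ne n by (simp add: divide_neg_pos)
      qed
      let ?O = "{e. a1 \<bullet> e > 0} \<inter> {e. a2 \<bullet> e < 0}"
      have "open ?O"
        by (intro open_Int open_halfspace_gt open_halfspace_lt)
      moreover have "e0 \<in> ?O" using e1 e2 by simp
      ultimately obtain e where e: "e \<in> D" "a1 \<bullet> e > 0" "a2 \<bullet> e < 0"
        using dense open_Int_closure_eq_empty[of ?O D] by auto
      have "(a1 \<bullet> e) *\<^sub>R a2 - (a2 \<bullet> e) *\<^sub>R a1 = 0" by (rule no_corner[OF e(1) t(1) e(2,3) corner])
      then have "(a1 \<bullet> e) *\<^sub>R a2 = (a2 \<bullet> e) *\<^sub>R a1" by simp
      then have "a2 = ((a2 \<bullet> e) / (a1 \<bullet> e)) *\<^sub>R a1"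
        using e(2) by (metis divide_inverse_commute left_inverse less_irrefl scaleR_one scaleR_scaleR)
      then show ?thesis using False e by (metis divide_eq_0_iff less_irrefl)
    qed
  qed
qed

theorem theorem1:
  fixes M :: "'w measure" and B :: "real \<Rightarrow> 'w \<Rightarrow> real ^ 'n"
  assumes "CARD('n) \<ge> 2"
    and "standard_brownian_motion M B"
  shows "AE \<omega> in M. smooth_convex (convex hull ((\<lambda>t. B t \<omega>) ` {0..1}))"
proof -
  obtain D :: "(real ^ 'n) set" where D: "countable D" "closure D = UNIV"
    using separable[of "UNIV :: (real ^ 'n) set"] by (metis top.extremum_uniqueI)
  have "AE \<omega> in M. \<forall>e\<in>D. \<forall>t\<in>{0..1}. \<forall>a1 a2. a1 \<bullet> e > 0 \<longrightarrow> a2 \<bullet> e < 0 \<longrightarrow>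
    (\<forall>s\<in>{0..1}. a1 \<bullet> (B s \<omega> - B t \<omega>) \<le> 0 \<and> a2 \<bullet> (B s \<omega> - B t \<omega>) \<le> 0) \<longrightarrow>
    (a1 \<bullet> e) *\<^sub>R a2 - (a2 \<bullet> e) *\<^sub>R a1 = 0" (is "AE \<omega> in M. \<forall>e\<in>D. ?P \<omega> e")
  proof -
    have "AE \<omega> in M. ?P \<omega> e" for e
      using AE_no_corner_direction[OF assms] by (cases "e = 0") auto
    then show ?thesis using D(1) by (subst AE_ball_countable) auto
  qed
  moreover have "AE \<omega> in M. continuous_on {0..} (\<lambda>t. B t \<omega>)"
    using assms(2) by (simp add: standard_brownian_motion_def)
  ultimately show ?thesis
  proof eventually_elim
    case (elim \<omega>)
    have "continuous_on {0..1} (\<lambda>t. B t \<omega>)" using elim(2) by (rule continuous_on_subset) auto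
    then show ?case by (rule smooth_convex_hull_pathI[OF _ D(2)]) (use elim(1) in blast)
  qed
qed

end
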